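(* Let $\mathcal{C}$ be a model category with class of weak equivalences $\mathcal{W}$, let $\mathcal{C}_{fc}$ be its full subcategory of objects that are both fibrant and cofibrant, and let $\mathcal{W}_{fc}=\mathcal{W}\cap\mathcal{C}_{fc}$. Then the inclusion $i:\mathcal{C}_{fc}\to\mathcal{H}o(\mathcal{C}_{fc})$ into the homotopy 2-category of $(\mathcal{C}_{fc},\mathcal{W}_{fc})$ is the 2-localization, in the strict sense, of $\mathcal{C}_{fc}$ at the class $\mathcal{W}_{fc}$. Furthermore, for every 2-category $\mathcal{D}$, the precomposition 2-functors $$i^*: Hom_s(\mathcal{H}o(\mathcal{C}_{fc}),\mathcal{D})\longrightarrow Hom_{s}(\mathcal{C}_{fc},\mathcal{D})_+ ,\qquad i^*: Hom_p(\mathcal{H}o(\mathcal{C}_{fc}),\mathcal{D})\longrightarrow Hom_{p}(\mathcal{C}_{fc},\mathcal{D})_+$$ are both isomorphisms of 2-categories.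
   Context: Model category means Quillen's closed model category: finite limits and colimits, lifting axioms, the three classes closed under retracts and composition and containing identities, (not necessarily functorial) factorizations (cofibration, trivial fibration) and (trivial cofibration, fibration), and 3-for-2 for weak equivalences. Conventions. A category is regarded as a 2-category with only identity 2-cells; an arrow is identified with its identity 2-cell; horizontal composition is juxtaposition, vertical composition is $\circ$. An arrow $f:X\to Y$ of a 2-category is an equivalence if there are $g:Y\to X$ and invertible 2-cells $id_X\Rightarrow gf$, $fg\Rightarrow id_Y$. $Hom_p(\mathcal{B},\mathcal{D})$ is the 2-category of (strict) 2-functors $\mathcal{B}\to\mathcal{D}$, pseudonatural transformations (with invertible structure 2-cells) and modifications; $Hom_s(\mathcal{B},\mathcal{D})$ is the same with only 2-natural transformations as arrows. The subscript $+$ denotes the full sub-2-category on the 2-functors sending weak equivalences to equivalences. A 2-functor $F:\mathcal{B}\to\mathcal{B}'$ is a pseudoequivalence (resp. in the strict sense) if there are a 2-functor $G:\mathcal{B}'\to\mathcal{B}$ and pseudonatural (resp. 2-natural) transformations $Id\Rightarrow GF$, $FG\Rightarrow Id$ that are equivalences in $Hom_p$ (resp. $Hom_s$) of endo-2-functors. A 2-localization of $\mathcal{A}$ at $\Sigma$ is a 2-functor $q:\mathcal{A}\to\mathcal{A}[\Sigma^{-1}]$ sending $\Sigma$ to equivalences and such that $q^*:Hom_p(\mathcal{A}[\Sigma^{-1}],\mathcal{D})\to Hom_p(\mathcal{A},\mathcal{D})_+$ is a pseudoequivalence for every 2-category $\mathcal{D}$ ("in the strict sense": a pseudoequivalence in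 the strict sense). The homotopy 2-category $\mathcal{H}o(\mathcal{A})$ of a category $\mathcal{A}$ with a class $\Sigma$ of arrows containing identities (here $\mathcal{A}=\mathcal{C}_{fc}$, $\Sigma=\mathcal{W}_{fc}$). A cylinder $C=(W,Z,d_0,d_1,s,x)$ for an object $X$ consists of arrows $d_0,d_1:X\to W$, $s:W\to Z$, $x:X\to Z$ of $\mathcal{A}$ with $s\in\Sigma$ and $sd_0=sd_1=x$. A homotopy $H=(C,h)$ from $f$ to $g$ ($f,g:X\to Y$) is a cylinder $C$ for $X$ with an arrow $h:W\to Y$ such that $hd_0=f$, $hd_1=g$. If $F:\mathcal{A}\to\mathcal{D}$ is a 2-functor into a 2-category sending $\Sigma$ to equivalences, there is a unique 2-cell $\widehat{FC}:Fd_0\Rightarrow Fd_1$ with $Fs\,\widehat{FC}=Fx$ (the identity 2-cell); put $\widehat{FH}=Fh\,\widehat{FC}:Ff\Rightarrow Fg$. $\mathcal{H}o(\mathcal{A})$ has the objects and arrows of $\mathcal{A}$. A 2-cell $f\Rightarrow g$ is a class $[H_n,\dots,H_1]$ of a finite sequence of composable homotopies from $f$ to $g$, where two sequences $(H_n,\dots,H_1)$, $(K_m,\dots,K_1)$ are equivalent iff $\widehat{FH_n}\circ\cdots\circ\widehat{FH_1}=\widehat{FK_m}\circ\cdots\circ\widehat{FK_1}$ for every 2-category $\mathcal{D}$ and every 2-functor $F:\mathcal{A}\to\mathcal{D}$ sending $\Sigma$ to equivalences. Vertical composition is juxtaposition of sequences; the identity of $f$ is the class of the homotopy with cylinder $(X,X,id,id,id,id)$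 and $h=f$. Whiskering is $r[H]=[(C,rh)]$ and $[H]l=[(Cl,h)]$ with $Cl=(W,Z,d_0l,d_1l,s,xl)$, extended termwise to sequences; this determines horizontal composition. $i$ is the identity on objects and arrows. *)

theory Defs
  imports "HOL-Library.FuncSet"
begin

section \<open>Categories and 2-categories\<close>

text \<open>Operations are only meaningful on the carrier sets; their values elsewhere are irrelevant.
  \<open>Comp C g f\<close> is \<open>f\<close> followed by \<open>g\<close>, and similarly for \<open>VComp\<close> and \<open>HComp\<close>.\<close>

record ('o, 'a) cat =
  Obj :: "'o set"
  Arr :: "'a set"
  Dom :: "'a \<Rightarrow> 'o"
  Cod :: "'a \<Rightarrow> 'o"
  Ide :: "'o \<Rightarrow> 'a"
  Comp :: "'a \<Rightarrow> 'a \<Rightarrow> 'a"  (infixr "\<cdot>\<index>" 75)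

record ('o, 'a, 'c) twocat = "('o, 'a) cat" +
  Cell :: "'c set"
  Src :: "'c \<Rightarrow> 'a"
  Trg :: "'c \<Rightarrow> 'a"
  IdC :: "'a \<Rightarrow> 'c"
  VComp :: "'c \<Rightarrow> 'c \<Rightarrow> 'c"  (infixr "\<bullet>\<index>" 65)
  HComp :: "'c \<Rightarrow> 'c \<Rightarrow> 'c"  (infixr "\<star>\<index>" 70)

definition hom :: "('o, 'a, 'm) cat_scheme \<Rightarrow> 'o \<Rightarrow> 'o \<Rightarrow> 'a set" where
  "hom C X Y = {f \<in> Arr C. Dom C f = X \<and> Cod C f = Y}"

definition hom2 :: "('o, 'a, 'c, 'm) twocat_scheme \<Rightarrow> 'a \<Rightarrow> 'a \<Rightarrow> 'c set" where
  "hom2 D f g = {\<alpha> \<in> Cell D. Src D \<alpha> = f \<and> Trg D \<alpha> = g}"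

locale category =
  fixes C :: "('o, 'a, 'm) cat_scheme" (structure)
  assumes dom_closed: "f \<in> Arr C \<Longrightarrow> Dom C f \<in> Obj C"
    and cod_closed: "f \<in> Arr C \<Longrightarrow> Cod C f \<in> Obj C"
    and ide_hom: "X \<in> Obj C \<Longrightarrow> Ide C X \<in> hom C X X"
    and comp_hom: "\<lbrakk>f \<in> hom C X Y; g \<in> hom C Y Z\<rbrakk> \<Longrightarrow> g \<cdot> f \<in> hom C X Z"
    and comp_ide: "f \<in> Arr C \<Longrightarrow> f \<cdot> Ide C (Dom C f) = f"
    and ide_comp: "f \<in> Arr C \<Longrightarrow> Ide C (Cod C f) \<cdot> f = f"
    and comp_assoc: "\<lbrakk>f \<in> hom C X Y; g \<in> hom C Y Z; h \<in> hom C Z U\<rbrakk>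
          \<Longrightarrow> (h \<cdot> g) \<cdot> f = h \<cdot> (g \<cdot> f)"

locale two_category = category D
  for D :: "('o, 'a, 'c, 'm) twocat_scheme" (structure) +
  assumes src_closed: "\<alpha> \<in> Cell D \<Longrightarrow> Src D \<alpha> \<in> Arr D"
    and trg_parallel: "\<alpha> \<in> Cell D \<Longrightarrow>
          Trg D \<alpha> \<in> hom D (Dom D (Src D \<alpha>)) (Cod D (Src D \<alpha>))"
    and idc_hom: "f \<in> Arr D \<Longrightarrow> IdC D f \<in> hom2 D f f"
    and vcomp_hom: "\<lbrakk>\<alpha> \<in> hom2 D f g; \<beta> \<in> hom2 D g h\<rbrakk> \<Longrightarrow> \<beta> \<bullet> \<alpha> \<in> hom2 D f h"
    and vcomp_idc: "\<alpha> \<in> Cell D \<Longrightarrow> \<alpha> \<bullet> IdC D (Src D \<alpha>) = \<alpha>"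
    and idc_vcomp: "\<alpha> \<in> Cell D \<Longrightarrow> IdC D (Trg D \<alpha>) \<bullet> \<alpha> = \<alpha>"
    and vcomp_assoc: "\<lbrakk>\<alpha> \<in> hom2 D f g; \<beta> \<in> hom2 D g h; \<gamma> \<in> hom2 D h k\<rbrakk>
          \<Longrightarrow> (\<gamma> \<bullet> \<beta>) \<bullet> \<alpha> = \<gamma> \<bullet> (\<beta> \<bullet> \<alpha>)"
    and hcomp_hom: "\<lbrakk>\<alpha> \<in> hom2 D f f'; \<beta> \<in> hom2 D g g'; Dom D g = Cod D f\<rbrakk>
          \<Longrightarrow> \<beta> \<star> \<alpha> \<in> hom2 D (g \<cdot> f) (g' \<cdot> f')"
    and hcomp_idc: "\<alpha> \<in> Cell D \<Longrightarrow> \<alpha> \<star> IdC D (Ide D (Dom D (Src D \<alpha>))) = \<alpha>"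
    and idc_hcomp: "\<alpha> \<in> Cell D \<Longrightarrow> IdC D (Ide D (Cod D (Src D \<alpha>))) \<star> \<alpha> = \<alpha>"
    and hcomp_assoc: "\<lbrakk>\<alpha> \<in> hom2 D f f'; \<beta> \<in> hom2 D g g'; \<gamma> \<in> hom2 D h h';
            Dom D g = Cod D f; Dom D h = Cod D g\<rbrakk>
          \<Longrightarrow> (\<gamma> \<star> \<beta>) \<star> \<alpha> = \<gamma> \<star> (\<beta> \<star> \<alpha>)"
    and idc_comp: "\<lbrakk>f \<in> hom D X Y; g \<in> hom D Y Z\<rbrakk> \<Longrightarrow> IdC D g \<star> IdC D f = IdC D (g \<cdot> f)"
    and interchange: "\<lbrakk>\<alpha> \<in> hom2 D f f'; \<alpha>' \<in> hom2 D f' f''; \<beta> \<in> hom2 D g g'; \<beta>' \<in> hom2 D g' g'';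
            Dom D g = Cod D f\<rbrakk>
          \<Longrightarrow> (\<beta>' \<bullet> \<beta>) \<star> (\<alpha>' \<bullet> \<alpha>) = (\<beta>' \<star> \<alpha>') \<bullet> (\<beta> \<star> \<alpha>)"

text \<open>A category as a 2-category with only identity 2-cells: the 2-cells are the arrows themselves.\<close>

definition disc :: "('o, 'a) cat \<Rightarrow> ('o, 'a, 'a) twocat" where
  "disc C = \<lparr>Obj = Obj C, Arr = Arr C, Dom = Dom C, Cod = Cod C, Ide = Ide C, Comp = Comp C,
     Cell = Arr C, Src = (\<lambda>f. f), Trg = (\<lambda>f. f), IdC = (\<lambda>f. f),
     VComp = (\<lambda>g f. f), HComp = Comp C\<rparr>"

definition op_cat :: "('o, 'a) cat \<Rightarrow> ('o, 'a) cat" where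
  "op_cat C = C\<lparr>Dom := Cod C, Cod := Dom C, Comp := (\<lambda>g f. Comp C f g)\<rparr>"

definition full_subcat :: "('o, 'a) cat \<Rightarrow> 'o set \<Rightarrow> ('o, 'a) cat" where
  "full_subcat C S = C\<lparr>Obj := Obj C \<inter> S,
     Arr := {f \<in> Arr C. Dom C f \<in> S \<and> Cod C f \<in> S}\<rparr>"

definition invertible :: "('o, 'a, 'c, 'm) twocat_scheme \<Rightarrow> 'c \<Rightarrow> bool" where
  "invertible D \<alpha> \<longleftrightarrow> \<alpha> \<in> Cell D \<and>
     (\<exists>\<beta> \<in> hom2 D (Trg D \<alpha>) (Src D \<alpha>).
        \<beta> \<bullet>\<^bsub>D\<^esub> \<alpha> = IdC D (Src D \<alpha>) \<and> \<alpha> \<bullet>\<^bsub>D\<^esub> \<beta> = IdC D (Trg D \<alpha>))"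

definition equivalence :: "('o, 'a, 'c, 'm) twocat_scheme \<Rightarrow> 'a \<Rightarrow> bool" where
  "equivalence D f \<longleftrightarrow> f \<in> Arr D \<and>
     (\<exists>g \<in> hom D (Cod D f) (Dom D f).
        (\<exists>\<eta> \<in> hom2 D (Ide D (Dom D f)) (g \<cdot>\<^bsub>D\<^esub> f). invertible D \<eta>) \<and>
        (\<exists>\<epsilon> \<in> hom2 D (f \<cdot>\<^bsub>D\<^esub> g) (Ide D (Cod D f)). invertible D \<epsilon>))"


section \<open>Functors and 2-functors\<close>

record ('o, 'a, 'p, 'b) fun1 =
  FObj :: "'o \<Rightarrow> 'p"
  FArr :: "'a \<Rightarrow> 'b"

record ('o, 'a, 'c, 'p, 'b, 'd) fun2 = "('o, 'a, 'p, 'b) fun1" +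
  FCell :: "'c \<Rightarrow> 'd"

definition is_functor ::
  "('o, 'a, 'm) cat_scheme \<Rightarrow> ('p, 'b, 'n) cat_scheme \<Rightarrow> ('o, 'a, 'p, 'b, 'k) fun1_scheme \<Rightarrow> bool"
where
  "is_functor B D F \<longleftrightarrow>
     (\<forall>X \<in> Obj B. FObj F X \<in> Obj D) \<and>
     (\<forall>f \<in> Arr B. FArr F f \<in> hom D (FObj F (Dom B f)) (FObj F (Cod B f))) \<and>
     (\<forall>X \<in> Obj B. FArr F (Ide B X) = Ide D (FObj F X)) \<and>
     (\<forall>f \<in> Arr B. \<forall>g \<in> Arr B. Dom B g = Cod B f \<longrightarrow>
        FArr F (g \<cdot>\<^bsub>B\<^esub> f) = FArr F g \<cdot>\<^bsub>D\<^esub> FArr F f)"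

text \<open>The three maps are required to be extensional (\<open>undefined\<close> off the carriers), so that
  equality of 2-functors is equality of records. The same convention is used for
  transformations and modifications.\<close>

definition two_functor ::
  "('o, 'a, 'c, 'm) twocat_scheme \<Rightarrow> ('p, 'b, 'd, 'n) twocat_scheme
    \<Rightarrow> ('o, 'a, 'c, 'p, 'b, 'd) fun2 \<Rightarrow> bool"
where
  "two_functor B D F \<longleftrightarrow> is_functor B D F \<and>
     (\<forall>\<alpha> \<in> Cell B. FCell F \<alpha> \<in> hom2 D (FArr F (Src B \<alpha>)) (FArr F (Trg B \<alpha>))) \<and>
     (\<forall>f \<in> Arr B. FCell F (IdC B f) = IdC D (FArr F f)) \<and>
     (\<forall>\<alpha> \<in> Cell B. \<forall>\<beta> \<in> Cell B. Src B \<beta> = Trg B \<alpha> \<longrightarrow>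
        FCell F (\<beta> \<bullet>\<^bsub>B\<^esub> \<alpha>) = FCell F \<beta> \<bullet>\<^bsub>D\<^esub> FCell F \<alpha>) \<and>
     (\<forall>\<alpha> \<in> Cell B. \<forall>\<beta> \<in> Cell B. Dom B (Src B \<beta>) = Cod B (Src B \<alpha>) \<longrightarrow>
        FCell F (\<beta> \<star>\<^bsub>B\<^esub> \<alpha>) = FCell F \<beta> \<star>\<^bsub>D\<^esub> FCell F \<alpha>) \<and>
     FObj F \<in> extensional (Obj B) \<and> FArr F \<in> extensional (Arr B) \<and>
     FCell F \<in> extensional (Cell B)"

definition id_fun2 :: "('o, 'a, 'c, 'm) twocat_scheme \<Rightarrow> ('o, 'a, 'c, 'o, 'a, 'c) fun2" where
  "id_fun2 B = \<lparr>FObj = (\<lambda>X\<in>Obj B. X), FArr = (\<lambda>f\<in>Arr B. f), FCell = (\<lambda>\<alpha>\<in>Cell B. \<alpha>)\<rparr>"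

text \<open>\<open>comp_fun2 A G F\<close> is \<open>G\<close> after \<open>F\<close>, where \<open>A\<close> is the source of \<open>F\<close>.\<close>

definition comp_fun2 ::
  "('o, 'a, 'c, 'm) twocat_scheme \<Rightarrow> ('p, 'b, 'd, 'q, 'e, 'f) fun2
    \<Rightarrow> ('o, 'a, 'c, 'p, 'b, 'd) fun2 \<Rightarrow> ('o, 'a, 'c, 'q, 'e, 'f) fun2"
where
  "comp_fun2 A G F = \<lparr>FObj = compose (Obj A) (FObj G) (FObj F),
     FArr = compose (Arr A) (FArr G) (FArr F),
     FCell = compose (Cell A) (FCell G) (FCell F)\<rparr>"

definition inverts ::
  "('o, 'a, 'c, 'p, 'b, 'd) fun2 \<Rightarrow> 'a set \<Rightarrow> ('p, 'b, 'd, 'n) twocat_scheme \<Rightarrow> bool"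
where
  "inverts F \<Sigma> D \<longleftrightarrow> (\<forall>s \<in> \<Sigma>. equivalence D (FArr F s))"

definition isomorphism_2cat ::
  "('o, 'a, 'c, 'm) twocat_scheme \<Rightarrow> ('p, 'b, 'd, 'n) twocat_scheme
    \<Rightarrow> ('o, 'a, 'c, 'p, 'b, 'd) fun2 \<Rightarrow> bool"
where
  "isomorphism_2cat B D F \<longleftrightarrow> two_functor B D F \<and>
     (\<exists>G. two_functor D B G \<and> comp_fun2 B G F = id_fun2 B \<and> comp_fun2 D F G = id_fun2 D)"


section \<open>Pseudonatural transformations, modifications and the hom 2-categories\<close>

record ('o, 'a, 'c, 'p, 'b, 'd) trans =
  TDom :: "('o, 'a, 'c, 'p, 'b, 'd) fun2"
  TCod :: "('o, 'a, 'c, 'p, 'b, 'd) fun2"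
  TObj :: "'o \<Rightarrow> 'b"
  TArr :: "'a \<Rightarrow> 'd"

record ('o, 'a, 'c, 'p, 'b, 'd) modif =
  MSrc :: "('o, 'a, 'c, 'p, 'b, 'd) trans"
  MTrg :: "('o, 'a, 'c, 'p, 'b, 'd) trans"
  MObj :: "'o \<Rightarrow> 'd"

text \<open>For \<open>\<theta> : F \<Rightarrow> G\<close> and \<open>f : X \<rightarrow> Y\<close> the structure 2-cell is directed as
  \<open>\<theta>\<^sub>f : G f \<theta>\<^sub>X \<Rightarrow> \<theta>\<^sub>Y F f\<close>.\<close>

definition pseudonatural ::
  "('o, 'a, 'c, 'm) twocat_scheme \<Rightarrow> ('p, 'b, 'd, 'n) twocat_scheme
    \<Rightarrow> ('o, 'a, 'c, 'p, 'b, 'd) trans \<Rightarrow> bool"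
where
  "pseudonatural B D \<theta> \<longleftrightarrow>
     (let F = TDom \<theta>; G = TCod \<theta> in
      two_functor B D F \<and> two_functor B D G \<and>
      TObj \<theta> \<in> extensional (Obj B) \<and> TArr \<theta> \<in> extensional (Arr B) \<and>
      (\<forall>X \<in> Obj B. TObj \<theta> X \<in> hom D (FObj F X) (FObj G X)) \<and>
      (\<forall>f \<in> Arr B. invertible D (TArr \<theta> f) \<and>
         TArr \<theta> f \<in> hom2 D (FArr G f \<cdot>\<^bsub>D\<^esub> TObj \<theta> (Dom B f)) (TObj \<theta> (Cod B f) \<cdot>\<^bsub>D\<^esub> FArr F f)) \<and>
      (\<forall>X \<in> Obj B. TArr \<theta> (Ide B X) = IdC D (TObj \<theta> X)) \<and>
      (\<forall>f \<in> Arr B. \<forall>g \<in> Arr B. Dom B g = Cod B f \<longrightarrow>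
         TArr \<theta> (g \<cdot>\<^bsub>B\<^esub> f) =
           (TArr \<theta> g \<star>\<^bsub>D\<^esub> IdC D (FArr F f)) \<bullet>\<^bsub>D\<^esub> (IdC D (FArr G g) \<star>\<^bsub>D\<^esub> TArr \<theta> f)) \<and>
      (\<forall>\<alpha> \<in> Cell B.
         TArr \<theta> (Trg B \<alpha>) \<bullet>\<^bsub>D\<^esub> (FCell G \<alpha> \<star>\<^bsub>D\<^esub> IdC D (TObj \<theta> (Dom B (Src B \<alpha>)))) =
         (IdC D (TObj \<theta> (Cod B (Src B \<alpha>))) \<star>\<^bsub>D\<^esub> FCell F \<alpha>) \<bullet>\<^bsub>D\<^esub> TArr \<theta> (Src B \<alpha>)))"

definition two_natural ::
  "('o, 'a, 'c, 'm) twocat_scheme \<Rightarrow> ('p, 'b, 'd, 'n) twocat_scheme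
    \<Rightarrow> ('o, 'a, 'c, 'p, 'b, 'd) trans \<Rightarrow> bool"
where
  "two_natural B D \<theta> \<longleftrightarrow> pseudonatural B D \<theta> \<and>
     (\<forall>f \<in> Arr B. TArr \<theta> f = IdC D (FArr (TCod \<theta>) f \<cdot>\<^bsub>D\<^esub> TObj \<theta> (Dom B f)))"

definition modification ::
  "('o, 'a, 'c, 'm) twocat_scheme \<Rightarrow> ('p, 'b, 'd, 'n) twocat_scheme
    \<Rightarrow> ('o, 'a, 'c, 'p, 'b, 'd) modif \<Rightarrow> bool"
where
  "modification B D \<rho> \<longleftrightarrow>
     (let \<theta> = MSrc \<rho>; \<eta> = MTrg \<rho> in
      pseudonatural B D \<theta> \<and> pseudonatural B D \<eta> \<and> TDom \<theta> = TDom \<eta> \<and> TCod \<theta> = TCod \<eta> \<and>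
      MObj \<rho> \<in> extensional (Obj B) \<and>
      (\<forall>X \<in> Obj B. MObj \<rho> X \<in> hom2 D (TObj \<theta> X) (TObj \<eta> X)) \<and>
      (\<forall>f \<in> Arr B.
         (MObj \<rho> (Cod B f) \<star>\<^bsub>D\<^esub> IdC D (FArr (TDom \<theta>) f)) \<bullet>\<^bsub>D\<^esub> TArr \<theta> f =
         TArr \<eta> f \<bullet>\<^bsub>D\<^esub> (IdC D (FArr (TCod \<theta>) f) \<star>\<^bsub>D\<^esub> MObj \<rho> (Dom B f))))"

definition comp_trans ::
  "('o, 'a, 'c, 'm) twocat_scheme \<Rightarrow> ('p, 'b, 'd, 'n) twocat_scheme
    \<Rightarrow> ('o, 'a, 'c, 'p, 'b, 'd) trans \<Rightarrow> ('o, 'a, 'c, 'p, 'b, 'd) trans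
    \<Rightarrow> ('o, 'a, 'c, 'p, 'b, 'd) trans"
where
  "comp_trans B D \<eta> \<theta> = \<lparr>TDom = TDom \<theta>, TCod = TCod \<eta>,
     TObj = (\<lambda>X\<in>Obj B. TObj \<eta> X \<cdot>\<^bsub>D\<^esub> TObj \<theta> X),
     TArr = (\<lambda>f\<in>Arr B. (IdC D (TObj \<eta> (Cod B f)) \<star>\<^bsub>D\<^esub> TArr \<theta> f) \<bullet>\<^bsub>D\<^esub>
                        (TArr \<eta> f \<star>\<^bsub>D\<^esub> IdC D (TObj \<theta> (Dom B f))))\<rparr>"

definition Hom_p ::
  "('o, 'a, 'c, 'm) twocat_scheme \<Rightarrow> ('p, 'b, 'd, 'n) twocat_scheme
    \<Rightarrow> (('o, 'a, 'c, 'p, 'b, 'd) fun2, ('o, 'a, 'c, 'p, 'b, 'd) trans,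
        ('o, 'a, 'c, 'p, 'b, 'd) modif) twocat"
where
  "Hom_p B D =
    \<lparr>Obj = {F. two_functor B D F},
     Arr = {\<theta>. pseudonatural B D \<theta>},
     Dom = TDom,
     Cod = TCod,
     Ide = (\<lambda>F. \<lparr>TDom = F, TCod = F,
       TObj = (\<lambda>X\<in>Obj B. Ide D (FObj F X)), TArr = (\<lambda>f\<in>Arr B. IdC D (FArr F f))\<rparr>),
     Comp = comp_trans B D,
     Cell = {\<rho>. modification B D \<rho>},
     Src = MSrc,
     Trg = MTrg,
     IdC = (\<lambda>\<theta>. \<lparr>MSrc = \<theta>, MTrg = \<theta>, MObj = (\<lambda>X\<in>Obj B. IdC D (TObj \<theta> X))\<rparr>),
     VComp = (\<lambda>\<sigma> \<rho>. \<lparr>MSrc = MSrc \<rho>, MTrg = MTrg \<sigma>,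
       MObj = (\<lambda>X\<in>Obj B. MObj \<sigma> X \<bullet>\<^bsub>D\<^esub> MObj \<rho> X)\<rparr>),
     HComp = (\<lambda>\<sigma> \<rho>. \<lparr>MSrc = comp_trans B D (MSrc \<sigma>) (MSrc \<rho>),
       MTrg = comp_trans B D (MTrg \<sigma>) (MTrg \<rho>),
       MObj = (\<lambda>X\<in>Obj B. MObj \<sigma> X \<star>\<^bsub>D\<^esub> MObj \<rho> X)\<rparr>)\<rparr>"

text \<open>The locally full sub-2-category on the objects satisfying \<open>P\<close> and the arrows between them
  satisfying \<open>Q\<close>.\<close>

definition sub_2cat :: "('o, 'a, 'c) twocat \<Rightarrow> ('o \<Rightarrow> bool) \<Rightarrow> ('a \<Rightarrow> bool) \<Rightarrow> ('o, 'a, 'c) twocat"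
where
  "sub_2cat H P Q =
     (let A = {f \<in> Arr H. P (Dom H f) \<and> P (Cod H f) \<and> Q f} in
      H\<lparr>Obj := {X \<in> Obj H. P X}, Arr := A,
        Cell := {\<alpha> \<in> Cell H. Src H \<alpha> \<in> A \<and> Trg H \<alpha> \<in> A}\<rparr>)"

definition Hom_s ::
  "('o, 'a, 'c, 'm) twocat_scheme \<Rightarrow> ('p, 'b, 'd, 'n) twocat_scheme
    \<Rightarrow> (('o, 'a, 'c, 'p, 'b, 'd) fun2, ('o, 'a, 'c, 'p, 'b, 'd) trans,
        ('o, 'a, 'c, 'p, 'b, 'd) modif) twocat"
where
  "Hom_s B D = sub_2cat (Hom_p B D) (\<lambda>F. True) (two_natural B D)"

definition Hom_p_plus ::
  "('o, 'a, 'c, 'm) twocat_scheme \<Rightarrow> 'a set \<Rightarrow> ('p, 'b, 'd, 'n) twocat_scheme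
    \<Rightarrow> (('o, 'a, 'c, 'p, 'b, 'd) fun2, ('o, 'a, 'c, 'p, 'b, 'd) trans,
        ('o, 'a, 'c, 'p, 'b, 'd) modif) twocat"
where
  "Hom_p_plus A \<Sigma> D = sub_2cat (Hom_p A D) (\<lambda>F. inverts F \<Sigma> D) (\<lambda>\<theta>. True)"

definition Hom_s_plus ::
  "('o, 'a, 'c, 'm) twocat_scheme \<Rightarrow> 'a set \<Rightarrow> ('p, 'b, 'd, 'n) twocat_scheme
    \<Rightarrow> (('o, 'a, 'c, 'p, 'b, 'd) fun2, ('o, 'a, 'c, 'p, 'b, 'd) trans,
        ('o, 'a, 'c, 'p, 'b, 'd) modif) twocat"
where
  "Hom_s_plus A \<Sigma> D = sub_2cat (Hom_s A D) (\<lambda>F. inverts F \<Sigma> D) (\<lambda>\<theta>. True)"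

definition whisker_trans ::
  "('o, 'a, 'c, 'm) twocat_scheme \<Rightarrow> ('o, 'a, 'c, 'p, 'b, 'd) fun2
    \<Rightarrow> ('p, 'b, 'd, 'q, 'e, 'f) trans \<Rightarrow> ('o, 'a, 'c, 'q, 'e, 'f) trans"
where
  "whisker_trans A q \<theta> = \<lparr>TDom = comp_fun2 A (TDom \<theta>) q, TCod = comp_fun2 A (TCod \<theta>) q,
     TObj = compose (Obj A) (TObj \<theta>) (FObj q), TArr = compose (Arr A) (TArr \<theta>) (FArr q)\<rparr>"

definition whisker_modif ::
  "('o, 'a, 'c, 'm) twocat_scheme \<Rightarrow> ('o, 'a, 'c, 'p, 'b, 'd) fun2
    \<Rightarrow> ('p, 'b, 'd, 'q, 'e, 'f) modif \<Rightarrow> ('o, 'a, 'c, 'q, 'e, 'f) modif"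
where
  "whisker_modif A q \<rho> = \<lparr>MSrc = whisker_trans A q (MSrc \<rho>), MTrg = whisker_trans A q (MTrg \<rho>),
     MObj = compose (Obj A) (MObj \<rho>) (FObj q)\<rparr>"

text \<open>\<open>precomp A q K\<close> is the 2-functor \<open>q\<^sup>*\<close> defined on the hom 2-category \<open>K\<close> of 2-functors out of
  the target of \<open>q\<close>, where \<open>A\<close> is the source of \<open>q\<close>.\<close>

definition precomp ::
  "('o, 'a, 'c, 'm) twocat_scheme \<Rightarrow> ('o, 'a, 'c, 'p, 'b, 'd) fun2
    \<Rightarrow> (('p, 'b, 'd, 'q, 'e, 'f) fun2, ('p, 'b, 'd, 'q, 'e, 'f) trans,
        ('p, 'b, 'd, 'q, 'e, 'f) modif) twocat
    \<Rightarrow> (('p, 'b, 'd, 'q, 'e, 'f) fun2, ('p, 'b, 'd, 'q, 'e, 'f) trans,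
        ('p, 'b, 'd, 'q, 'e, 'f) modif,
        ('o, 'a, 'c, 'q, 'e, 'f) fun2, ('o, 'a, 'c, 'q, 'e, 'f) trans,
        ('o, 'a, 'c, 'q, 'e, 'f) modif) fun2"
where
  "precomp A q K = \<lparr>FObj = (\<lambda>F\<in>Obj K. comp_fun2 A F q),
     FArr = (\<lambda>\<theta>\<in>Arr K. whisker_trans A q \<theta>), FCell = (\<lambda>\<rho>\<in>Cell K. whisker_modif A q \<rho>)\<rparr>"


section \<open>2-localization\<close>

definition pseudoequivalence_strict ::
  "('o, 'a, 'c, 'm) twocat_scheme \<Rightarrow> ('p, 'b, 'd, 'n) twocat_scheme
    \<Rightarrow> ('o, 'a, 'c, 'p, 'b, 'd) fun2 \<Rightarrow> bool"
where
  "pseudoequivalence_strict B B' F \<longleftrightarrow> two_functor B B' F \<and>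
     (\<exists>G. two_functor B' B G \<and>
       (\<exists>\<eta> \<in> hom (Hom_s B B) (id_fun2 B) (comp_fun2 B G F). equivalence (Hom_s B B) \<eta>) \<and>
       (\<exists>\<epsilon> \<in> hom (Hom_s B' B') (comp_fun2 B' F G) (id_fun2 B'). equivalence (Hom_s B' B') \<epsilon>))"

text \<open>Since HOL cannot quantify over types inside a formula, the types of the test 2-categories
  \<open>D\<close> are a parameter; leaving them as type variables in a theorem gives all 2-categories \<open>D\<close>.\<close>

definition two_localization_strict ::
  "('x, 'y, 'z) twocat itself \<Rightarrow> ('o, 'a, 'c) twocat \<Rightarrow> 'a set
    \<Rightarrow> ('p, 'b, 'd) twocat \<Rightarrow> ('o, 'a, 'c, 'p, 'b, 'd) fun2 \<Rightarrow> bool"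
where
  "two_localization_strict _ A \<Sigma> L q \<longleftrightarrow>
     two_category L \<and> two_functor A L q \<and> inverts q \<Sigma> L \<and>
     (\<forall>D :: ('x, 'y, 'z) twocat. two_category D \<longrightarrow>
        pseudoequivalence_strict (Hom_p L D) (Hom_p_plus A \<Sigma> D) (precomp A q (Hom_p L D)))"


section \<open>The homotopy 2-category\<close>

record ('o, 'a) cylinder =
  cylW :: 'o
  cylZ :: 'o
  cyl_d0 :: 'a
  cyl_d1 :: 'a
  cyl_s :: 'a
  cyl_x :: 'a

record ('o, 'a) homotopy =
  hcyl :: "('o, 'a) cylinder"
  hmap :: 'a

definition is_cylinder :: "('o, 'a) cat \<Rightarrow> 'a set \<Rightarrow> 'o \<Rightarrow> ('o, 'a) cylinder \<Rightarrow> bool" where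
  "is_cylinder A \<Sigma> X C \<longleftrightarrow>
     cyl_d0 C \<in> hom A X (cylW C) \<and> cyl_d1 C \<in> hom A X (cylW C) \<and>
     cyl_s C \<in> hom A (cylW C) (cylZ C) \<and> cyl_x C \<in> hom A X (cylZ C) \<and> cyl_s C \<in> \<Sigma> \<and>
     cyl_s C \<cdot>\<^bsub>A\<^esub> cyl_d0 C = cyl_x C \<and> cyl_s C \<cdot>\<^bsub>A\<^esub> cyl_d1 C = cyl_x C"

definition is_homotopy :: "('o, 'a) cat \<Rightarrow> 'a set \<Rightarrow> 'a \<Rightarrow> 'a \<Rightarrow> ('o, 'a) homotopy \<Rightarrow> bool" where
  "is_homotopy A \<Sigma> f g H \<longleftrightarrow> f \<in> Arr A \<and> g \<in> hom A (Dom A f) (Cod A f) \<and>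
     is_cylinder A \<Sigma> (Dom A f) (hcyl H) \<and> hmap H \<in> hom A (cylW (hcyl H)) (Cod A f) \<and>
     hmap H \<cdot>\<^bsub>A\<^esub> cyl_d0 (hcyl H) = f \<and> hmap H \<cdot>\<^bsub>A\<^esub> cyl_d1 (hcyl H) = g"

text \<open>A composable sequence \<open>(H\<^sub>n, \<dots>, H\<^sub>1)\<close>, \<open>n \<ge> 1\<close>, is the list with head \<open>H\<^sub>n\<close>.\<close>

inductive is_hseq :: "('o, 'a) cat \<Rightarrow> 'a set \<Rightarrow> 'a \<Rightarrow> 'a \<Rightarrow> ('o, 'a) homotopy list \<Rightarrow> bool"
  for A \<Sigma>
where
  single: "is_homotopy A \<Sigma> f g H \<Longrightarrow> is_hseq A \<Sigma> f g [H]"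
| step: "is_hseq A \<Sigma> f g Hs \<Longrightarrow> is_homotopy A \<Sigma> g k H \<Longrightarrow> is_hseq A \<Sigma> f k (H # Hs)"

definition hat_cyl ::
  "('p, 'b, 'd) twocat \<Rightarrow> ('o, 'a, 'a, 'p, 'b, 'd) fun2 \<Rightarrow> ('o, 'a) cylinder \<Rightarrow> 'd"
where
  "hat_cyl D F C = (THE \<gamma>. \<gamma> \<in> hom2 D (FArr F (cyl_d0 C)) (FArr F (cyl_d1 C)) \<and>
     IdC D (FArr F (cyl_s C)) \<star>\<^bsub>D\<^esub> \<gamma> = IdC D (FArr F (cyl_x C)))"

definition hat_htpy ::
  "('p, 'b, 'd) twocat \<Rightarrow> ('o, 'a, 'a, 'p, 'b, 'd) fun2 \<Rightarrow> ('o, 'a) homotopy \<Rightarrow> 'd"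
where
  "hat_htpy D F H = IdC D (FArr F (hmap H)) \<star>\<^bsub>D\<^esub> hat_cyl D F (hcyl H)"

fun hat_hseq ::
  "('p, 'b, 'd) twocat \<Rightarrow> ('o, 'a, 'a, 'p, 'b, 'd) fun2 \<Rightarrow> ('o, 'a) homotopy list \<Rightarrow> 'd"
where
  "hat_hseq D F [] = undefined"
| "hat_hseq D F [H] = hat_htpy D F H"
| "hat_hseq D F (H # K # Hs) = hat_htpy D F H \<bullet>\<^bsub>D\<^esub> hat_hseq D F (K # Hs)"

text \<open>The relation identifying two sequences when their images agree in every 2-category \<open>D\<close>
  under every 2-functor inverting \<open>\<Sigma>\<close>. Its definition can only quantify over 2-categories on
  fixed types; \<open>hseq_equiv_hat_eq\<close> below shows that the types chosen here are large enough, i.e.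
  that the images then agree for \<open>D\<close> on arbitrary types.\<close>

type_synonym 'a univ = "('a \<times> nat) list"

definition hseq_equiv ::
  "('o, 'a) cat \<Rightarrow> 'a set \<Rightarrow> ('o, 'a) homotopy list \<Rightarrow> ('o, 'a) homotopy list \<Rightarrow> bool"
where
  "hseq_equiv A \<Sigma> Hs Ks \<longleftrightarrow>
     (\<forall>(D :: ('a univ, 'a univ, 'a univ) twocat) F.
        two_category D \<longrightarrow> two_functor (disc A) D F \<longrightarrow> inverts F \<Sigma> D \<longrightarrow>
        hat_hseq D F Hs = hat_hseq D F Ks)"

definition hclass ::
  "('o, 'a) cat \<Rightarrow> 'a set \<Rightarrow> 'a \<Rightarrow> 'a \<Rightarrow> ('o, 'a) homotopy list \<Rightarrow> ('o, 'a) homotopy list set"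
where
  "hclass A \<Sigma> f g Hs = {Ks. is_hseq A \<Sigma> f g Ks \<and> hseq_equiv A \<Sigma> Hs Ks}"

definition id_htpy :: "('o, 'a) cat \<Rightarrow> 'a \<Rightarrow> ('o, 'a) homotopy" where
  "id_htpy A f = (let X = Dom A f in
     \<lparr>hcyl = \<lparr>cylW = X, cylZ = X, cyl_d0 = Ide A X, cyl_d1 = Ide A X, cyl_s = Ide A X,
        cyl_x = Ide A X\<rparr>, hmap = f\<rparr>)"

definition lwhisker :: "('o, 'a) cat \<Rightarrow> 'a \<Rightarrow> ('o, 'a) homotopy \<Rightarrow> ('o, 'a) homotopy" where
  "lwhisker A r H = H\<lparr>hmap := r \<cdot>\<^bsub>A\<^esub> hmap H\<rparr>"

definition rwhisker :: "('o, 'a) cat \<Rightarrow> ('o, 'a) homotopy \<Rightarrow> 'a \<Rightarrow> ('o, 'a) homotopy" where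
  "rwhisker A H l = (let C = hcyl H in
     H\<lparr>hcyl := C\<lparr>cyl_d0 := cyl_d0 C \<cdot>\<^bsub>A\<^esub> l, cyl_d1 := cyl_d1 C \<cdot>\<^bsub>A\<^esub> l, cyl_x := cyl_x C \<cdot>\<^bsub>A\<^esub> l\<rparr>\<rparr>)"

text \<open>A 2-cell \<open>f \<Rightarrow> g\<close> is a triple \<open>(f, g, S)\<close> with \<open>S\<close> a class of sequences. Operations on classes
  are given by the unions of the classes of the results on all representatives.
  The horizontal composite of \<open>\<alpha> : f \<Rightarrow> f'\<close> and \<open>\<beta> : g \<Rightarrow> g'\<close> is \<open>\<beta> f' \<circ> g \<alpha>\<close>.\<close>

definition Ho ::
  "('o, 'a) cat \<Rightarrow> 'a set \<Rightarrow> ('o, 'a, 'a \<times> 'a \<times> ('o, 'a) homotopy list set) twocat"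
where
  "Ho A \<Sigma> =
    \<lparr>Obj = Obj A, Arr = Arr A, Dom = Dom A, Cod = Cod A, Ide = Ide A, Comp = Comp A,
     Cell = {(f, g, hclass A \<Sigma> f g Hs) | f g Hs. is_hseq A \<Sigma> f g Hs},
     Src = (\<lambda>(f, g, S). f),
     Trg = (\<lambda>(f, g, S). g),
     IdC = (\<lambda>f. (f, f, hclass A \<Sigma> f f [id_htpy A f])),
     VComp = (\<lambda>(g, k, T) (f, _, S). (f, k, \<Union>Ks\<in>T. \<Union>Hs\<in>S. hclass A \<Sigma> f k (Ks @ Hs))),
     HComp = (\<lambda>(g, g', T) (f, f', S).
       (g \<cdot>\<^bsub>A\<^esub> f, g' \<cdot>\<^bsub>A\<^esub> f',
        \<Union>Ks\<in>T. \<Union>Hs\<in>S. hclass A \<Sigma> (g \<cdot>\<^bsub>A\<^esub> f) (g' \<cdot>\<^bsub>A\<^esub> f')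
          (map (\<lambda>K. rwhisker A K f') Ks @ map (lwhisker A g) Hs)))\<rparr>"

definition Ho_incl ::
  "('o, 'a) cat \<Rightarrow> 'a set
    \<Rightarrow> ('o, 'a, 'a, 'o, 'a, 'a \<times> 'a \<times> ('o, 'a) homotopy list set) fun2"
where
  "Ho_incl A \<Sigma> = \<lparr>FObj = (\<lambda>X\<in>Obj A. X), FArr = (\<lambda>f\<in>Arr A. f),
     FCell = (\<lambda>f\<in>Arr A. IdC (Ho A \<Sigma>) f)\<rparr>"

section \<open>Model categories\<close>

definition is_cone ::
  "('j, 'u) cat \<Rightarrow> ('o, 'a) cat \<Rightarrow> ('j, 'u, 'o, 'a) fun1 \<Rightarrow> 'o \<Rightarrow> ('j \<Rightarrow> 'a) \<Rightarrow> bool"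
where
  "is_cone J C F L \<pi> \<longleftrightarrow> L \<in> Obj C \<and> (\<forall>j \<in> Obj J. \<pi> j \<in> hom C L (FObj F j)) \<and>
     (\<forall>u \<in> Arr J. FArr F u \<cdot>\<^bsub>C\<^esub> \<pi> (Dom J u) = \<pi> (Cod J u))"

definition is_limit ::
  "('j, 'u) cat \<Rightarrow> ('o, 'a) cat \<Rightarrow> ('j, 'u, 'o, 'a) fun1 \<Rightarrow> 'o \<Rightarrow> ('j \<Rightarrow> 'a) \<Rightarrow> bool"
where
  "is_limit J C F L \<pi> \<longleftrightarrow> is_cone J C F L \<pi> \<and>
     (\<forall>M \<rho>. is_cone J C F M \<rho> \<longrightarrow>
        (\<exists>!m. m \<in> hom C M L \<and> (\<forall>j \<in> Obj J. \<pi> j \<cdot>\<^bsub>C\<^esub> m = \<rho> j)))"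

text \<open>Every finite category is isomorphic to one whose objects and arrows are natural numbers.\<close>

definition has_finite_limits :: "('o, 'a) cat \<Rightarrow> bool" where
  "has_finite_limits C \<longleftrightarrow>
     (\<forall>(J :: (nat, nat) cat) F. category J \<and> finite (Obj J) \<and> finite (Arr J) \<and> is_functor J C F
        \<longrightarrow> (\<exists>L \<pi>. is_limit J C F L \<pi>))"

definition has_finite_colimits :: "('o, 'a) cat \<Rightarrow> bool" where
  "has_finite_colimits C \<longleftrightarrow> has_finite_limits (op_cat C)"

definition terminal :: "('o, 'a) cat \<Rightarrow> 'o \<Rightarrow> bool" where
  "terminal C T \<longleftrightarrow> T \<in> Obj C \<and> (\<forall>X \<in> Obj C. \<exists>!f. f \<in> hom C X T)"

definition initial :: "('o, 'a) cat \<Rightarrow> 'o \<Rightarrow> bool" where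
  "initial C I \<longleftrightarrow> I \<in> Obj C \<and> (\<forall>X \<in> Obj C. \<exists>!f. f \<in> hom C I X)"

definition is_retract :: "('o, 'a) cat \<Rightarrow> 'a \<Rightarrow> 'a \<Rightarrow> bool" where
  "is_retract C f g \<longleftrightarrow> f \<in> Arr C \<and> g \<in> Arr C \<and>
     (\<exists>a \<in> hom C (Dom C f) (Dom C g). \<exists>b \<in> hom C (Dom C g) (Dom C f).
      \<exists>c \<in> hom C (Cod C f) (Cod C g). \<exists>d \<in> hom C (Cod C g) (Cod C f).
        b \<cdot>\<^bsub>C\<^esub> a = Ide C (Dom C f) \<and> d \<cdot>\<^bsub>C\<^esub> c = Ide C (Cod C f) \<and>
        g \<cdot>\<^bsub>C\<^esub> a = c \<cdot>\<^bsub>C\<^esub> f \<and> f \<cdot>\<^bsub>C\<^esub> b = d \<cdot>\<^bsub>C\<^esub> g)"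

definition has_lifting :: "('o, 'a) cat \<Rightarrow> 'a \<Rightarrow> 'a \<Rightarrow> bool" where
  "has_lifting C i p \<longleftrightarrow>
     (\<forall>u \<in> hom C (Dom C i) (Dom C p). \<forall>v \<in> hom C (Cod C i) (Cod C p).
        p \<cdot>\<^bsub>C\<^esub> u = v \<cdot>\<^bsub>C\<^esub> i \<longrightarrow>
        (\<exists>d \<in> hom C (Cod C i) (Dom C p). d \<cdot>\<^bsub>C\<^esub> i = u \<and> p \<cdot>\<^bsub>C\<^esub> d = v))"

definition wide_retract_closed :: "('o, 'a) cat \<Rightarrow> 'a set \<Rightarrow> bool" where
  "wide_retract_closed C S \<longleftrightarrow> S \<subseteq> Arr C \<and>
     (\<forall>X \<in> Obj C. Ide C X \<in> S) \<and>
     (\<forall>f \<in> S. \<forall>g \<in> S. Dom C g = Cod C f \<longrightarrow> g \<cdot>\<^bsub>C\<^esub> f \<in> S) \<and>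
     (\<forall>f g. g \<in> S \<and> is_retract C f g \<longrightarrow> f \<in> S)"

locale model_category = category C
  for C :: "('o, 'a) cat" (structure) +
  fixes W Fib Cof :: "'a set"
  assumes finite_limits: "has_finite_limits C"
    and finite_colimits: "has_finite_colimits C"
    and classes: "wide_retract_closed C W" "wide_retract_closed C Fib" "wide_retract_closed C Cof"
    and two_of_three: "\<lbrakk>f \<in> Arr C; g \<in> Arr C; Dom C g = Cod C f\<rbrakk> \<Longrightarrow>
          (f \<in> W \<and> g \<in> W \<longrightarrow> g \<cdot> f \<in> W) \<and> (f \<in> W \<and> g \<cdot> f \<in> W \<longrightarrow> g \<in> W) \<and>
          (g \<in> W \<and> g \<cdot> f \<in> W \<longrightarrow> f \<in> W)"
    and lift_cof_tfib: "\<lbrakk>i \<in> Cof; p \<in> Fib \<inter> W\<rbrakk> \<Longrightarrow> has_lifting C i p"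
    and lift_tcof_fib: "\<lbrakk>i \<in> Cof \<inter> W; p \<in> Fib\<rbrakk> \<Longrightarrow> has_lifting C i p"
    and factor_cof_tfib: "f \<in> Arr C \<Longrightarrow>
          \<exists>i \<in> Cof. \<exists>p \<in> Fib \<inter> W. Dom C p = Cod C i \<and> f = p \<cdot> i"
    and factor_tcof_fib: "f \<in> Arr C \<Longrightarrow>
          \<exists>i \<in> Cof \<inter> W. \<exists>p \<in> Fib. Dom C p = Cod C i \<and> f = p \<cdot> i"

definition fibrant :: "('o, 'a) cat \<Rightarrow> 'a set \<Rightarrow> 'o \<Rightarrow> bool" where
  "fibrant C Fib X \<longleftrightarrow> X \<in> Obj C \<and> (\<exists>T. terminal C T \<and> (\<exists>p \<in> hom C X T. p \<in> Fib))"

definition cofibrant :: "('o, 'a) cat \<Rightarrow> 'a set \<Rightarrow> 'o \<Rightarrow> bool" where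
  "cofibrant C Cof X \<longleftrightarrow> X \<in> Obj C \<and> (\<exists>I. initial C I \<and> (\<exists>i \<in> hom C I X. i \<in> Cof))"

definition fc :: "('o, 'a) cat \<Rightarrow> 'a set \<Rightarrow> 'a set \<Rightarrow> ('o, 'a) cat" where
  "fc C Fib Cof = full_subcat C {X. fibrant C Fib X \<and> cofibrant C Cof X}"


section \<open>Independence of the types in the definition of \<open>hseq_equiv\<close>\<close>

text \<open>For a 2-functor \<open>F\<close> from \<open>A\<close> to \<open>D\<close> inverting \<open>\<Sigma>\<close>, the sub-2-category of \<open>D\<close> generated by the
  image of \<open>F\<close> and by quasi-inverses of the \<open>F s\<close>, \<open>s \<in> \<Sigma>\<close>, has a copy whose objects, arrows and
  2-cells are lists over \<open>'a \<times> nat\<close>: each generated 2-cell is coded by a program for a stack machine,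
  an arrow by its identity 2-cell, and an object by its identity arrow. \<open>F\<close> factors through it.\<close>

lemma stack_coding:
  fixes gen :: "'a \<times> nat \<Rightarrow> 'c" and un :: "nat \<Rightarrow> 'c \<Rightarrow> 'c" and bin :: "nat \<Rightarrow> 'c \<Rightarrow> 'c \<Rightarrow> 'c"
  shows "\<exists>S (e :: 'c \<Rightarrow> 'a univ). inj_on e S \<and> range gen \<subseteq> S \<and> (\<forall>n. \<forall>c\<in>S. un n c \<in> S) \<and>
     (\<forall>n. \<forall>c\<in>S. \<forall>d\<in>S. bin n c d \<in> S)"
proof -
  define stp :: "'a \<times> nat \<Rightarrow> 'c list \<Rightarrow> 'c list" where
    "stp = (\<lambda>(a, m) st. if m mod 3 = 0 then gen (a, m div 3) # st
       else if m mod 3 = 1 then un (m div 3) (hd st) # tl st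
       else bin (m div 3) (hd (tl st)) (hd st) # tl (tl st))"
  define S where "S = {c. \<exists>l. \<forall>st. fold stp l st = c # st}"
  define e where "e c = (SOME l. \<forall>st. fold stp l st = c # st)" for c
  have e: "fold stp (e c) st = c # st" if "c \<in> S" for c st
    using that someI_ex[of "\<lambda>l. \<forall>st. fold stp l st = c # st"] unfolding S_def e_def by blast
  have "inj_on e S" by (rule inj_onI) (metis e list.inject)
  moreover have "gen (a, n) \<in> S" for a n
  proof -
    have "\<forall>st. fold stp [(a, 3 * n)] st = gen (a, n) # st" by (simp add: stp_def)
    then show ?thesis unfolding S_def by blast
  qed
  moreover have "un n c \<in> S" if "c \<in> S" for n c
  proof -
    have *: "(3 * n + 1) mod 3 = 1" "(3 * n + 1) div 3 = n" by presburger+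
    have "\<forall>st. fold stp (e c @ [(undefined, 3 * n + 1)]) st = un n c # st"
      by (simp add: e[OF that] del: One_nat_def) (simp only: stp_def prod.case *, simp)
    then show ?thesis unfolding S_def by blast
  qed
  moreover have "bin n c d \<in> S" if "c \<in> S" "d \<in> S" for n c d
  proof -
    have *: "(3 * n + 2) mod 3 = 2" "(3 * n + 2) div 3 = n" by presburger+
    have "\<forall>st. fold stp (e c @ e d @ [(undefined, 3 * n + 2)]) st = bin n c d # st"
      by (simp add: e that del: mult_Suc_right add_2_eq_Suc') (simp only: stp_def prod.case *, simp)
    then show ?thesis unfolding S_def by blast
  qed
  ultimately show ?thesis by (intro exI[of _ S] exI[of _ e]) auto
qed

lemma (in two_category) cellD:
  assumes "\<alpha> \<in> hom2 D f g"
  shows "\<alpha> \<in> Cell D" "Src D \<alpha> = f" "Trg D \<alpha> = g" "f \<in> Arr D" "g \<in> hom D (Dom D f) (Cod D f)"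
  using assms src_closed[of \<alpha>] trg_parallel[of \<alpha>] unfolding hom2_def by auto

lemma (in two_category) whisker_faithful:
  assumes "s \<in> hom D W Z" "g \<in> hom D Z W" "\<eta> \<in> hom2 D (Ide D W) (g \<cdot> s)" "invertible D \<eta>"
    and "\<alpha> \<in> hom2 D a b" "\<beta> \<in> hom2 D a b" "Cod D a = W"
    and "IdC D s \<star> \<alpha> = IdC D s \<star> \<beta>"
  shows "\<alpha> = \<beta>"
proof -
  obtain \<eta>' where e': "\<eta>' \<in> hom2 D (g \<cdot> s) (Ide D W)" "\<eta>' \<bullet> \<eta> = IdC D (Ide D W)"
    using assms(3,4) unfolding invertible_def hom2_def by auto
  have key: "\<gamma> = (\<eta>' \<star> IdC D b) \<bullet> ((IdC D g \<star> (IdC D s \<star> \<gamma>)) \<bullet> (\<eta> \<star> IdC D a))"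
    if "\<gamma> \<in> hom2 D a b" for \<gamma>
  proof -
    note c = cellD[OF that]
    have W: "Dom D s = W" "Cod D s = Z" "Dom D g = Z" "Cod D g = W" "s \<in> Arr D" "g \<in> Arr D" "W \<in> Obj D"
      using assms(1,2) dom_closed unfolding hom_def by auto
    have b: "b \<in> Arr D" "Cod D b = W" "Dom D b = Dom D a" using c assms(7) unfolding hom_def by auto
    have ia: "IdC D a \<in> hom2 D a a" and ib: "IdC D b \<in> hom2 D b b"
      using idc_hom c b by auto
    have gs: "g \<cdot> s \<in> hom D W W" using comp_hom assms(1,2) by blast
    have igs: "IdC D (g \<cdot> s) \<in> hom2 D (g \<cdot> s) (g \<cdot> s)" using gs idc_hom unfolding hom_def by auto
    have IW: "Ide D W \<in> hom D W W" using W ide_hom by auto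
    have iW: "IdC D (Ide D W) \<in> hom2 D (Ide D W) (Ide D W)" using IW idc_hom unfolding hom_def by auto
    have 1: "IdC D g \<star> (IdC D s \<star> \<gamma>) = IdC D (g \<cdot> s) \<star> \<gamma>"
      using hcomp_assoc[OF that idc_hom idc_hom, of s g] idc_comp[OF assms(1,2)] W assms(7) by simp
    have 2: "(IdC D (g \<cdot> s) \<star> \<gamma>) \<bullet> (\<eta> \<star> IdC D a) = (IdC D (g \<cdot> s) \<bullet> \<eta>) \<star> (\<gamma> \<bullet> IdC D a)"
      using interchange[OF ia that assms(3) igs] IW assms(7) unfolding hom_def by auto
    have 3: "(IdC D (g \<cdot> s) \<bullet> \<eta>) \<star> (\<gamma> \<bullet> IdC D a) = \<eta> \<star> \<gamma>"
      using idc_vcomp[of \<eta>] vcomp_idc[of \<gamma>] cellD[OF assms(3)] c by simp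
    have 4: "(\<eta>' \<star> IdC D b) \<bullet> (\<eta> \<star> \<gamma>) = (\<eta>' \<bullet> \<eta>) \<star> (IdC D b \<bullet> \<gamma>)"
      using interchange[OF that ib assms(3) e'(1)] IW assms(7) unfolding hom_def by auto
    have 5: "(\<eta>' \<bullet> \<eta>) \<star> (IdC D b \<bullet> \<gamma>) = \<gamma>"
      using e'(2) idc_vcomp[of \<gamma>] idc_hcomp[of \<gamma>] c assms(7) by simp
    show ?thesis using 1 2 3 4 5 by simp
  qed
  show ?thesis using key[OF assms(5)] key[OF assms(6)] assms(8) by simp
qed

lemma (in two_category) inverse_invertible:
  assumes "\<alpha> \<in> hom2 D f g" "invertible D \<alpha>"
  obtains \<beta> where "\<beta> \<in> hom2 D g f" "invertible D \<beta>" "\<beta> \<bullet> \<alpha> = IdC D f" "\<alpha> \<bullet> \<beta> = IdC D g"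
  using assms unfolding invertible_def hom2_def by auto

lemma (in two_category) whisker_full_faithful:
  assumes s: "equivalence D s" and d: "d0 \<in> hom D X (Dom D s)" "d1 \<in> hom D X (Dom D s)"
    and \<beta>: "\<beta> \<in> hom2 D (s \<cdot> d0) (s \<cdot> d1)"
  shows "\<exists>!\<gamma>. \<gamma> \<in> hom2 D d0 d1 \<and> IdC D s \<star> \<gamma> = \<beta>"
proof -
  define W Z where "W = Dom D s" and "Z = Cod D s"
  obtain g \<eta> \<epsilon> where g: "g \<in> hom D Z W" and \<eta>: "\<eta> \<in> hom2 D (Ide D W) (g \<cdot> s)" "invertible D \<eta>"
    and \<epsilon>: "\<epsilon> \<in> hom2 D (s \<cdot> g) (Ide D Z)" "invertible D \<epsilon>"
    using s unfolding equivalence_def W_def Z_def by blast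
  have sh: "s \<in> hom D W Z" using s unfolding equivalence_def W_def Z_def hom_def by auto
  have d': "d0 \<in> hom D X W" "d1 \<in> hom D X W" using d W_def by auto
  have D: "Dom D s = W" "Cod D s = Z" "Dom D g = Z" "Cod D g = W" "Dom D d0 = X" "Cod D d0 = W"
     "Dom D d1 = X" "Cod D d1 = W" "s \<in> Arr D" "g \<in> Arr D" "d0 \<in> Arr D" "d1 \<in> Arr D" "W \<in> Obj D"
    using sh g d' dom_closed unfolding hom_def by auto
  obtain \<eta>' where \<eta>': "\<eta>' \<in> hom2 D (g \<cdot> s) (Ide D W)" "\<eta>' \<bullet> \<eta> = IdC D (Ide D W)"
     "\<eta> \<bullet> \<eta>' = IdC D (g \<cdot> s)" using inverse_invertible[OF \<eta>] by metis
  obtain \<epsilon>' where \<epsilon>': "\<epsilon>' \<in> hom2 D (Ide D Z) (s \<cdot> g)" "invertible D \<epsilon>'"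
    using inverse_invertible[OF \<epsilon>] by metis
  have gs: "g \<cdot> s \<in> hom D W W" and IW: "Ide D W \<in> hom D W W"
    using comp_hom sh g ide_hom D by blast+
  have sd: "s \<cdot> d0 \<in> hom D X Z" "s \<cdot> d1 \<in> hom D X Z" using comp_hom d' sh by blast+
  have i: "IdC D d0 \<in> hom2 D d0 d0" "IdC D d1 \<in> hom2 D d1 d1" "IdC D s \<in> hom2 D s s" "IdC D g \<in> hom2 D g g"
    using idc_hom D by auto
  have igs: "IdC D (g \<cdot> s) \<in> hom2 D (g \<cdot> s) (g \<cdot> s)" using gs idc_hom unfolding hom_def by auto
  have A: "Ide D W \<cdot> d0 = d0" "Ide D W \<cdot> d1 = d1" using ide_comp[of d0] ide_comp[of d1] D by auto
  have h0: "\<eta> \<star> IdC D d0 \<in> hom2 D d0 ((g \<cdot> s) \<cdot> d0)"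
    using hcomp_hom[OF i(1) \<eta>(1)] A IW D unfolding hom_def by auto
  have h1: "\<eta>' \<star> IdC D d1 \<in> hom2 D ((g \<cdot> s) \<cdot> d1) d1"
    using hcomp_hom[OF i(2) \<eta>'(1)] A gs D unfolding hom_def by auto
  have as: "(g \<cdot> s) \<cdot> d0 = g \<cdot> (s \<cdot> d0)" "(g \<cdot> s) \<cdot> d1 = g \<cdot> (s \<cdot> d1)"
    using comp_assoc sh g d' by blast+
  have hb: "IdC D g \<star> \<beta> \<in> hom2 D ((g \<cdot> s) \<cdot> d0) ((g \<cdot> s) \<cdot> d1)"
    unfolding as using hcomp_hom[OF \<beta> i(4)] D sd unfolding hom_def by auto
  define \<gamma> where "\<gamma> = (\<eta>' \<star> IdC D d1) \<bullet> ((IdC D g \<star> \<beta>) \<bullet> (\<eta> \<star> IdC D d0))"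
  have hbh: "(IdC D g \<star> \<beta>) \<bullet> (\<eta> \<star> IdC D d0) \<in> hom2 D d0 ((g \<cdot> s) \<cdot> d1)"
    using vcomp_hom h0 hb by blast
  have \<gamma>: "\<gamma> \<in> hom2 D d0 d1" unfolding \<gamma>_def using vcomp_hom hbh h1 by blast
  have nat: "(IdC D (g \<cdot> s) \<star> \<gamma>) \<bullet> (\<eta> \<star> IdC D d0) = (\<eta> \<star> IdC D d1) \<bullet> \<gamma>"
  proof -
    have iW: "IdC D (Ide D W) \<in> hom2 D (Ide D W) (Ide D W)" using IW idc_hom unfolding hom_def by auto
    have "(IdC D (g \<cdot> s) \<star> \<gamma>) \<bullet> (\<eta> \<star> IdC D d0) = (IdC D (g \<cdot> s) \<bullet> \<eta>) \<star> (\<gamma> \<bullet> IdC D d0)"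
      using interchange[OF i(1) \<gamma> \<eta>(1) igs] IW D unfolding hom_def by auto
    also have "\<dots> = \<eta> \<star> \<gamma>"
      using idc_vcomp[of \<eta>] vcomp_idc[of \<gamma>] cellD[OF \<eta>(1)] cellD[OF \<gamma>] by simp
    also have "\<dots> = (\<eta> \<bullet> IdC D (Ide D W)) \<star> (IdC D d1 \<bullet> \<gamma>)"
      using vcomp_idc[of \<eta>] idc_vcomp[of \<gamma>] cellD[OF \<eta>(1)] cellD[OF \<gamma>] by simp
    also have "\<dots> = (\<eta> \<star> IdC D d1) \<bullet> (IdC D (Ide D W) \<star> \<gamma>)"
      using interchange[OF \<gamma> i(2) iW \<eta>(1)] IW D unfolding hom_def by auto
    also have "IdC D (Ide D W) \<star> \<gamma> = \<gamma>" using idc_hcomp[of \<gamma>] cellD[OF \<gamma>] D by simp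
    finally show ?thesis .
  qed
  have h1': "\<eta> \<star> IdC D d1 \<in> hom2 D d1 ((g \<cdot> s) \<cdot> d1)"
    using hcomp_hom[OF i(2) \<eta>(1)] A IW D unfolding hom_def by auto
  have h0': "\<eta>' \<star> IdC D d0 \<in> hom2 D ((g \<cdot> s) \<cdot> d0) d0"
    using hcomp_hom[OF i(1) \<eta>'(1)] A gs D unfolding hom_def by auto
  have inv1: "(\<eta> \<star> IdC D d1) \<bullet> (\<eta>' \<star> IdC D d1) = IdC D ((g \<cdot> s) \<cdot> d1)"
    using interchange[OF i(2) i(2) \<eta>'(1) \<eta>(1)] gs D \<eta>'(3) vcomp_idc[of "IdC D d1"] cellD[OF i(2)]
      idc_comp[OF d'(2) gs] unfolding hom_def by auto
  have inv0: "(\<eta> \<star> IdC D d0) \<bullet> (\<eta>' \<star> IdC D d0) = IdC D ((g \<cdot> s) \<cdot> d0)"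
    using interchange[OF i(1) i(1) \<eta>'(1) \<eta>(1)] gs D \<eta>'(3) vcomp_idc[of "IdC D d0"] cellD[OF i(1)]
      idc_comp[OF d'(1) gs] unfolding hom_def by auto
  have "(\<eta> \<star> IdC D d1) \<bullet> \<gamma> = (IdC D g \<star> \<beta>) \<bullet> (\<eta> \<star> IdC D d0)"
    unfolding \<gamma>_def using vcomp_assoc[OF hbh h1 h1'] inv1 idc_vcomp[of "(IdC D g \<star> \<beta>) \<bullet> (\<eta> \<star> IdC D d0)"]
      cellD[OF hbh] by simp
  with nat have E: "(IdC D (g \<cdot> s) \<star> \<gamma>) \<bullet> (\<eta> \<star> IdC D d0) = (IdC D g \<star> \<beta>) \<bullet> (\<eta> \<star> IdC D d0)" by simp
  have gg: "IdC D (g \<cdot> s) \<star> \<gamma> \<in> hom2 D ((g \<cdot> s) \<cdot> d0) ((g \<cdot> s) \<cdot> d1)"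
    using hcomp_hom[OF \<gamma> igs] gs D unfolding hom_def by auto
  have cancel: "\<delta> = (\<delta> \<bullet> (\<eta> \<star> IdC D d0)) \<bullet> (\<eta>' \<star> IdC D d0)"
    if "\<delta> \<in> hom2 D ((g \<cdot> s) \<cdot> d0) ((g \<cdot> s) \<cdot> d1)" for \<delta>
    using vcomp_assoc[OF h0' h0 that] inv0 vcomp_idc[of \<delta>] cellD[OF that] by simp
  have E': "IdC D (g \<cdot> s) \<star> \<gamma> = IdC D g \<star> \<beta>" using cancel[OF gg] cancel[OF hb] E by simp
  have "IdC D g \<star> (IdC D s \<star> \<gamma>) = IdC D g \<star> \<beta>"
    using hcomp_assoc[OF \<gamma> i(3,4)] idc_comp[OF sh g] D E' by simp
  moreover have "IdC D s \<star> \<gamma> \<in> hom2 D (s \<cdot> d0) (s \<cdot> d1)"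
    using hcomp_hom[OF \<gamma> i(3)] D by simp
  ultimately have "IdC D s \<star> \<gamma> = \<beta>"
    using whisker_faithful[OF g sh \<epsilon>' _ \<beta>] sd unfolding hom_def by auto
  moreover have "\<gamma>' = \<gamma>" if "\<gamma>' \<in> hom2 D d0 d1" "IdC D s \<star> \<gamma>' = \<beta>" for \<gamma>'
    using whisker_faithful[OF sh g \<eta> that(1) \<gamma>] that(2) \<open>IdC D s \<star> \<gamma> = \<beta>\<close> D by simp
  ultimately show ?thesis using \<gamma> by blast
qed

definition coded_2cat :: "('p, 'b, 'd) twocat \<Rightarrow> 'd set \<Rightarrow> ('d \<Rightarrow> 'u) \<Rightarrow> ('u, 'u, 'u) twocat" where
  "coded_2cat D S e =
     (let dc = inv_into S e; da = (\<lambda>u. Src D (dc u)); db = (\<lambda>u. Dom D (da u));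
          ea = (\<lambda>f. e (IdC D f)); eo = (\<lambda>X. ea (Ide D X))
      in \<lparr>Obj = eo ` {X \<in> Obj D. IdC D (Ide D X) \<in> S}, Arr = ea ` {f \<in> Arr D. IdC D f \<in> S},
          Dom = (\<lambda>u. eo (Dom D (da u))), Cod = (\<lambda>u. eo (Cod D (da u))),
          Ide = (\<lambda>u. ea (Ide D (db u))), Comp = (\<lambda>v u. ea (Comp D (da v) (da u))),
          Cell = e ` S, Src = (\<lambda>u. ea (Src D (dc u))), Trg = (\<lambda>u. ea (Trg D (dc u))),
          IdC = (\<lambda>u. e (IdC D (da u))), VComp = (\<lambda>v u. e (VComp D (dc v) (dc u))),
          HComp = (\<lambda>v u. e (HComp D (dc v) (dc u)))\<rparr>)"

locale sub_coding = two_category D for D :: "('p, 'b, 'd) twocat" (structure) +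
  fixes S :: "'d set" and e :: "'d \<Rightarrow> 'u"
  assumes sub: "S \<subseteq> Cell D" and inj: "inj_on e S"
    and clo: "c \<in> S \<Longrightarrow> IdC D (Src D c) \<in> S" "c \<in> S \<Longrightarrow> IdC D (Trg D c) \<in> S"
      "c \<in> S \<Longrightarrow> IdC D (Ide D (Dom D (Src D c))) \<in> S"
      "c \<in> S \<Longrightarrow> IdC D (Ide D (Cod D (Src D c))) \<in> S"
    and vclo: "c \<in> S \<Longrightarrow> d \<in> S \<Longrightarrow> Src D d = Trg D c \<Longrightarrow> d \<bullet> c \<in> S"
    and hclo: "c \<in> S \<Longrightarrow> d \<in> S \<Longrightarrow> Dom D (Src D d) = Cod D (Src D c) \<Longrightarrow> d \<star> c \<in> S"
begin

definition "O0 = {X \<in> Obj D. IdC D (Ide D X) \<in> S}"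
definition "A0 = {f \<in> Arr D. IdC D f \<in> S}"
definition "ea f = e (IdC D f)"
definition "eo X = ea (Ide D X)"
abbreviation "E \<equiv> coded_2cat D S e"

lemma srcidc: "f \<in> Arr D \<Longrightarrow> Src D (IdC D f) = f" "f \<in> Arr D \<Longrightarrow> IdC D f \<in> Cell D"
  "f \<in> Arr D \<Longrightarrow> Trg D (IdC D f) = f"
  using idc_hom[of f] unfolding hom2_def by auto

lemma ideD: "X \<in> Obj D \<Longrightarrow> Ide D X \<in> Arr D" "X \<in> Obj D \<Longrightarrow> Dom D (Ide D X) = X"
   "X \<in> Obj D \<Longrightarrow> Cod D (Ide D X) = X"
  using ide_hom[of X] unfolding hom_def by auto

lemma dec: "c \<in> S \<Longrightarrow> inv_into S e (e c) = c" using inj by simp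
lemma deca: "f \<in> A0 \<Longrightarrow> inv_into S e (ea f) = IdC D f" unfolding A0_def ea_def using dec by simp

lemma ea_eq: "f \<in> A0 \<Longrightarrow> g \<in> A0 \<Longrightarrow> ea f = ea g \<longleftrightarrow> f = g"
  by (metis deca srcidc(1) A0_def mem_Collect_eq)
lemma eo_eq: "X \<in> O0 \<Longrightarrow> Y \<in> O0 \<Longrightarrow> eo X = eo Y \<longleftrightarrow> X = Y"
proof -
  assume "X \<in> O0" "Y \<in> O0"
  then have "Ide D X \<in> A0" "Ide D Y \<in> A0" "X \<in> Obj D" "Y \<in> Obj D" unfolding O0_def A0_def using ideD by auto
  then show ?thesis unfolding eo_def using ea_eq ideD by metis
qed
lemma e_eq: "c \<in> S \<Longrightarrow> d \<in> S \<Longrightarrow> e c = e d \<longleftrightarrow> c = d" using inj by (meson inj_onD)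

lemma in0: "X \<in> O0 \<Longrightarrow> Ide D X \<in> A0" "f \<in> A0 \<Longrightarrow> Dom D f \<in> O0" "f \<in> A0 \<Longrightarrow> Cod D f \<in> O0"
  "f \<in> A0 \<Longrightarrow> g \<in> A0 \<Longrightarrow> Dom D g = Cod D f \<Longrightarrow> g \<cdot> f \<in> A0"
  "c \<in> S \<Longrightarrow> Src D c \<in> A0" "c \<in> S \<Longrightarrow> Trg D c \<in> A0" "f \<in> A0 \<Longrightarrow> IdC D f \<in> S"
proof -
  show "X \<in> O0 \<Longrightarrow> Ide D X \<in> A0" using ideD unfolding O0_def A0_def by auto
  show "f \<in> A0 \<Longrightarrow> Dom D f \<in> O0" "f \<in> A0 \<Longrightarrow> Cod D f \<in> O0"
    using clo(3,4)[of "IdC D f"] srcidc dom_closed cod_closed unfolding O0_def A0_def by auto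
  show "f \<in> A0 \<Longrightarrow> g \<in> A0 \<Longrightarrow> Dom D g = Cod D f \<Longrightarrow> g \<cdot> f \<in> A0"
    using hclo[of "IdC D f" "IdC D g"] idc_comp[of f "Dom D f" "Cod D f" g "Cod D g"]
      comp_hom[of f "Dom D f" "Cod D f" g "Cod D g"] srcidc unfolding A0_def hom_def by auto
  show "c \<in> S \<Longrightarrow> Src D c \<in> A0" "c \<in> S \<Longrightarrow> Trg D c \<in> A0"
    using clo(1,2) src_closed trg_parallel sub unfolding A0_def hom_def by auto
  show "f \<in> A0 \<Longrightarrow> IdC D f \<in> S" unfolding A0_def by auto
qed

lemma sub0: "f \<in> A0 \<Longrightarrow> f \<in> Arr D" "X \<in> O0 \<Longrightarrow> X \<in> Obj D" "c \<in> S \<Longrightarrow> c \<in> Cell D"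
  using sub unfolding A0_def O0_def by auto

lemma E_sets: "Obj E = eo ` O0" "Arr E = ea ` A0" "Cell E = e ` S"
  by (simp_all add: coded_2cat_def Let_def O0_def A0_def ea_def eo_def)

lemma E_ops [simp]:
  "f \<in> A0 \<Longrightarrow> Dom E (ea f) = eo (Dom D f)" "f \<in> A0 \<Longrightarrow> Cod E (ea f) = eo (Cod D f)"
  "X \<in> O0 \<Longrightarrow> Ide E (eo X) = ea (Ide D X)"
  "f \<in> A0 \<Longrightarrow> g \<in> A0 \<Longrightarrow> Comp E (ea g) (ea f) = ea (g \<cdot> f)"
  "c \<in> S \<Longrightarrow> Src E (e c) = ea (Src D c)" "c \<in> S \<Longrightarrow> Trg E (e c) = ea (Trg D c)"
  "f \<in> A0 \<Longrightarrow> IdC E (ea f) = e (IdC D f)"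
  "c \<in> S \<Longrightarrow> d \<in> S \<Longrightarrow> VComp E (e d) (e c) = e (d \<bullet> c)"
  "c \<in> S \<Longrightarrow> d \<in> S \<Longrightarrow> HComp E (e d) (e c) = e (d \<star> c)"
proof -
  have x: "inv_into S e (e (IdC D f)) = IdC D f" if "f \<in> A0" for f
    using dec in0(7)[OF that] by simp
  show "f \<in> A0 \<Longrightarrow> Dom E (ea f) = eo (Dom D f)" "f \<in> A0 \<Longrightarrow> Cod E (ea f) = eo (Cod D f)"
    "X \<in> O0 \<Longrightarrow> Ide E (eo X) = ea (Ide D X)"
    "f \<in> A0 \<Longrightarrow> g \<in> A0 \<Longrightarrow> Comp E (ea g) (ea f) = ea (g \<cdot> f)"
    "c \<in> S \<Longrightarrow> Src E (e c) = ea (Src D c)" "c \<in> S \<Longrightarrow> Trg E (e c) = ea (Trg D c)"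
    "f \<in> A0 \<Longrightarrow> IdC E (ea f) = e (IdC D f)"
    "c \<in> S \<Longrightarrow> d \<in> S \<Longrightarrow> VComp E (e d) (e c) = e (d \<bullet> c)"
    "c \<in> S \<Longrightarrow> d \<in> S \<Longrightarrow> HComp E (e d) (e c) = e (d \<star> c)"
    using in0(1)[of X] x sub0 ideD
    by (auto simp: coded_2cat_def Let_def ea_def eo_def dec srcidc)
qed

lemma E_hom: "X \<in> O0 \<Longrightarrow> Y \<in> O0 \<Longrightarrow> u \<in> hom E (eo X) (eo Y) \<longleftrightarrow> (\<exists>f \<in> A0. u = ea f \<and> f \<in> hom D X Y)"
  unfolding hom_def E_sets using eo_eq in0 sub0 by auto
lemma E_hom2: "f \<in> A0 \<Longrightarrow> g \<in> A0 \<Longrightarrow> u \<in> hom2 E (ea f) (ea g) \<longleftrightarrow> (\<exists>c \<in> S. u = e c \<and> c \<in> hom2 D f g)"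
  unfolding hom2_def E_sets using ea_eq in0 sub0 by auto
lemma E_homE: assumes "u \<in> hom E X Y"
  obtains f where "f \<in> A0" "u = ea f" "X = eo (Dom D f)" "Y = eo (Cod D f)"
  using assms unfolding hom_def E_sets by auto
lemma E_hom2E: assumes "u \<in> hom2 E f g"
  obtains c where "c \<in> S" "u = e c" "f = ea (Src D c)" "g = ea (Trg D c)"
  using assms unfolding hom2_def E_sets by auto

lemma compD: assumes "f \<in> Arr D" "g \<in> Arr D" "Dom D g = Cod D f"
  shows "g \<cdot> f \<in> Arr D" "Dom D (g \<cdot> f) = Dom D f" "Cod D (g \<cdot> f) = Cod D g"
  using comp_hom[of f "Dom D f" "Cod D f" g "Cod D g"] assms unfolding hom_def by auto
lemma celD: assumes "c \<in> Cell D"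
  shows "Src D c \<in> Arr D" "Trg D c \<in> Arr D" "Dom D (Trg D c) = Dom D (Src D c)"
    "Cod D (Trg D c) = Cod D (Src D c)"
  using src_closed trg_parallel assms unfolding hom_def by auto
lemma vD: assumes "c \<in> Cell D" "d \<in> Cell D" "Src D d = Trg D c"
  shows "d \<bullet> c \<in> Cell D" "Src D (d \<bullet> c) = Src D c" "Trg D (d \<bullet> c) = Trg D d"
  using vcomp_hom[of c "Src D c" "Trg D c" d "Trg D d"] assms unfolding hom2_def by auto
lemma hD: assumes "c \<in> Cell D" "d \<in> Cell D" "Dom D (Src D d) = Cod D (Src D c)"
  shows "d \<star> c \<in> Cell D" "Src D (d \<star> c) = Src D d \<cdot> Src D c" "Trg D (d \<star> c) = Trg D d \<cdot> Trg D c"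
  using hcomp_hom[of c "Src D c" "Trg D c" d "Src D d" "Trg D d"] assms unfolding hom2_def by auto

lemma E_two_category: "two_category E"
proof
  show "f \<in> Arr E \<Longrightarrow> Dom E f \<in> Obj E" "f \<in> Arr E \<Longrightarrow> Cod E f \<in> Obj E" for f
    unfolding E_sets using in0 by auto
  show "X \<in> Obj E \<Longrightarrow> Ide E X \<in> hom E X X" for X
    unfolding E_sets hom_def using in0 sub0 ideD by auto
  show "g \<cdot>\<^bsub>E\<^esub> f \<in> hom E X Z" if fg: "f \<in> hom E X Y" "g \<in> hom E Y Z" for f g X Y Z
  proof -
    obtain f' where f: "f' \<in> A0" "f = ea f'" "X = eo (Dom D f')" "Y = eo (Cod D f')" using E_homE fg by metis
    obtain g' where g: "g' \<in> A0" "g = ea g'" "Y = eo (Dom D g')" "Z = eo (Cod D g')" using E_homE fg by metis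
    have m: "Dom D g' = Cod D f'" using f g eo_eq in0 by metis
    then show ?thesis unfolding hom_def E_sets using f g in0(4) compD[of f' g'] sub0 by auto
  qed
  show "f \<in> Arr E \<Longrightarrow> f \<cdot>\<^bsub>E\<^esub> Ide E (Dom E f) = f" "f \<in> Arr E \<Longrightarrow> Ide E (Cod E f) \<cdot>\<^bsub>E\<^esub> f = f" for f
    unfolding E_sets using in0 sub0 comp_ide ide_comp by auto
  show "(h \<cdot>\<^bsub>E\<^esub> g) \<cdot>\<^bsub>E\<^esub> f = h \<cdot>\<^bsub>E\<^esub> (g \<cdot>\<^bsub>E\<^esub> f)"
    if fg: "f \<in> hom E X Y" "g \<in> hom E Y Z" "h \<in> hom E Z U" for f g h X Y Z U
  proof -
    obtain f' where f: "f' \<in> A0" "f = ea f'" "X = eo (Dom D f')" "Y = eo (Cod D f')" using E_homE fg by metis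
    obtain g' where g: "g' \<in> A0" "g = ea g'" "Y = eo (Dom D g')" "Z = eo (Cod D g')" using E_homE fg by metis
    obtain h' where h: "h' \<in> A0" "h = ea h'" "Z = eo (Dom D h')" "U = eo (Cod D h')" using E_homE fg by metis
    have m: "Dom D g' = Cod D f'" "Dom D h' = Cod D g'" using f g h eo_eq in0 by metis+
    then have "(h' \<cdot> g') \<cdot> f' = h' \<cdot> (g' \<cdot> f')"
      using comp_assoc[of f' "Dom D f'" "Cod D f'" g' "Cod D g'" h' "Cod D h'"] f g h sub0 unfolding hom_def by auto
    then show ?thesis using f g h m in0(4) by auto
  qed
  show "c \<in> Cell E \<Longrightarrow> Src E c \<in> Arr E" for c unfolding E_sets using in0 by auto
  show "c \<in> Cell E \<Longrightarrow> Trg E c \<in> hom E (Dom E (Src E c)) (Cod E (Src E c))" for c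
    unfolding E_sets hom_def using in0(5,6) celD sub0 by auto
  show "f \<in> Arr E \<Longrightarrow> IdC E f \<in> hom2 E f f" for f
    unfolding E_sets hom2_def using in0(7) srcidc sub0 by auto
  show "b \<bullet>\<^bsub>E\<^esub> a \<in> hom2 E f h" if ab: "a \<in> hom2 E f g" "b \<in> hom2 E g h" for a b f g h
  proof -
    obtain a' where a: "a' \<in> S" "a = e a'" "f = ea (Src D a')" "g = ea (Trg D a')" using E_hom2E ab by metis
    obtain b' where b: "b' \<in> S" "b = e b'" "g = ea (Src D b')" "h = ea (Trg D b')" using E_hom2E ab by metis
    have "Src D b' = Trg D a'" using a b ea_eq in0 by metis
    then show ?thesis unfolding hom2_def E_sets using a b vclo[of a' b'] vD[of a' b'] sub0 by auto
  qed
  show "a \<in> Cell E \<Longrightarrow> a \<bullet>\<^bsub>E\<^esub> IdC E (Src E a) = a" "a \<in> Cell E \<Longrightarrow> IdC E (Trg E a) \<bullet>\<^bsub>E\<^esub> a = a" for a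
    unfolding E_sets using in0 sub0 vcomp_idc idc_vcomp by auto
  show "(c \<bullet>\<^bsub>E\<^esub> b) \<bullet>\<^bsub>E\<^esub> a = c \<bullet>\<^bsub>E\<^esub> (b \<bullet>\<^bsub>E\<^esub> a)"
    if ab: "a \<in> hom2 E f g" "b \<in> hom2 E g h" "c \<in> hom2 E h k" for a b c f g h k
  proof -
    obtain a' where a: "a' \<in> S" "a = e a'" "f = ea (Src D a')" "g = ea (Trg D a')" using E_hom2E ab by metis
    obtain b' where b: "b' \<in> S" "b = e b'" "g = ea (Src D b')" "h = ea (Trg D b')" using E_hom2E ab by metis
    obtain c' where c: "c' \<in> S" "c = e c'" "h = ea (Src D c')" "k = ea (Trg D c')" using E_hom2E ab by metis
    have m: "Src D b' = Trg D a'" "Src D c' = Trg D b'" using a b c ea_eq in0 by metis+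
    then have "(c' \<bullet> b') \<bullet> a' = c' \<bullet> (b' \<bullet> a')"
      using vcomp_assoc[of a' "Src D a'" "Trg D a'" b' "Trg D b'" c' "Trg D c'"] a b c sub0 unfolding hom2_def by auto
    then show ?thesis using a b c m vclo vD[of a' b'] vD[of b' c'] sub0 by auto
  qed
  show "b \<star>\<^bsub>E\<^esub> a \<in> hom2 E (g \<cdot>\<^bsub>E\<^esub> f) (g' \<cdot>\<^bsub>E\<^esub> f')"
    if ab: "a \<in> hom2 E f f'" "b \<in> hom2 E g g'" "Dom E g = Cod E f" for a b f f' g g'
  proof -
    obtain a' where a: "a' \<in> S" "a = e a'" "f = ea (Src D a')" "f' = ea (Trg D a')" using E_hom2E ab by metis
    obtain b' where b: "b' \<in> S" "b = e b'" "g = ea (Src D b')" "g' = ea (Trg D b')" using E_hom2E ab by metis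
    have m: "Dom D (Src D b') = Cod D (Src D a')" using a b ab(3) eo_eq in0 by simp
    then show ?thesis unfolding hom2_def E_sets using a b in0(5,6) hclo[of a' b'] hD[of a' b'] sub0 by auto
  qed
  show "a \<in> Cell E \<Longrightarrow> a \<star>\<^bsub>E\<^esub> IdC E (Ide E (Dom E (Src E a))) = a"
     "a \<in> Cell E \<Longrightarrow> IdC E (Ide E (Cod E (Src E a))) \<star>\<^bsub>E\<^esub> a = a" for a
    unfolding E_sets using in0 sub0 hcomp_idc idc_hcomp by auto
  show "(c \<star>\<^bsub>E\<^esub> b) \<star>\<^bsub>E\<^esub> a = c \<star>\<^bsub>E\<^esub> (b \<star>\<^bsub>E\<^esub> a)"
    if ab: "a \<in> hom2 E f f'" "b \<in> hom2 E g g'" "c \<in> hom2 E h h'" "Dom E g = Cod E f" "Dom E h = Cod E g"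
    for a b c f f' g g' h h'
  proof -
    obtain a' where a: "a' \<in> S" "a = e a'" "f = ea (Src D a')" "f' = ea (Trg D a')" using E_hom2E ab by metis
    obtain b' where b: "b' \<in> S" "b = e b'" "g = ea (Src D b')" "g' = ea (Trg D b')" using E_hom2E ab by metis
    obtain c' where c: "c' \<in> S" "c = e c'" "h = ea (Src D c')" "h' = ea (Trg D c')" using E_hom2E ab by metis
    have m: "Dom D (Src D b') = Cod D (Src D a')" "Dom D (Src D c') = Cod D (Src D b')"
      using a b c ab(4,5) eo_eq in0 by simp_all
    then have "(c' \<star> b') \<star> a' = c' \<star> (b' \<star> a')"
      using hcomp_assoc[of a' "Src D a'" "Trg D a'" b' "Src D b'" "Trg D b'" c' "Src D c'" "Trg D c'"]
        a b c sub0 unfolding hom2_def by auto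
    then show ?thesis using a b c m hclo hD[of a' b'] hD[of b' c'] sub0 celD compD by auto
  qed
  show "IdC E g \<star>\<^bsub>E\<^esub> IdC E f = IdC E (g \<cdot>\<^bsub>E\<^esub> f)" if fg: "f \<in> hom E X Y" "g \<in> hom E Y Z" for f g X Y Z
  proof -
    obtain f' where f: "f' \<in> A0" "f = ea f'" "X = eo (Dom D f')" "Y = eo (Cod D f')" using E_homE fg by metis
    obtain g' where g: "g' \<in> A0" "g = ea g'" "Y = eo (Dom D g')" "Z = eo (Cod D g')" using E_homE fg by metis
    have m: "Dom D g' = Cod D f'" using f g eo_eq in0 by metis
    then show ?thesis using f g in0(4,7) sub0 idc_comp[of f' "Dom D f'" "Cod D f'" g' "Cod D g'"]
      unfolding hom_def by auto
  qed
  show "(b' \<bullet>\<^bsub>E\<^esub> b) \<star>\<^bsub>E\<^esub> (a' \<bullet>\<^bsub>E\<^esub> a) = (b' \<star>\<^bsub>E\<^esub> a') \<bullet>\<^bsub>E\<^esub> (b \<star>\<^bsub>E\<^esub> a)"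
    if ab: "a \<in> hom2 E f f'" "a' \<in> hom2 E f' f''" "b \<in> hom2 E g g'" "b' \<in> hom2 E g' g''" "Dom E g = Cod E f"
    for a a' b b' f f' f'' g g' g''
  proof -
    obtain a1 where a: "a1 \<in> S" "a = e a1" "f = ea (Src D a1)" "f' = ea (Trg D a1)" using E_hom2E ab by metis
    obtain a2 where a': "a2 \<in> S" "a' = e a2" "f' = ea (Src D a2)" "f'' = ea (Trg D a2)" using E_hom2E ab by metis
    obtain b1 where b: "b1 \<in> S" "b = e b1" "g = ea (Src D b1)" "g' = ea (Trg D b1)" using E_hom2E ab by metis
    obtain b2 where b': "b2 \<in> S" "b' = e b2" "g' = ea (Src D b2)" "g'' = ea (Trg D b2)" using E_hom2E ab by metis
    have m: "Dom D (Src D b1) = Cod D (Src D a1)" using a b ab(5) eo_eq in0 by simp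
    have m2: "Src D a2 = Trg D a1" "Src D b2 = Trg D b1" using a a' b b' ea_eq in0 by metis+
    have m3: "Dom D (Src D b2) = Cod D (Src D a2)" using m m2 celD a b sub0 by auto
    have "(b2 \<bullet> b1) \<star> (a2 \<bullet> a1) = (b2 \<star> a2) \<bullet> (b1 \<star> a1)"
      using interchange[of a1 "Src D a1" "Trg D a1" a2 "Trg D a2" b1 "Src D b1" "Trg D b1" b2 "Trg D b2"]
        a a' b b' m m2 sub0 unfolding hom2_def by auto
    then show ?thesis using a a' b b' m m2 m3 vclo hclo sub0
       vD[of a1 a2] vD[of b1 b2] hD[of a1 b1] hD[of a2 b2] by auto
  qed
qed
end

lemma disc_simps [simp]: "Obj (disc A) = Obj A" "Arr (disc A) = Arr A" "Dom (disc A) = Dom A"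
  "Cod (disc A) = Cod A" "Ide (disc A) = Ide A" "Comp (disc A) = Comp A" "Cell (disc A) = Arr A"
  "Src (disc A) = (\<lambda>f. f)" "Trg (disc A) = (\<lambda>f. f)" "IdC (disc A) = (\<lambda>f. f)"
  "VComp (disc A) = (\<lambda>g f. f)" "HComp (disc A) = Comp A"
  by (simp_all add: disc_def)

lemma disc_functorD:
  assumes "two_functor (disc A) D F"
  shows "X \<in> Obj A \<Longrightarrow> FObj F X \<in> Obj D"
    "f \<in> Arr A \<Longrightarrow> FArr F f \<in> Arr D" "f \<in> Arr A \<Longrightarrow> Dom D (FArr F f) = FObj F (Dom A f)"
    "f \<in> Arr A \<Longrightarrow> Cod D (FArr F f) = FObj F (Cod A f)"
    "X \<in> Obj A \<Longrightarrow> FArr F (Ide A X) = Ide D (FObj F X)"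
    "f \<in> Arr A \<Longrightarrow> g \<in> Arr A \<Longrightarrow> Dom A g = Cod A f \<Longrightarrow>
       FArr F (g \<cdot>\<^bsub>A\<^esub> f) = FArr F g \<cdot>\<^bsub>D\<^esub> FArr F f"
    "f \<in> Arr A \<Longrightarrow> FCell F f = IdC D (FArr F f)"
  using assms unfolding two_functor_def is_functor_def hom_def by auto

lemma hat_cyl:
  assumes D: "two_category D" and F: "two_functor (disc A) D F" "inverts F \<Sigma> D"
    and C: "is_cylinder A \<Sigma> X C"
  shows "hat_cyl D F C \<in> hom2 D (FArr F (cyl_d0 C)) (FArr F (cyl_d1 C)) \<and>
     IdC D (FArr F (cyl_s C)) \<star>\<^bsub>D\<^esub> hat_cyl D F C = IdC D (FArr F (cyl_x C))"
    and "\<gamma> \<in> hom2 D (FArr F (cyl_d0 C)) (FArr F (cyl_d1 C)) \<Longrightarrow>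
     IdC D (FArr F (cyl_s C)) \<star>\<^bsub>D\<^esub> \<gamma> = IdC D (FArr F (cyl_x C)) \<Longrightarrow> hat_cyl D F C = \<gamma>"
proof -
  interpret two_category D by fact
  have c: "cyl_d0 C \<in> hom A X (cylW C)" "cyl_d1 C \<in> hom A X (cylW C)"
     "cyl_s C \<in> hom A (cylW C) (cylZ C)" "cyl_x C \<in> hom A X (cylZ C)" "cyl_s C \<in> \<Sigma>"
     "cyl_s C \<cdot>\<^bsub>A\<^esub> cyl_d0 C = cyl_x C" "cyl_s C \<cdot>\<^bsub>A\<^esub> cyl_d1 C = cyl_x C"
    using C unfolding is_cylinder_def by auto
  have a: "cyl_d0 C \<in> Arr A" "cyl_d1 C \<in> Arr A" "cyl_s C \<in> Arr A" "cyl_x C \<in> Arr A"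
     "Dom A (cyl_d0 C) = X" "Dom A (cyl_d1 C) = X" "Dom A (cyl_s C) = cylW C"
     "Cod A (cyl_d0 C) = cylW C" "Cod A (cyl_d1 C) = cylW C"
    using c unfolding hom_def by auto
  have e: "equivalence D (FArr F (cyl_s C))" using F(2) c(5) unfolding inverts_def by blast
  have x: "FArr F (cyl_s C) \<cdot>\<^bsub>D\<^esub> FArr F (cyl_d0 C) = FArr F (cyl_x C)"
    "FArr F (cyl_s C) \<cdot>\<^bsub>D\<^esub> FArr F (cyl_d1 C) = FArr F (cyl_x C)"
    using disc_functorD(6)[OF F(1)] a c by metis+
  have "\<exists>!\<gamma>. \<gamma> \<in> hom2 D (FArr F (cyl_d0 C)) (FArr F (cyl_d1 C)) \<and>
     IdC D (FArr F (cyl_s C)) \<star>\<^bsub>D\<^esub> \<gamma> = IdC D (FArr F (cyl_x C))"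
    using whisker_full_faithful[OF e, of "FArr F (cyl_d0 C)" "FObj F X" "FArr F (cyl_d1 C)"
       "IdC D (FArr F (cyl_x C))"] disc_functorD[OF F(1)] a x idc_hom[of "FArr F (cyl_x C)"]
    unfolding hom_def by auto
  from theI'[OF this] this show "hat_cyl D F C \<in> hom2 D (FArr F (cyl_d0 C)) (FArr F (cyl_d1 C)) \<and>
     IdC D (FArr F (cyl_s C)) \<star>\<^bsub>D\<^esub> hat_cyl D F C = IdC D (FArr F (cyl_x C))"
    and "\<gamma> \<in> hom2 D (FArr F (cyl_d0 C)) (FArr F (cyl_d1 C)) \<Longrightarrow>
     IdC D (FArr F (cyl_s C)) \<star>\<^bsub>D\<^esub> \<gamma> = IdC D (FArr F (cyl_x C)) \<Longrightarrow> hat_cyl D F C = \<gamma>"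
    unfolding hat_cyl_def by blast+
qed

lemma (in sub_coding) hat_coded:
  assumes A: "category A" "\<Sigma> \<subseteq> Arr A" and F: "two_functor (disc A) D F" "inverts F \<Sigma> D"
    and FA: "\<And>f. f \<in> Arr A \<Longrightarrow> FArr F f \<in> A0"
    and eq: "\<And>s. s \<in> \<Sigma> \<Longrightarrow> \<exists>g \<in> A0. g \<in> hom D (Cod D (FArr F s)) (Dom D (FArr F s)) \<and>
        (\<exists>\<eta> \<in> S. \<exists>\<eta>' \<in> S. \<eta> \<in> hom2 D (Ide D (Dom D (FArr F s))) (g \<cdot> FArr F s) \<and>
           \<eta>' \<in> hom2 D (g \<cdot> FArr F s) (Ide D (Dom D (FArr F s))) \<and>
           \<eta>' \<bullet> \<eta> = IdC D (Ide D (Dom D (FArr F s))) \<and> \<eta> \<bullet> \<eta>' = IdC D (g \<cdot> FArr F s)) \<and>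
        (\<exists>\<epsilon> \<in> S. \<exists>\<epsilon>' \<in> S. \<epsilon> \<in> hom2 D (FArr F s \<cdot> g) (Ide D (Cod D (FArr F s))) \<and>
           \<epsilon>' \<in> hom2 D (Ide D (Cod D (FArr F s))) (FArr F s \<cdot> g) \<and>
           \<epsilon>' \<bullet> \<epsilon> = IdC D (FArr F s \<cdot> g) \<and> \<epsilon> \<bullet> \<epsilon>' = IdC D (Ide D (Cod D (FArr F s))))"
  defines "F0 \<equiv> \<lparr>FObj = (\<lambda>X\<in>Obj A. eo (FObj F X)), FArr = (\<lambda>f\<in>Arr A. ea (FArr F f)),
     FCell = (\<lambda>f\<in>Arr A. e (FCell F f))\<rparr>"
  shows "two_functor (disc A) E F0 \<and> inverts F0 \<Sigma> E \<and>
    (\<forall>f g Hs. is_hseq A \<Sigma> f g Hs \<longrightarrow> hat_hseq D F Hs \<in> S \<and> hat_hseq E F0 Hs = e (hat_hseq D F Hs))"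
proof (intro conjI allI impI)
  interpret A: category A by fact
  have ADC: "f \<in> Arr A \<Longrightarrow> Dom A f \<in> Obj A" "f \<in> Arr A \<Longrightarrow> Cod A f \<in> Obj A"
    "X \<in> Obj A \<Longrightarrow> Ide A X \<in> Arr A" "X \<in> Obj A \<Longrightarrow> Dom A (Ide A X) = X" for f X
    using A.dom_closed A.cod_closed A.ide_hom unfolding hom_def by auto
  have Ac: "g \<cdot>\<^bsub>A\<^esub> f \<in> Arr A" if "f \<in> Arr A" "g \<in> Arr A" "Dom A g = Cod A f" for f g
    using A.comp_hom[of f "Dom A f" "Cod A f" g "Cod A g"] that unfolding hom_def by auto
  note FD = disc_functorD[OF F(1)]
  have FO: "FObj F X \<in> O0" if "X \<in> Obj A" for X
    using in0(2)[OF FA[of "Ide A X"]] FD(3)[of "Ide A X"] ADC that by simp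
  have F0s: "X \<in> Obj A \<Longrightarrow> FObj F0 X = eo (FObj F X)" "f \<in> Arr A \<Longrightarrow> FArr F0 f = ea (FArr F f)"
    "f \<in> Arr A \<Longrightarrow> FCell F0 f = e (IdC D (FArr F f))" for X f
    unfolding F0_def using FD(7) by auto
  show F0: "two_functor (disc A) E F0"
    unfolding two_functor_def is_functor_def
  proof (intro conjI ballI impI)
    show "FObj F0 \<in> extensional (Obj (disc A))" "FArr F0 \<in> extensional (Arr (disc A))"
      "FCell F0 \<in> extensional (Cell (disc A))" by (simp_all add: F0_def)
  next
    fix f g assume fg: "f \<in> Cell (disc A)" "g \<in> Cell (disc A)" "Src (disc A) g = Trg (disc A) f"
    then have "IdC D (FArr F f) \<bullet> IdC D (FArr F f) = IdC D (FArr F f)"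
      using vcomp_idc[of "IdC D (FArr F f)"] srcidc FD(2) by simp
    then show "FCell F0 (g \<bullet>\<^bsub>disc A\<^esub> f) = FCell F0 g \<bullet>\<^bsub>E\<^esub> FCell F0 f"
      using fg FA in0(7) by (simp add: F0s)
  next
    fix f g assume fg: "f \<in> Cell (disc A)" "g \<in> Cell (disc A)"
       "Dom (disc A) (Src (disc A) g) = Cod (disc A) (Src (disc A) f)"
    then have "IdC D (FArr F g) \<star> IdC D (FArr F f) = IdC D (FArr F (g \<cdot>\<^bsub>A\<^esub> f))"
      using idc_comp[of "FArr F f" _ _ "FArr F g"] FD unfolding hom_def by simp
    then show "FCell F0 (g \<star>\<^bsub>disc A\<^esub> f) = FCell F0 g \<star>\<^bsub>E\<^esub> FCell F0 f"
      using fg FA in0(7) Ac by (simp add: F0s)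
  qed (use FA FO FD in0 sub0 srcidc ADC Ac in \<open>auto simp: F0s E_sets hom_def hom2_def\<close>)
  show F0i: "inverts F0 \<Sigma> E" unfolding inverts_def
  proof
    fix s assume s: "s \<in> \<Sigma>"
    then have sA: "s \<in> Arr A" using A by auto
    define t where "t = FArr F s"
    have t: "t \<in> A0" "FArr F0 s = ea t" unfolding t_def using sA FA F0s by auto
    obtain g \<eta> \<eta>' \<epsilon> \<epsilon>' where g: "g \<in> A0" "g \<in> hom D (Cod D t) (Dom D t)"
      and eta: "\<eta> \<in> S" "\<eta>' \<in> S" "\<eta> \<in> hom2 D (Ide D (Dom D t)) (g \<cdot> t)" "\<eta>' \<in> hom2 D (g \<cdot> t) (Ide D (Dom D t))"
       "\<eta>' \<bullet> \<eta> = IdC D (Ide D (Dom D t))" "\<eta> \<bullet> \<eta>' = IdC D (g \<cdot> t)"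
      and eps: "\<epsilon> \<in> S" "\<epsilon>' \<in> S" "\<epsilon> \<in> hom2 D (t \<cdot> g) (Ide D (Cod D t))" "\<epsilon>' \<in> hom2 D (Ide D (Cod D t)) (t \<cdot> g)"
       "\<epsilon>' \<bullet> \<epsilon> = IdC D (t \<cdot> g)" "\<epsilon> \<bullet> \<epsilon>' = IdC D (Ide D (Cod D t))"
      using eq[OF s] unfolding t_def[symmetric] by blast
    have gd: "Dom D g = Cod D t" "Cod D g = Dom D t" using g unfolding hom_def by auto
    have ids: "Ide D (Dom D t) \<in> A0" "Ide D (Cod D t) \<in> A0" "g \<cdot> t \<in> A0" "t \<cdot> g \<in> A0"
      using in0 t g gd by auto
    have q: "Ide E (Dom E (ea t)) = ea (Ide D (Dom D t))" "Ide E (Cod E (ea t)) = ea (Ide D (Cod D t))"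
      "Comp E (ea g) (ea t) = ea (g \<cdot> t)" "Comp E (ea t) (ea g) = ea (t \<cdot> g)"
      using t g in0 by auto
    have inv: "invertible E (e c)" if "c \<in> S" "d \<in> S" "a \<in> A0" "b \<in> A0" "c \<in> hom2 D a b" "d \<in> hom2 D b a"
       "d \<bullet> c = IdC D a" "c \<bullet> d = IdC D b" for a b c d
      proof -
      have "e d \<in> hom2 E (ea b) (ea a)" using E_hom2 that by blast
      moreover have "e c \<in> Cell E" "Src E (e c) = ea a" "Trg E (e c) = ea b"
        using that E_sets unfolding hom2_def by auto
      moreover have "e d \<bullet>\<^bsub>E\<^esub> e c = IdC E (ea a)" "e c \<bullet>\<^bsub>E\<^esub> e d = IdC E (ea b)"
        using that by simp_all
      ultimately show ?thesis unfolding invertible_def by auto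
    qed
    have "e \<eta> \<in> hom2 E (ea (Ide D (Dom D t))) (ea (g \<cdot> t))" "e \<epsilon> \<in> hom2 E (ea (t \<cdot> g)) (ea (Ide D (Cod D t)))"
      using E_hom2 ids eta eps by blast+
    moreover have "invertible E (e \<eta>)" "invertible E (e \<epsilon>)"
      using inv[OF eta(1,2) ids(1,3) eta(3-6)] inv[OF eps(1,2) ids(4,2) eps(3-6)] by auto
    moreover have "ea g \<in> hom E (Cod E (ea t)) (Dom E (ea t))" using t g E_hom in0 by auto
    moreover have "ea t \<in> Arr E" using t E_sets by auto
    ultimately show "equivalence E (FArr F0 s)"
      unfolding equivalence_def t(2) q(1,2)
      by - (rule conjI, blast, rule bexI[of _ "ea g"], unfold q(3,4), blast+)
  qed
  have cyl: "hat_cyl D F C \<in> S \<and> hat_cyl E F0 C = e (hat_cyl D F C) \<and>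
      hat_cyl D F C \<in> hom2 D (FArr F (cyl_d0 C)) (FArr F (cyl_d1 C))"
    if C: "is_cylinder A \<Sigma> X C" for X C
  proof -
    have a: "cyl_d0 C \<in> Arr A" "cyl_d1 C \<in> Arr A" "cyl_s C \<in> Arr A" "cyl_x C \<in> Arr A"
       "Cod A (cyl_d0 C) = Dom A (cyl_s C)"
      using C unfolding is_cylinder_def hom_def by auto
    have "hat_cyl E F0 C \<in> hom2 E (ea (FArr F (cyl_d0 C))) (ea (FArr F (cyl_d1 C)))"
      using hat_cyl(1)[OF E_two_category F0 F0i C] a by (simp add: F0s)
    then obtain c where c: "c \<in> S" "hat_cyl E F0 C = e c" "c \<in> hom2 D (FArr F (cyl_d0 C)) (FArr F (cyl_d1 C))"
      using E_hom2 FA a by blast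
    have "e (IdC D (FArr F (cyl_s C)) \<star> c) = e (IdC D (FArr F (cyl_x C)))"
      using hat_cyl(1)[OF E_two_category F0 F0i C] c FA a in0(7) by (simp add: F0s)
    moreover have "IdC D (FArr F (cyl_s C)) \<star> c \<in> S"
      using hclo[of c "IdC D (FArr F (cyl_s C))"] c(1,3) FA a in0(7) FD srcidc
      unfolding hom2_def by simp
    ultimately have "IdC D (FArr F (cyl_s C)) \<star> c = IdC D (FArr F (cyl_x C))"
      using e_eq in0(7) FA a by simp
    then have "hat_cyl D F C = c" using hat_cyl(2)[OF two_category_axioms F C] c by simp
    then show ?thesis using c by simp
  qed
  have hty: "hat_htpy D F H \<in> S \<and> hat_htpy E F0 H = e (hat_htpy D F H) \<and>
      hat_htpy D F H \<in> hom2 D (FArr F f) (FArr F g)" if H: "is_homotopy A \<Sigma> f g H" for f g H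
  proof -
    have C: "is_cylinder A \<Sigma> (Dom A f) (hcyl H)" using H unfolding is_homotopy_def by auto
    have a: "cyl_d0 (hcyl H) \<in> Arr A" "cyl_d1 (hcyl H) \<in> Arr A" "hmap H \<in> Arr A"
       "Cod A (cyl_d0 (hcyl H)) = Dom A (hmap H)" "Cod A (cyl_d1 (hcyl H)) = Dom A (hmap H)"
       "hmap H \<cdot>\<^bsub>A\<^esub> cyl_d0 (hcyl H) = f" "hmap H \<cdot>\<^bsub>A\<^esub> cyl_d1 (hcyl H) = g"
      using H unfolding is_homotopy_def is_cylinder_def hom_def by auto
    have fg: "FArr F f = FArr F (hmap H) \<cdot> FArr F (cyl_d0 (hcyl H))"
       "FArr F g = FArr F (hmap H) \<cdot> FArr F (cyl_d1 (hcyl H))" using FD(6) a by metis+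
    have i: "IdC D (FArr F (hmap H)) \<in> S" "IdC D (FArr F (hmap H)) \<in> hom2 D (FArr F (hmap H)) (FArr F (hmap H))"
      using a FA in0(7) idc_hom sub0 by auto
    note c = cyl[OF C]
    have "hat_htpy D F H \<in> hom2 D (FArr F f) (FArr F g)" unfolding hat_htpy_def fg
      using hcomp_hom[OF _ i(2)] c FD a by simp
    moreover have "hat_htpy D F H \<in> S" unfolding hat_htpy_def
      using hclo[of "hat_cyl D F (hcyl H)" "IdC D (FArr F (hmap H))"] c i FD a unfolding hom2_def by simp
    moreover have "hat_htpy E F0 H = e (hat_htpy D F H)" unfolding hat_htpy_def
      using c i a FA by (simp add: F0s)
    ultimately show ?thesis by simp
  qed
  have "hat_hseq D F Hs \<in> S \<and> hat_hseq E F0 Hs = e (hat_hseq D F Hs) \<and>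
      hat_hseq D F Hs \<in> hom2 D (FArr F f) (FArr F g)" if "is_hseq A \<Sigma> f g Hs" for f g Hs
    using that
  proof induction
    case (single f g H)
    then show ?case using hty by simp
  next
    case (step f g Hs k H)
    obtain K Ks where Hs: "Hs = K # Ks" using step(1) by (cases Hs) (auto elim: is_hseq.cases)
    have "hat_htpy D F H \<bullet> hat_hseq D F Hs \<in> S"
      using vclo[of "hat_hseq D F Hs" "hat_htpy D F H"] hty[OF step(2)] step(3) unfolding hom2_def by simp
    then show ?case using hty[OF step(2)] step(3) vcomp_hom unfolding Hs by auto
  qed
  then show "is_hseq A \<Sigma> f g Hs \<Longrightarrow> hat_hseq D F Hs \<in> S"
     "is_hseq A \<Sigma> f g Hs \<Longrightarrow> hat_hseq E F0 Hs = e (hat_hseq D F Hs)" for f g Hs by auto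
qed

lemma hseq_equiv_hat_eq:
  fixes A :: "('o, 'a) cat"
  assumes A: "category A" "\<Sigma> \<subseteq> Arr A"
    and HK: "is_hseq A \<Sigma> f g Hs" "is_hseq A \<Sigma> f g Ks" and HKeq: "hseq_equiv A \<Sigma> Hs Ks"
    and D: "two_category (D :: ('p, 'b, 'd) twocat)" and F: "two_functor (disc A) D F" "inverts F \<Sigma> D"
  shows "hat_hseq D F Hs = hat_hseq D F Ks"
proof -
  interpret D: two_category D by fact
  note FD = disc_functorD[OF F(1)]
  define P where "P s g \<eta> \<eta>' \<epsilon> \<epsilon>' \<longleftrightarrow>
      g \<in> hom D (Cod D (FArr F s)) (Dom D (FArr F s)) \<and>
        \<eta> \<in> hom2 D (Ide D (Dom D (FArr F s))) (g \<cdot>\<^bsub>D\<^esub> FArr F s) \<and>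
           \<eta>' \<in> hom2 D (g \<cdot>\<^bsub>D\<^esub> FArr F s) (Ide D (Dom D (FArr F s))) \<and>
           \<eta>' \<bullet>\<^bsub>D\<^esub> \<eta> = IdC D (Ide D (Dom D (FArr F s))) \<and> \<eta> \<bullet>\<^bsub>D\<^esub> \<eta>' = IdC D (g \<cdot>\<^bsub>D\<^esub> FArr F s) \<and>
        \<epsilon> \<in> hom2 D (FArr F s \<cdot>\<^bsub>D\<^esub> g) (Ide D (Cod D (FArr F s))) \<and>
           \<epsilon>' \<in> hom2 D (Ide D (Cod D (FArr F s))) (FArr F s \<cdot>\<^bsub>D\<^esub> g) \<and>
           \<epsilon>' \<bullet>\<^bsub>D\<^esub> \<epsilon> = IdC D (FArr F s \<cdot>\<^bsub>D\<^esub> g) \<and> \<epsilon> \<bullet>\<^bsub>D\<^esub> \<epsilon>' = IdC D (Ide D (Cod D (FArr F s)))" for s g \<eta> \<eta>' \<epsilon> \<epsilon>'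
  have ex: "\<exists>w. case w of (g, \<eta>, \<eta>', \<epsilon>, \<epsilon>') \<Rightarrow> P s g \<eta> \<eta>' \<epsilon> \<epsilon>'" if "s \<in> \<Sigma>" for s
  proof -
      from that have "equivalence D (FArr F s)" using F(2) unfolding inverts_def by auto
      then obtain g \<eta> \<epsilon> where g: "g \<in> hom D (Cod D (FArr F s)) (Dom D (FArr F s))"
        and eta: "\<eta> \<in> hom2 D (Ide D (Dom D (FArr F s))) (g \<cdot>\<^bsub>D\<^esub> FArr F s)" "invertible D \<eta>"
        and eps: "\<epsilon> \<in> hom2 D (FArr F s \<cdot>\<^bsub>D\<^esub> g) (Ide D (Cod D (FArr F s)))" "invertible D \<epsilon>"
        unfolding equivalence_def by blast
      obtain \<eta>' where eta': "\<eta>' \<in> hom2 D (g \<cdot>\<^bsub>D\<^esub> FArr F s) (Ide D (Dom D (FArr F s)))"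
        "\<eta>' \<bullet>\<^bsub>D\<^esub> \<eta> = IdC D (Ide D (Dom D (FArr F s)))" "\<eta> \<bullet>\<^bsub>D\<^esub> \<eta>' = IdC D (g \<cdot>\<^bsub>D\<^esub> FArr F s)"
        using D.inverse_invertible[OF eta] by metis
      obtain \<epsilon>' where eps': "\<epsilon>' \<in> hom2 D (Ide D (Cod D (FArr F s))) (FArr F s \<cdot>\<^bsub>D\<^esub> g)"
        "\<epsilon>' \<bullet>\<^bsub>D\<^esub> \<epsilon> = IdC D (FArr F s \<cdot>\<^bsub>D\<^esub> g)" "\<epsilon> \<bullet>\<^bsub>D\<^esub> \<epsilon>' = IdC D (Ide D (Cod D (FArr F s)))"
        using D.inverse_invertible[OF eps] by metis
      have "P s g \<eta> \<eta>' \<epsilon> \<epsilon>'" unfolding P_def using g eta eta' eps eps' by (intro conjI)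
      then show ?thesis by (intro exI[of _ "(g, \<eta>, \<eta>', \<epsilon>, \<epsilon>')"]) simp
  qed
  define v where "v s = (SOME w. case w of (g, \<eta>, \<eta>', \<epsilon>, \<epsilon>') \<Rightarrow> P s g \<eta> \<eta>' \<epsilon> \<epsilon>')" for s
  have v: "case v s of (g, \<eta>, \<eta>', \<epsilon>, \<epsilon>') \<Rightarrow> P s g \<eta> \<eta>' \<epsilon> \<epsilon>'" if "s \<in> \<Sigma>" for s
    unfolding v_def by (rule someI_ex[OF ex[OF that]])
  define gen where "gen = (\<lambda>(s, n :: nat). case v s of (g, \<eta>, \<eta>', \<epsilon>, \<epsilon>') \<Rightarrow>
     [IdC D (FArr F s), IdC D g, \<eta>, \<eta>', \<epsilon>, \<epsilon>'] ! (n mod 6))"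
  define un where "un = (\<lambda>(n :: nat) c. [IdC D (Src D c), IdC D (Trg D c),
     IdC D (Ide D (Dom D (Src D c))), IdC D (Ide D (Cod D (Src D c)))] ! (n mod 4))"
  define bin where "bin = (\<lambda>(n :: nat) c d. if n = 0 then VComp D d c else HComp D d c)"
  from stack_coding[of gen un bin] obtain S0 where "\<exists>e :: 'd \<Rightarrow> 'a univ. inj_on e S0 \<and> range gen \<subseteq> S0 \<and>
     (\<forall>n. \<forall>c\<in>S0. un n c \<in> S0) \<and> (\<forall>n. \<forall>c\<in>S0. \<forall>d\<in>S0. bin n c d \<in> S0)" by (rule exE)
  then obtain e :: "'d \<Rightarrow> 'a univ" where "inj_on e S0 \<and> range gen \<subseteq> S0 \<and>
     (\<forall>n. \<forall>c\<in>S0. un n c \<in> S0) \<and> (\<forall>n. \<forall>c\<in>S0. \<forall>d\<in>S0. bin n c d \<in> S0)" by (rule exE)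
  then have S0: "inj_on e S0" "range gen \<subseteq> S0" "\<forall>n. \<forall>c\<in>S0. un n c \<in> S0"
     "\<forall>n. \<forall>c\<in>S0. \<forall>d\<in>S0. bin n c d \<in> S0" by simp_all
  define S where "S = S0 \<inter> Cell D"
  have u: "IdC D (Src D c) \<in> S0" "IdC D (Trg D c) \<in> S0" "IdC D (Ide D (Dom D (Src D c))) \<in> S0"
      "IdC D (Ide D (Cod D (Src D c))) \<in> S0" if "c \<in> S0" for c
    using S0(3)[rule_format, OF that, of 0] S0(3)[rule_format, OF that, of 1]
      S0(3)[rule_format, OF that, of 2] S0(3)[rule_format, OF that, of 3] unfolding un_def by auto
  have b: "d \<bullet>\<^bsub>D\<^esub> c \<in> S0" "d \<star>\<^bsub>D\<^esub> c \<in> S0" if "c \<in> S0" "d \<in> S0" for c d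
    using S0(4)[rule_format, OF that, of 0] S0(4)[rule_format, OF that, of 1] unfolding bin_def by auto
  have idcell: "f \<in> Arr D \<Longrightarrow> IdC D f \<in> Cell D" "X \<in> Obj D \<Longrightarrow> Ide D X \<in> Arr D" for f X
    using D.idc_hom D.ide_hom unfolding hom_def hom2_def by auto
  interpret sub_coding D S e
  proof
    show "S \<subseteq> Cell D" "inj_on e S" unfolding S_def using S0(1) by (auto intro: inj_on_subset)
    show "c \<in> S \<Longrightarrow> IdC D (Src D c) \<in> S" "c \<in> S \<Longrightarrow> IdC D (Trg D c) \<in> S"
      "c \<in> S \<Longrightarrow> IdC D (Ide D (Dom D (Src D c))) \<in> S"
      "c \<in> S \<Longrightarrow> IdC D (Ide D (Cod D (Src D c))) \<in> S" for c
      unfolding S_def using u idcell D.src_closed D.trg_parallel D.dom_closed D.cod_closed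
      by (auto simp: hom_def)
    show "d \<bullet>\<^bsub>D\<^esub> c \<in> S" if "c \<in> S" "d \<in> S" "Src D d = Trg D c" for c d
      using that b D.vcomp_hom[of c "Src D c" "Trg D c" d "Trg D d"] unfolding S_def hom2_def by auto
    show "d \<star>\<^bsub>D\<^esub> c \<in> S" if "c \<in> S" "d \<in> S" "Dom D (Src D d) = Cod D (Src D c)" for c d
      using that b D.hcomp_hom[of c "Src D c" "Trg D c" d "Src D d" "Trg D d"] unfolding S_def hom2_def by auto
  qed
  have gS: "gen (s, n) \<in> S0" for s n using S0(2) by auto
  have FA: "FArr F f \<in> A0" if "f \<in> Arr A" for f
  proof -
    have "IdC D (FArr F f) \<in> S0" using gS[of f 0] unfolding gen_def by (simp split: prod.splits)
    then show ?thesis unfolding A0_def unfolding S_def using FD(2)[OF that] idcell by simp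
  qed
  have eq: "\<exists>g \<in> A0. g \<in> hom D (Cod D (FArr F s)) (Dom D (FArr F s)) \<and>
        (\<exists>\<eta> \<in> S. \<exists>\<eta>' \<in> S. \<eta> \<in> hom2 D (Ide D (Dom D (FArr F s))) (g \<cdot>\<^bsub>D\<^esub> FArr F s) \<and>
           \<eta>' \<in> hom2 D (g \<cdot>\<^bsub>D\<^esub> FArr F s) (Ide D (Dom D (FArr F s))) \<and>
           \<eta>' \<bullet>\<^bsub>D\<^esub> \<eta> = IdC D (Ide D (Dom D (FArr F s))) \<and> \<eta> \<bullet>\<^bsub>D\<^esub> \<eta>' = IdC D (g \<cdot>\<^bsub>D\<^esub> FArr F s)) \<and>
        (\<exists>\<epsilon> \<in> S. \<exists>\<epsilon>' \<in> S. \<epsilon> \<in> hom2 D (FArr F s \<cdot>\<^bsub>D\<^esub> g) (Ide D (Cod D (FArr F s))) \<and>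
           \<epsilon>' \<in> hom2 D (Ide D (Cod D (FArr F s))) (FArr F s \<cdot>\<^bsub>D\<^esub> g) \<and>
           \<epsilon>' \<bullet>\<^bsub>D\<^esub> \<epsilon> = IdC D (FArr F s \<cdot>\<^bsub>D\<^esub> g) \<and> \<epsilon> \<bullet>\<^bsub>D\<^esub> \<epsilon>' = IdC D (Ide D (Cod D (FArr F s))))"
    if s: "s \<in> \<Sigma>" for s
  proof -
    obtain g \<eta> \<eta>' \<epsilon> \<epsilon>' where vs: "v s = (g, \<eta>, \<eta>', \<epsilon>, \<epsilon>')" by (cases "v s") auto
    have P: "P s g \<eta> \<eta>' \<epsilon> \<epsilon>'" using v[OF s] by (simp add: vs)
    note P = P[unfolded P_def]
    have "IdC D g \<in> S0" "\<eta> \<in> S0" "\<eta>' \<in> S0" "\<epsilon> \<in> S0" "\<epsilon>' \<in> S0"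
      using gS[of s 1] gS[of s 2] gS[of s 3] gS[of s 4] gS[of s 5] unfolding gen_def by (auto simp: vs)
    then have "g \<in> A0" "\<eta> \<in> S" "\<eta>' \<in> S" "\<epsilon> \<in> S" "\<epsilon>' \<in> S"
      using P idcell unfolding A0_def unfolding S_def hom_def hom2_def by auto
    then show ?thesis using P by auto
  qed
  define F0 where "F0 = \<lparr>FObj = (\<lambda>X\<in>Obj A. eo (FObj F X)), FArr = (\<lambda>f\<in>Arr A. ea (FArr F f)),
     FCell = (\<lambda>f\<in>Arr A. e (FCell F f))\<rparr>"
  note F0 = hat_coded[OF A F FA eq, folded F0_def]
  have "hat_hseq E F0 Hs = hat_hseq E F0 Ks"
    using HKeq E_two_category F0 unfolding hseq_equiv_def by simp
  then show ?thesis using F0 HK e_eq by metis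
qed

end

theory Submission
  imports Defs
begin

text \<open>A 2-functor \<open>F\<close> inverting \<open>\<Sigma>\<close> extends to the homotopy 2-category by \<open>[H] \<mapsto> hat_hseq D F H\<close>, and
  2-cells of the homotopy 2-category are by definition separated by these extensions; hence all its
  2-category axioms are inherited from the targets \<open>D\<close>. If the inclusion inverts \<open>\<Sigma>\<close>, the extension
  is unique, because the class of a cylinder becomes an identity after whiskering with \<open>cyl_s\<close>. A
  pseudonatural transformation between restrictions is automatically natural with respect to the
  class of a cylinder, since whiskering with an equivalence is faithful; modifications see no 2-cells
  at all. So restriction is bijective on objects, arrows and 2-cells.

  For fibrant-cofibrant objects a weak equivalence is a trivial cofibration with a retraction followed
  by a trivial fibration with a section. If \<open>s t = id\<close> with \<open>s\<close> a weak equivalence, then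
  \<open>s (t s) = s id\<close>, so \<open>(id, t s, s)\<close> is itself a cylinder and gives an invertible 2-cell
  \<open>id \<Rightarrow> t s\<close>: no genuine cylinder objects are needed. Retractions are dual.\<close>

section \<open>Calculus in a 2-category\<close>

text \<open>The obstacle is the quantification over all test 2-categories: \<open>hseq_equiv\<close>
  can range only over targets on the types \<open>'a univ\<close>. Equality of 2-cells of
  \<open>Ho\<close> is therefore proved by testing on those targets (\<open>hseq_equivI\<close>,
  \<open>Ho_cell_eqI\<close>), but used on targets of arbitrary types, to which
  \<open>hseq_equiv_hat_eq\<close> transfers it (\<open>hseq_equivD\<close>). A hat 2-cell exists
  and is unique because its defining equation whiskers with an equivalence. For the restriction of a
  2-functor on \<open>Ho\<close> this requires that the inclusion itself inverts \<Sigma>, since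
  2-functors preserve equivalences; the model structure enters only there. \<open>Ho\<close> adds no
  objects and no arrows, so transformations and modifications extend with unchanged components and
  restriction has a strict inverse. The pseudoequivalence in the strict sense then holds with
  identity transformations.\<close>

lemma invertibleI:
  assumes "c \<in> Cell D" "d \<in> Cell D" "Src D d = Trg D c" "Trg D d = Src D c"
    "d \<bullet>\<^bsub>D\<^esub> c = IdC D (Src D c)" "c \<bullet>\<^bsub>D\<^esub> d = IdC D (Trg D c)"
  shows "invertible D c"
  using assms unfolding invertible_def hom2_def by blast

lemma invertibleE:
  assumes "invertible D c"
  obtains d where "c \<in> Cell D" "d \<in> Cell D" "Src D d = Trg D c" "Trg D d = Src D c"
    "d \<bullet>\<^bsub>D\<^esub> c = IdC D (Src D c)" "c \<bullet>\<^bsub>D\<^esub> d = IdC D (Trg D c)"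
  using assms unfolding invertible_def hom2_def by blast

lemma equivalenceI:
  assumes "f \<in> Arr D" "g \<in> Arr D" "Dom D g = Cod D f" "Cod D g = Dom D f"
    "\<eta> \<in> Cell D" "Src D \<eta> = Ide D (Dom D f)" "Trg D \<eta> = g \<cdot>\<^bsub>D\<^esub> f" "invertible D \<eta>"
    "\<epsilon> \<in> Cell D" "Src D \<epsilon> = f \<cdot>\<^bsub>D\<^esub> g" "Trg D \<epsilon> = Ide D (Cod D f)" "invertible D \<epsilon>"
  shows "equivalence D f"
  using assms unfolding equivalence_def hom_def hom2_def by blast

lemma equivalenceE:
  assumes "equivalence D f"
  obtains g \<eta> \<epsilon> where "f \<in> Arr D" "g \<in> Arr D" "Dom D g = Cod D f" "Cod D g = Dom D f"
    "\<eta> \<in> Cell D" "Src D \<eta> = Ide D (Dom D f)" "Trg D \<eta> = g \<cdot>\<^bsub>D\<^esub> f" "invertible D \<eta>"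
    "\<epsilon> \<in> Cell D" "Src D \<epsilon> = f \<cdot>\<^bsub>D\<^esub> g" "Trg D \<epsilon> = Ide D (Cod D f)" "invertible D \<epsilon>"
  using assms unfolding equivalence_def hom_def hom2_def by blast

context category
begin

lemma ide_simps:
  "X \<in> Obj C \<Longrightarrow> Ide C X \<in> Arr C" "X \<in> Obj C \<Longrightarrow> Dom C (Ide C X) = X"
  "X \<in> Obj C \<Longrightarrow> Cod C (Ide C X) = X"
  using ide_hom[of X] unfolding hom_def by auto

lemma comp_simps:
  assumes "f \<in> Arr C" "g \<in> Arr C" "Dom C g = Cod C f"
  shows "g \<cdot> f \<in> Arr C" "Dom C (g \<cdot> f) = Dom C f" "Cod C (g \<cdot> f) = Cod C g"
  using comp_hom[of f "Dom C f" "Cod C f" g "Cod C g"] assms unfolding hom_def by auto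

lemma comp_assoc_arr:
  assumes "f \<in> Arr C" "g \<in> Arr C" "h \<in> Arr C" "Dom C g = Cod C f" "Dom C h = Cod C g"
  shows "(h \<cdot> g) \<cdot> f = h \<cdot> (g \<cdot> f)"
  using comp_assoc[of f "Dom C f" "Cod C f" g "Cod C g" h "Cod C h"] assms unfolding hom_def by auto

lemma comp_ide_eq:
  "\<lbrakk>f \<in> Arr C; X = Dom C f\<rbrakk> \<Longrightarrow> f \<cdot> Ide C X = f"
  "\<lbrakk>f \<in> Arr C; Y = Cod C f\<rbrakk> \<Longrightarrow> Ide C Y \<cdot> f = f"
  by (auto simp: comp_ide ide_comp)

text \<open>Boundaries are stated as equations on \<open>Dom\<close> and \<open>Cod\<close> instead
  of membership in hom-sets, so that the simplifier can discharge the side conditions of the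
  category laws; \<open>cell_simps\<close> does the same for 2-cells.\<close>

lemmas arr_simps = dom_closed cod_closed ide_simps comp_simps comp_assoc_arr comp_ide_eq

end

context two_category
begin

lemma idc_simps:
  "f \<in> Arr D \<Longrightarrow> IdC D f \<in> Cell D" "f \<in> Arr D \<Longrightarrow> Src D (IdC D f) = f"
  "f \<in> Arr D \<Longrightarrow> Trg D (IdC D f) = f"
  using idc_hom[of f] unfolding hom2_def by auto

lemma cell_boundary:
  assumes "c \<in> Cell D"
  shows "Src D c \<in> Arr D" "Trg D c \<in> Arr D" "Dom D (Trg D c) = Dom D (Src D c)"
    "Cod D (Trg D c) = Cod D (Src D c)"
  using src_closed trg_parallel assms unfolding hom_def by auto

lemma vcomp_simps:
  assumes "c \<in> Cell D" "d \<in> Cell D" "Src D d = Trg D c"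
  shows "d \<bullet> c \<in> Cell D" "Src D (d \<bullet> c) = Src D c" "Trg D (d \<bullet> c) = Trg D d"
  using vcomp_hom[of c "Src D c" "Trg D c" d "Trg D d"] assms unfolding hom2_def by auto

lemma hcomp_simps:
  assumes "c \<in> Cell D" "d \<in> Cell D" "Dom D (Src D d) = Cod D (Src D c)"
  shows "d \<star> c \<in> Cell D" "Src D (d \<star> c) = Src D d \<cdot> Src D c" "Trg D (d \<star> c) = Trg D d \<cdot> Trg D c"
  using hcomp_hom[of c "Src D c" "Trg D c" d "Src D d" "Trg D d"] assms unfolding hom2_def by auto

lemma vcomp_assoc_cell:
  assumes "a \<in> Cell D" "b \<in> Cell D" "c \<in> Cell D" "Src D b = Trg D a" "Src D c = Trg D b"
  shows "(c \<bullet> b) \<bullet> a = c \<bullet> (b \<bullet> a)"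
  using vcomp_assoc[of a "Src D a" "Trg D a" b "Trg D b" c "Trg D c"] assms unfolding hom2_def by auto

lemma hcomp_assoc_cell:
  assumes "a \<in> Cell D" "b \<in> Cell D" "c \<in> Cell D"
    "Dom D (Src D b) = Cod D (Src D a)" "Dom D (Src D c) = Cod D (Src D b)"
  shows "(c \<star> b) \<star> a = c \<star> (b \<star> a)"
  using hcomp_assoc[of a "Src D a" "Trg D a" b "Src D b" "Trg D b" c "Src D c" "Trg D c"] assms
  unfolding hom2_def by auto

lemma vcomp_idc_eq:
  "\<lbrakk>a \<in> Cell D; f = Src D a\<rbrakk> \<Longrightarrow> a \<bullet> IdC D f = a"
  "\<lbrakk>a \<in> Cell D; f = Trg D a\<rbrakk> \<Longrightarrow> IdC D f \<bullet> a = a"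
  by (auto simp: vcomp_idc idc_vcomp)

lemma hcomp_idc_eq:
  "\<lbrakk>a \<in> Cell D; X = Dom D (Src D a)\<rbrakk> \<Longrightarrow> a \<star> IdC D (Ide D X) = a"
  "\<lbrakk>a \<in> Cell D; X = Cod D (Src D a)\<rbrakk> \<Longrightarrow> IdC D (Ide D X) \<star> a = a"
  by (auto simp: hcomp_idc idc_hcomp)

lemma idc_hcomp_idc:
  "\<lbrakk>f \<in> Arr D; g \<in> Arr D; Dom D g = Cod D f\<rbrakk> \<Longrightarrow> IdC D g \<star> IdC D f = IdC D (g \<cdot> f)"
  using idc_comp[of f "Dom D f" "Cod D f" g "Cod D g"] unfolding hom_def by auto

lemmas cell_simps = arr_simps idc_simps cell_boundary vcomp_simps hcomp_simps vcomp_assoc_cell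
  hcomp_assoc_cell vcomp_idc_eq hcomp_idc_eq idc_hcomp_idc

text \<open>Directed towards a single horizontal composite, against
  \<open>whisker_left_vcomp\<close> and \<open>whisker_right_vcomp\<close>; hence it is supplied
  only where this direction is wanted.\<close>

lemma interchange_cell:
  assumes "a \<in> Cell D" "a' \<in> Cell D" "b \<in> Cell D" "b' \<in> Cell D" "Src D a' = Trg D a"
    "Src D b' = Trg D b" "Dom D (Src D b) = Cod D (Src D a)"
  shows "(b' \<star> a') \<bullet> (b \<star> a) = (b' \<bullet> b) \<star> (a' \<bullet> a)"
  using interchange[of a "Src D a" "Trg D a" a' "Trg D a'" b "Src D b" "Trg D b" b' "Trg D b'"] assms
  unfolding hom2_def by auto

lemma whisker_left_vcomp:
  assumes "a \<in> Cell D" "a' \<in> Cell D" "Src D a' = Trg D a" "h \<in> Arr D" "Dom D h = Cod D (Src D a)"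
  shows "IdC D h \<star> (a' \<bullet> a) = (IdC D h \<star> a') \<bullet> (IdC D h \<star> a)"
  using assms by (simp add: interchange_cell cell_simps)

lemma whisker_right_vcomp:
  assumes "a \<in> Cell D" "a' \<in> Cell D" "Src D a' = Trg D a" "h \<in> Arr D" "Dom D (Src D a) = Cod D h"
  shows "(a' \<bullet> a) \<star> IdC D h = (a' \<star> IdC D h) \<bullet> (a \<star> IdC D h)"
  using assms by (simp add: interchange_cell cell_simps)

text \<open>Equating the two forms lets 2-cells on different sides of a horizontal composite slide
  past each other, the basic move of the pasting arguments below.\<close>

lemma hcomp_exchange:
  assumes "a \<in> Cell D" "b \<in> Cell D" "Dom D (Src D b) = Cod D (Src D a)"
  shows "(b \<star> IdC D (Trg D a)) \<bullet> (IdC D (Src D b) \<star> a) = b \<star> a"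
    "(IdC D (Trg D b) \<star> a) \<bullet> (b \<star> IdC D (Src D a)) = b \<star> a"
  using assms by (simp_all add: interchange_cell cell_simps)

lemma invertible_idc: "f \<in> Arr D \<Longrightarrow> invertible D (IdC D f)"
  by (rule invertibleI[of _ _ "IdC D f"]) (simp_all add: cell_simps)

lemma invertible_vcomp:
  assumes "invertible D a" "invertible D b" "Src D b = Trg D a"
  shows "invertible D (b \<bullet> a)"
proof -
  obtain a' where a: "a \<in> Cell D" "a' \<in> Cell D" "Src D a' = Trg D a" "Trg D a' = Src D a"
    "a' \<bullet> a = IdC D (Src D a)" "a \<bullet> a' = IdC D (Trg D a)"
    using assms(1) by (rule invertibleE)
  obtain b' where b: "b \<in> Cell D" "b' \<in> Cell D" "Src D b' = Trg D b" "Trg D b' = Src D b"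
    "b' \<bullet> b = IdC D (Src D b)" "b \<bullet> b' = IdC D (Trg D b)"
    using assms(2) by (rule invertibleE)
  \<comment> \<open>Associativity alone brings the mutually inverse factors together. The
    cancellation is a separate step, because in the right-bracketed normal form they are not visible
    as a subterm.\<close>
  have 1: "(a' \<bullet> b') \<bullet> (b \<bullet> a) = a' \<bullet> ((b' \<bullet> b) \<bullet> a)" "(b \<bullet> a) \<bullet> (a' \<bullet> b') = b \<bullet> ((a \<bullet> a') \<bullet> b')"
    using a(1-4) b(1-4) assms(3) by (simp_all add: cell_simps)
  have 2: "a' \<bullet> ((b' \<bullet> b) \<bullet> a) = IdC D (Src D a)" "b \<bullet> ((a \<bullet> a') \<bullet> b') = IdC D (Trg D b)"
    unfolding a(6) b(5) using a b assms(3) by (simp_all add: cell_simps)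
  show ?thesis
    by (rule invertibleI[of _ _ "a' \<bullet> b'"]) (use a(1-4) b(1-4) trans[OF 1(1) 2(1)] trans[OF 1(2) 2(2)] assms(3) in \<open>simp_all add: cell_simps\<close>)
qed

lemma invertible_hcomp:
  assumes "invertible D a" "invertible D b" "Dom D (Src D b) = Cod D (Src D a)"
  shows "invertible D (b \<star> a)"
proof -
  obtain a' where a: "a \<in> Cell D" "a' \<in> Cell D" "Src D a' = Trg D a" "Trg D a' = Src D a"
    "a' \<bullet> a = IdC D (Src D a)" "a \<bullet> a' = IdC D (Trg D a)"
    using assms(1) by (rule invertibleE)
  obtain b' where b: "b \<in> Cell D" "b' \<in> Cell D" "Src D b' = Trg D b" "Trg D b' = Src D b"
    "b' \<bullet> b = IdC D (Src D b)" "b \<bullet> b' = IdC D (Trg D b)"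
    using assms(2) by (rule invertibleE)
  show ?thesis
    by (rule invertibleI[of _ _ "b' \<star> a'"])
      (use a b assms(3) in \<open>simp_all add: interchange_cell cell_simps\<close>)
qed

lemma equivalence_ide: "X \<in> Obj D \<Longrightarrow> equivalence D (Ide D X)"
  by (rule equivalenceI[of _ _ "Ide D X" "IdC D (Ide D X)" "IdC D (Ide D X)"])
    (simp_all add: cell_simps invertible_idc)

lemma equivalence_comp:
  assumes "equivalence D f" "equivalence D f'" "Dom D f' = Cod D f"
  shows "equivalence D (f' \<cdot> f)"
proof -
  obtain g \<eta> \<epsilon> where g: "f \<in> Arr D" "g \<in> Arr D" "Dom D g = Cod D f" "Cod D g = Dom D f"
    "\<eta> \<in> Cell D" "Src D \<eta> = Ide D (Dom D f)" "Trg D \<eta> = g \<cdot> f" "invertible D \<eta>"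
    "\<epsilon> \<in> Cell D" "Src D \<epsilon> = f \<cdot> g" "Trg D \<epsilon> = Ide D (Cod D f)" "invertible D \<epsilon>"
    using assms(1) by (rule equivalenceE)
  obtain g' \<eta>' \<epsilon>' where g': "f' \<in> Arr D" "g' \<in> Arr D" "Dom D g' = Cod D f'" "Cod D g' = Dom D f'"
    "\<eta>' \<in> Cell D" "Src D \<eta>' = Ide D (Dom D f')" "Trg D \<eta>' = g' \<cdot> f'" "invertible D \<eta>'"
    "\<epsilon>' \<in> Cell D" "Src D \<epsilon>' = f' \<cdot> g'" "Trg D \<epsilon>' = Ide D (Cod D f')" "invertible D \<epsilon>'"
    using assms(2) by (rule equivalenceE)
  show ?thesis
    \<comment> \<open>The new unit inserts \<eta>' between \<open>g\<close> and \<open>f\<close>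
      after \<eta>; the new counit first contracts the inner pair with \<epsilon>, then the outer
      one with \<epsilon>'.\<close>
    by (rule equivalenceI[of _ _ "g \<cdot> g'" "(IdC D g \<star> (\<eta>' \<star> IdC D f)) \<bullet> \<eta>"
        "\<epsilon>' \<bullet> (IdC D f' \<star> (\<epsilon> \<star> IdC D g'))"])
      (use g g' assms(3) in
        \<open>simp_all add: cell_simps invertible_idc invertible_hcomp invertible_vcomp\<close>)
qed

end

section \<open>2-functors: preservation of equivalences and a criterion for isomorphisms of
  2-categories\<close>

lemma two_functorD:
  assumes "two_functor B D F"
  shows "X \<in> Obj B \<Longrightarrow> FObj F X \<in> Obj D"
    "f \<in> Arr B \<Longrightarrow> FArr F f \<in> Arr D" "f \<in> Arr B \<Longrightarrow> Dom D (FArr F f) = FObj F (Dom B f)"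
    "f \<in> Arr B \<Longrightarrow> Cod D (FArr F f) = FObj F (Cod B f)"
    "X \<in> Obj B \<Longrightarrow> FArr F (Ide B X) = Ide D (FObj F X)"
    "\<lbrakk>f \<in> Arr B; g \<in> Arr B; Dom B g = Cod B f\<rbrakk> \<Longrightarrow> FArr F (g \<cdot>\<^bsub>B\<^esub> f) = FArr F g \<cdot>\<^bsub>D\<^esub> FArr F f"
    "c \<in> Cell B \<Longrightarrow> FCell F c \<in> Cell D" "c \<in> Cell B \<Longrightarrow> Src D (FCell F c) = FArr F (Src B c)"
    "c \<in> Cell B \<Longrightarrow> Trg D (FCell F c) = FArr F (Trg B c)"
    "f \<in> Arr B \<Longrightarrow> FCell F (IdC B f) = IdC D (FArr F f)"
    "\<lbrakk>c \<in> Cell B; d \<in> Cell B; Src B d = Trg B c\<rbrakk> \<Longrightarrow> FCell F (d \<bullet>\<^bsub>B\<^esub> c) = FCell F d \<bullet>\<^bsub>D\<^esub> FCell F c"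
    "\<lbrakk>c \<in> Cell B; d \<in> Cell B; Dom B (Src B d) = Cod B (Src B c)\<rbrakk> \<Longrightarrow>
       FCell F (d \<star>\<^bsub>B\<^esub> c) = FCell F d \<star>\<^bsub>D\<^esub> FCell F c"
  using assms unfolding two_functor_def is_functor_def hom_def hom2_def by auto

lemma two_functor_extensional:
  assumes "two_functor B D F"
  shows "FObj F \<in> extensional (Obj B)" "FArr F \<in> extensional (Arr B)" "FCell F \<in> extensional (Cell B)"
  using assms unfolding two_functor_def by auto

lemma two_functor_invertible:
  assumes "two_category B" "two_functor B D F" "invertible B c"
  shows "invertible D (FCell F c)"
proof -
  interpret B: two_category B by fact
  note FD = two_functorD[OF assms(2)]
  obtain d where d: "c \<in> Cell B" "d \<in> Cell B" "Src B d = Trg B c" "Trg B d = Src B c"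
    "d \<bullet>\<^bsub>B\<^esub> c = IdC B (Src B c)" "c \<bullet>\<^bsub>B\<^esub> d = IdC B (Trg B c)"
    using assms(3) by (rule invertibleE)
  have "FCell F d \<bullet>\<^bsub>D\<^esub> FCell F c = IdC D (FArr F (Src B c))"
    "FCell F c \<bullet>\<^bsub>D\<^esub> FCell F d = IdC D (FArr F (Trg B c))"
    using d FD(10,11) B.cell_boundary by metis+
  then show ?thesis
    by (intro invertibleI[of _ _ "FCell F d"]) (use d in \<open>simp_all add: FD\<close>)
qed

text \<open>Applied to 2-functors out of \<open>Ho\<close>, this makes their restrictions invert
  \<Sigma>.\<close>

lemma two_functor_equivalence:
  assumes "two_category B" "two_functor B D F" "equivalence B f"
  shows "equivalence D (FArr F f)"
proof -
  interpret B: two_category B by fact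
  obtain g \<eta> \<epsilon> where g: "f \<in> Arr B" "g \<in> Arr B" "Dom B g = Cod B f" "Cod B g = Dom B f"
    "\<eta> \<in> Cell B" "Src B \<eta> = Ide B (Dom B f)" "Trg B \<eta> = g \<cdot>\<^bsub>B\<^esub> f" "invertible B \<eta>"
    "\<epsilon> \<in> Cell B" "Src B \<epsilon> = f \<cdot>\<^bsub>B\<^esub> g" "Trg B \<epsilon> = Ide B (Cod B f)" "invertible B \<epsilon>"
    using assms(3) by (rule equivalenceE)
  have "invertible D (FCell F \<eta>)" "invertible D (FCell F \<epsilon>)"
    using g two_functor_invertible[OF assms(1,2)] by simp_all
  then show ?thesis
    by (intro equivalenceI[of _ _ "FArr F g" "FCell F \<eta>" "FCell F \<epsilon>"])
      (use g in \<open>simp_all add: two_functorD[OF assms(2)] B.cell_simps\<close>)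
qed

lemma fun2_eqI:
  fixes F G :: "('o, 'a, 'c, 'p, 'b, 'd) fun2"
  assumes "FObj F \<in> extensional P" "FObj G \<in> extensional P" "\<And>X. X \<in> P \<Longrightarrow> FObj F X = FObj G X"
    "FArr F \<in> extensional Q" "FArr G \<in> extensional Q" "\<And>X. X \<in> Q \<Longrightarrow> FArr F X = FArr G X"
    "FCell F \<in> extensional R" "FCell G \<in> extensional R" "\<And>X. X \<in> R \<Longrightarrow> FCell F X = FCell G X"
  shows "F = G"
proof (rule fun2.equality)
  show "FObj F = FObj G" by (rule extensionalityI[OF assms(1,2)]) (rule assms)
  show "FArr F = FArr G" by (rule extensionalityI[OF assms(4,5)]) (rule assms)
  show "FCell F = FCell G" by (rule extensionalityI[OF assms(7,8)]) (rule assms)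
qed simp

text \<open>The inverse maps respect boundaries, identities and compositions automatically: each law
  may be tested after applying \<open>F\<close>, which satisfies it and is injective on the
  carriers.\<close>

lemma isomorphism_2catI:
  fixes F :: "('o, 'a, 'c, 'p, 'b, 'd) fun2"
  assumes "two_category B" "two_category D" and F: "two_functor B D F"
    and bO: "bij_betw (FObj F) (Obj B) (Obj D)" and bA: "bij_betw (FArr F) (Arr B) (Arr D)"
    and bC: "bij_betw (FCell F) (Cell B) (Cell D)"
  shows "isomorphism_2cat B D F"
proof -
  interpret B: two_category B by fact
  interpret D: two_category D by fact
  note FD = two_functorD[OF F]
  define gO gA gC where "gO = inv_into (Obj B) (FObj F)" and "gA = inv_into (Arr B) (FArr F)"
    and "gC = inv_into (Cell B) (FCell F)"
  have O: "X \<in> Obj D \<Longrightarrow> gO X \<in> Obj B" "X \<in> Obj D \<Longrightarrow> FObj F (gO X) = X"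
      "Y \<in> Obj B \<Longrightarrow> gO (FObj F Y) = Y" for X Y
    unfolding gO_def using bO by (auto simp: bij_betw_def inv_into_into f_inv_into_f)
  have A: "X \<in> Arr D \<Longrightarrow> gA X \<in> Arr B" "X \<in> Arr D \<Longrightarrow> FArr F (gA X) = X"
      "Y \<in> Arr B \<Longrightarrow> gA (FArr F Y) = Y" for X Y
    unfolding gA_def using bA by (auto simp: bij_betw_def inv_into_into f_inv_into_f)
  have C: "X \<in> Cell D \<Longrightarrow> gC X \<in> Cell B" "X \<in> Cell D \<Longrightarrow> FCell F (gC X) = X"
      "Y \<in> Cell B \<Longrightarrow> gC (FCell F Y) = Y" for X Y
    unfolding gC_def using bC by (auto simp: bij_betw_def inv_into_into f_inv_into_f)
  \<comment> \<open>The inverse maps are restricted to the carriers because 2-functors are required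
    to be extensional.\<close>
  define G where "G = \<lparr>FObj = (\<lambda>X\<in>Obj D. gO X), FArr = (\<lambda>f\<in>Arr D. gA f), FCell = (\<lambda>c\<in>Cell D. gC c)\<rparr>"
  have DA: "Dom B (gA f) = gO (Dom D f)" "Cod B (gA f) = gO (Cod D f)" if "f \<in> Arr D" for f
    using that FD(3,4)[of "gA f"] A O B.arr_simps by metis+
  have DC: "Src B (gC f) = gA (Src D f)" "Trg B (gC f) = gA (Trg D f)" if "f \<in> Cell D" for f
    using that FD(8,9)[of "gC f"] A C B.cell_simps by metis+
  have IA: "gA (Ide D X) = Ide B (gO X)" if "X \<in> Obj D" for X
    using that FD(5)[of "gO X"] A O B.arr_simps by metis
  have IC: "gC (IdC D f) = IdC B (gA f)" if "f \<in> Arr D" for f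
    using that FD(10)[of "gA f"] A C B.cell_simps by metis
  have cA: "gA (g \<cdot>\<^bsub>D\<^esub> f) = gA g \<cdot>\<^bsub>B\<^esub> gA f" if "f \<in> Arr D" "g \<in> Arr D" "Dom D g = Cod D f" for f g
    using that FD(6)[of "gA f" "gA g"] A DA B.comp_simps(1)[of "gA f" "gA g"] by metis
  have cV: "gC (g \<bullet>\<^bsub>D\<^esub> f) = gC g \<bullet>\<^bsub>B\<^esub> gC f" if "f \<in> Cell D" "g \<in> Cell D" "Src D g = Trg D f" for f g
    using that FD(11)[of "gC f" "gC g"] C DC B.vcomp_simps(1)[of "gC f" "gC g"] by metis
  have cH: "gC (g \<star>\<^bsub>D\<^esub> f) = gC g \<star>\<^bsub>B\<^esub> gC f" if "f \<in> Cell D" "g \<in> Cell D" "Dom D (Src D g) = Cod D (Src D f)" for f g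
    using that FD(12)[of "gC f" "gC g"] C DC DA D.cell_simps B.hcomp_simps(1)[of "gC f" "gC g"] by metis
  have G: "two_functor D B G"
    unfolding two_functor_def is_functor_def hom_def hom2_def G_def
    by (simp add: O A C DA DC IA IC cA cV cH D.cell_simps)
  have "comp_fun2 B G F = id_fun2 B"
    by (rule fun2_eqI[where P = "Obj B" and Q = "Arr B" and R = "Cell B"])
      (simp_all add: comp_fun2_def id_fun2_def G_def compose_def FD O A C)
  moreover have "comp_fun2 D F G = id_fun2 D"
    by (rule fun2_eqI[where P = "Obj D" and Q = "Arr D" and R = "Cell D"])
      (simp_all add: comp_fun2_def id_fun2_def G_def compose_def FD O A C)
  ultimately show ?thesis unfolding isomorphism_2cat_def using F G by blast
qed

section \<open>The 2-category of 2-functors\<close>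

context two_category
begin

lemma whisker_merge:
  assumes "a \<in> Cell D" "g \<in> Arr D" "f \<in> Arr D" "Dom D f = Cod D (Src D a)" "Dom D g = Cod D f"
  shows "IdC D g \<star> (IdC D f \<star> a) = IdC D (g \<cdot> f) \<star> a"
  using assms hcomp_assoc_cell[of a "IdC D f" "IdC D g"] by (simp add: cell_simps)

text \<open>Applies an equation between two-fold composites inside a right-bracketed chain, where
  its left-hand side is not a subterm.\<close>

lemma vcomp_tail:
  assumes "c \<bullet> b = c' \<bullet> b'" "a \<in> Cell D" "b \<in> Cell D" "c \<in> Cell D" "b' \<in> Cell D" "c' \<in> Cell D"
    "Src D b = Trg D a" "Src D c = Trg D b" "Src D b' = Trg D a" "Src D c' = Trg D b'"
  shows "c \<bullet> (b \<bullet> a) = c' \<bullet> (b' \<bullet> a)"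
  using assms vcomp_assoc_cell by metis

text \<open>The resulting normal form brackets both compositions to the right, distributes
  whiskering over vertical composition and merges iterated whiskerings.\<close>

lemmas whisker_simps = cell_simps whisker_merge whisker_left_vcomp whisker_right_vcomp

end

lemma pseudonaturalD:
  assumes "pseudonatural B D \<theta>"
  shows "two_functor B D (TDom \<theta>)" "two_functor B D (TCod \<theta>)"
    "TObj \<theta> \<in> extensional (Obj B)" "TArr \<theta> \<in> extensional (Arr B)"
    "X \<in> Obj B \<Longrightarrow> TObj \<theta> X \<in> Arr D" "X \<in> Obj B \<Longrightarrow> Dom D (TObj \<theta> X) = FObj (TDom \<theta>) X"
    "X \<in> Obj B \<Longrightarrow> Cod D (TObj \<theta> X) = FObj (TCod \<theta>) X"
    "f \<in> Arr B \<Longrightarrow> invertible D (TArr \<theta> f)" "f \<in> Arr B \<Longrightarrow> TArr \<theta> f \<in> Cell D"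
    "f \<in> Arr B \<Longrightarrow> Src D (TArr \<theta> f) = FArr (TCod \<theta>) f \<cdot>\<^bsub>D\<^esub> TObj \<theta> (Dom B f)"
    "f \<in> Arr B \<Longrightarrow> Trg D (TArr \<theta> f) = TObj \<theta> (Cod B f) \<cdot>\<^bsub>D\<^esub> FArr (TDom \<theta>) f"
    "X \<in> Obj B \<Longrightarrow> TArr \<theta> (Ide B X) = IdC D (TObj \<theta> X)"
    "\<lbrakk>f \<in> Arr B; g \<in> Arr B; Dom B g = Cod B f\<rbrakk> \<Longrightarrow> TArr \<theta> (g \<cdot>\<^bsub>B\<^esub> f) =
      (TArr \<theta> g \<star>\<^bsub>D\<^esub> IdC D (FArr (TDom \<theta>) f)) \<bullet>\<^bsub>D\<^esub> (IdC D (FArr (TCod \<theta>) g) \<star>\<^bsub>D\<^esub> TArr \<theta> f)"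
    "\<alpha> \<in> Cell B \<Longrightarrow>
      TArr \<theta> (Trg B \<alpha>) \<bullet>\<^bsub>D\<^esub> (FCell (TCod \<theta>) \<alpha> \<star>\<^bsub>D\<^esub> IdC D (TObj \<theta> (Dom B (Src B \<alpha>)))) =
      (IdC D (TObj \<theta> (Cod B (Src B \<alpha>))) \<star>\<^bsub>D\<^esub> FCell (TDom \<theta>) \<alpha>) \<bullet>\<^bsub>D\<^esub> TArr \<theta> (Src B \<alpha>)"
  using assms unfolding pseudonatural_def Let_def hom_def hom2_def by auto

lemma pseudonaturalI:
  assumes "two_functor B D (TDom \<theta>)" "two_functor B D (TCod \<theta>)"
    "TObj \<theta> \<in> extensional (Obj B)" "TArr \<theta> \<in> extensional (Arr B)"
    "\<And>X. X \<in> Obj B \<Longrightarrow> TObj \<theta> X \<in> Arr D"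
    "\<And>X. X \<in> Obj B \<Longrightarrow> Dom D (TObj \<theta> X) = FObj (TDom \<theta>) X"
    "\<And>X. X \<in> Obj B \<Longrightarrow> Cod D (TObj \<theta> X) = FObj (TCod \<theta>) X"
    "\<And>f. f \<in> Arr B \<Longrightarrow> invertible D (TArr \<theta> f)"
    "\<And>f. f \<in> Arr B \<Longrightarrow> Src D (TArr \<theta> f) = FArr (TCod \<theta>) f \<cdot>\<^bsub>D\<^esub> TObj \<theta> (Dom B f)"
    "\<And>f. f \<in> Arr B \<Longrightarrow> Trg D (TArr \<theta> f) = TObj \<theta> (Cod B f) \<cdot>\<^bsub>D\<^esub> FArr (TDom \<theta>) f"
    "\<And>X. X \<in> Obj B \<Longrightarrow> TArr \<theta> (Ide B X) = IdC D (TObj \<theta> X)"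
    "\<And>f g. \<lbrakk>f \<in> Arr B; g \<in> Arr B; Dom B g = Cod B f\<rbrakk> \<Longrightarrow> TArr \<theta> (g \<cdot>\<^bsub>B\<^esub> f) =
      (TArr \<theta> g \<star>\<^bsub>D\<^esub> IdC D (FArr (TDom \<theta>) f)) \<bullet>\<^bsub>D\<^esub> (IdC D (FArr (TCod \<theta>) g) \<star>\<^bsub>D\<^esub> TArr \<theta> f)"
    "\<And>\<alpha>. \<alpha> \<in> Cell B \<Longrightarrow>
      TArr \<theta> (Trg B \<alpha>) \<bullet>\<^bsub>D\<^esub> (FCell (TCod \<theta>) \<alpha> \<star>\<^bsub>D\<^esub> IdC D (TObj \<theta> (Dom B (Src B \<alpha>)))) =
      (IdC D (TObj \<theta> (Cod B (Src B \<alpha>))) \<star>\<^bsub>D\<^esub> FCell (TDom \<theta>) \<alpha>) \<bullet>\<^bsub>D\<^esub> TArr \<theta> (Src B \<alpha>)"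
  shows "pseudonatural B D \<theta>"
  using assms unfolding pseudonatural_def Let_def hom_def hom2_def invertible_def by auto

lemma modificationD:
  assumes "modification B D \<rho>"
  shows "pseudonatural B D (MSrc \<rho>)" "pseudonatural B D (MTrg \<rho>)"
    "TDom (MTrg \<rho>) = TDom (MSrc \<rho>)" "TCod (MTrg \<rho>) = TCod (MSrc \<rho>)"
    "MObj \<rho> \<in> extensional (Obj B)" "X \<in> Obj B \<Longrightarrow> MObj \<rho> X \<in> Cell D"
    "X \<in> Obj B \<Longrightarrow> Src D (MObj \<rho> X) = TObj (MSrc \<rho>) X"
    "X \<in> Obj B \<Longrightarrow> Trg D (MObj \<rho> X) = TObj (MTrg \<rho>) X"
    "f \<in> Arr B \<Longrightarrow>
      (MObj \<rho> (Cod B f) \<star>\<^bsub>D\<^esub> IdC D (FArr (TDom (MSrc \<rho>)) f)) \<bullet>\<^bsub>D\<^esub> TArr (MSrc \<rho>) f =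
      TArr (MTrg \<rho>) f \<bullet>\<^bsub>D\<^esub> (IdC D (FArr (TCod (MSrc \<rho>)) f) \<star>\<^bsub>D\<^esub> MObj \<rho> (Dom B f))"
  using assms unfolding modification_def Let_def hom2_def by auto

lemma modificationI:
  assumes "pseudonatural B D (MSrc \<rho>)" "pseudonatural B D (MTrg \<rho>)"
    "TDom (MTrg \<rho>) = TDom (MSrc \<rho>)" "TCod (MTrg \<rho>) = TCod (MSrc \<rho>)"
    "MObj \<rho> \<in> extensional (Obj B)" "\<And>X. X \<in> Obj B \<Longrightarrow> MObj \<rho> X \<in> Cell D"
    "\<And>X. X \<in> Obj B \<Longrightarrow> Src D (MObj \<rho> X) = TObj (MSrc \<rho>) X"
    "\<And>X. X \<in> Obj B \<Longrightarrow> Trg D (MObj \<rho> X) = TObj (MTrg \<rho>) X"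
    "\<And>f. f \<in> Arr B \<Longrightarrow>
      (MObj \<rho> (Cod B f) \<star>\<^bsub>D\<^esub> IdC D (FArr (TDom (MSrc \<rho>)) f)) \<bullet>\<^bsub>D\<^esub> TArr (MSrc \<rho>) f =
      TArr (MTrg \<rho>) f \<bullet>\<^bsub>D\<^esub> (IdC D (FArr (TCod (MSrc \<rho>)) f) \<star>\<^bsub>D\<^esub> MObj \<rho> (Dom B f))"
  shows "modification B D \<rho>"
  using assms unfolding modification_def Let_def hom2_def by auto

lemma trans_eqI:
  fixes \<theta> \<eta> :: "('o, 'a, 'c, 'p, 'b, 'd) trans"
  assumes "TDom \<theta> = TDom \<eta>" "TCod \<theta> = TCod \<eta>"
    "TObj \<theta> \<in> extensional P" "TObj \<eta> \<in> extensional P" "\<And>X. X \<in> P \<Longrightarrow> TObj \<theta> X = TObj \<eta> X"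
    "TArr \<theta> \<in> extensional Q" "TArr \<eta> \<in> extensional Q" "\<And>X. X \<in> Q \<Longrightarrow> TArr \<theta> X = TArr \<eta> X"
  shows "\<theta> = \<eta>"
proof (rule trans.equality)
  show "TObj \<theta> = TObj \<eta>" by (rule extensionalityI[OF assms(3,4)]) (rule assms)
  show "TArr \<theta> = TArr \<eta>" by (rule extensionalityI[OF assms(6,7)]) (rule assms)
qed (use assms in simp_all)

lemma modif_eqI:
  fixes \<rho> \<sigma> :: "('o, 'a, 'c, 'p, 'b, 'd) modif"
  assumes "MSrc \<rho> = MSrc \<sigma>" "MTrg \<rho> = MTrg \<sigma>"
    "MObj \<rho> \<in> extensional P" "MObj \<sigma> \<in> extensional P" "\<And>X. X \<in> P \<Longrightarrow> MObj \<rho> X = MObj \<sigma> X"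
  shows "\<rho> = \<sigma>"
proof (rule modif.equality)
  show "MObj \<rho> = MObj \<sigma>" by (rule extensionalityI[OF assms(3,4)]) (rule assms)
qed (use assms in simp_all)

lemma Hom_p_sets:
  "Obj (Hom_p B D) = {F. two_functor B D F}" "Arr (Hom_p B D) = {\<theta>. pseudonatural B D \<theta>}"
  "Cell (Hom_p B D) = {\<rho>. modification B D \<rho>}"
  by (simp_all add: Hom_p_def)

lemma Hom_p_ops:
  "Dom (Hom_p B D) = TDom" "Cod (Hom_p B D) = TCod" "Src (Hom_p B D) = MSrc" "Trg (Hom_p B D) = MTrg"
  "Comp (Hom_p B D) = comp_trans B D"
  by (simp_all add: Hom_p_def)

lemma Hom_p_Ide_simps:
  "TDom (Ide (Hom_p B D) F) = F" "TCod (Ide (Hom_p B D) F) = F"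
  "X \<in> Obj B \<Longrightarrow> TObj (Ide (Hom_p B D) F) X = Ide D (FObj F X)"
  "f \<in> Arr B \<Longrightarrow> TArr (Ide (Hom_p B D) F) f = IdC D (FArr F f)"
  "TObj (Ide (Hom_p B D) F) \<in> extensional (Obj B)" "TArr (Ide (Hom_p B D) F) \<in> extensional (Arr B)"
  by (simp_all add: Hom_p_def)

lemma comp_trans_simps:
  "TDom (comp_trans B D \<eta> \<theta>) = TDom \<theta>" "TCod (comp_trans B D \<eta> \<theta>) = TCod \<eta>"
  "X \<in> Obj B \<Longrightarrow> TObj (comp_trans B D \<eta> \<theta>) X = TObj \<eta> X \<cdot>\<^bsub>D\<^esub> TObj \<theta> X"
  "f \<in> Arr B \<Longrightarrow> TArr (comp_trans B D \<eta> \<theta>) f =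
    (IdC D (TObj \<eta> (Cod B f)) \<star>\<^bsub>D\<^esub> TArr \<theta> f) \<bullet>\<^bsub>D\<^esub> (TArr \<eta> f \<star>\<^bsub>D\<^esub> IdC D (TObj \<theta> (Dom B f)))"
  "TObj (comp_trans B D \<eta> \<theta>) \<in> extensional (Obj B)"
  "TArr (comp_trans B D \<eta> \<theta>) \<in> extensional (Arr B)"
  by (simp_all add: comp_trans_def)

lemma Hom_p_cell_simps:
  "MSrc (IdC (Hom_p B D) \<theta>) = \<theta>" "MTrg (IdC (Hom_p B D) \<theta>) = \<theta>"
  "X \<in> Obj B \<Longrightarrow> MObj (IdC (Hom_p B D) \<theta>) X = IdC D (TObj \<theta> X)"
  "MObj (IdC (Hom_p B D) \<theta>) \<in> extensional (Obj B)"
  "MSrc (VComp (Hom_p B D) \<sigma> \<rho>) = MSrc \<rho>" "MTrg (VComp (Hom_p B D) \<sigma> \<rho>) = MTrg \<sigma>"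
  "X \<in> Obj B \<Longrightarrow> MObj (VComp (Hom_p B D) \<sigma> \<rho>) X = MObj \<sigma> X \<bullet>\<^bsub>D\<^esub> MObj \<rho> X"
  "MObj (VComp (Hom_p B D) \<sigma> \<rho>) \<in> extensional (Obj B)"
  "MSrc (HComp (Hom_p B D) \<sigma> \<rho>) = comp_trans B D (MSrc \<sigma>) (MSrc \<rho>)"
  "MTrg (HComp (Hom_p B D) \<sigma> \<rho>) = comp_trans B D (MTrg \<sigma>) (MTrg \<rho>)"
  "X \<in> Obj B \<Longrightarrow> MObj (HComp (Hom_p B D) \<sigma> \<rho>) X = MObj \<sigma> X \<star>\<^bsub>D\<^esub> MObj \<rho> X"
  "MObj (HComp (Hom_p B D) \<sigma> \<rho>) \<in> extensional (Obj B)"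
  by (simp_all add: Hom_p_def)

locale two_category_pair = B: two_category B + two_category D
  for B :: "('o, 'a, 'c, 'm) twocat_scheme" and D :: "('p, 'b, 'd, 'n) twocat_scheme" (structure)
begin

abbreviation "H \<equiv> Hom_p B D"

lemma Ide_pseudonatural:
  assumes "two_functor B D F"
  shows "pseudonatural B D (Ide H F)"
  by (rule pseudonaturalI)
    (simp_all add: Hom_p_Ide_simps two_functorD[OF assms] assms B.cell_simps cell_simps invertible_idc)

lemma comp_pseudonatural:
  assumes \<theta>: "pseudonatural B D \<theta>" and \<eta>: "pseudonatural B D \<eta>" and m: "TDom \<eta> = TCod \<theta>"
  shows "pseudonatural B D (comp_trans B D \<eta> \<theta>)"
proof -
  note t = pseudonaturalD(1-12)[OF \<theta>] and e = pseudonaturalD(3-12)[OF \<eta>] pseudonaturalD(2)[OF \<eta>]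
  note F = two_functorD[OF t(1)] and G = two_functorD[OF t(2)] and K = two_functorD[OF e(11)]
  note s = comp_trans_simps m t e F G K B.cell_simps whisker_simps invertible_idc
  show ?thesis
  proof (rule pseudonaturalI)
    fix f g assume fg: "f \<in> Arr B" "g \<in> Arr B" "Dom B g = Cod B f"
    \<comment> \<open>Writing out both composites, the outer layers agree; in the middle \<theta> at
      \<open>f\<close> and \<eta> at \<open>g\<close> occur in opposite orders and are
      exchanged.\<close>
    have 1: "(IdC D (TObj \<eta> (Cod B g) \<cdot> FArr (TCod \<theta>) g) \<star> TArr \<theta> f) \<bullet>
          (TArr \<eta> g \<star> IdC D (FArr (TCod \<theta>) f \<cdot> TObj \<theta> (Dom B f))) =
        (TArr \<eta> g \<star> IdC D (TObj \<theta> (Cod B f) \<cdot> FArr (TDom \<theta>) f)) \<bullet>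
          (IdC D (FArr (TCod \<eta>) g \<cdot> TObj \<eta> (Cod B f)) \<star> TArr \<theta> f)"
      using fg hcomp_exchange[of "TArr \<theta> f" "TArr \<eta> g"] by (simp add: s)
    show "TArr (comp_trans B D \<eta> \<theta>) (g \<cdot>\<^bsub>B\<^esub> f) =
        (TArr (comp_trans B D \<eta> \<theta>) g \<star> IdC D (FArr (TDom (comp_trans B D \<eta> \<theta>)) f)) \<bullet>
        (IdC D (FArr (TCod (comp_trans B D \<eta> \<theta>)) g) \<star> TArr (comp_trans B D \<eta> \<theta>) f)"
      using fg vcomp_tail[OF 1, of "IdC D (FArr (TCod \<eta>) g) \<star> (TArr \<eta> f \<star> IdC D (TObj \<theta> (Dom B f)))"]
      by (simp add: s pseudonaturalD(13)[OF \<theta>] pseudonaturalD(13)[OF \<eta>])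
  next
    fix \<alpha> assume a: "\<alpha> \<in> Cell B"
    define X Y f f' where X: "X = Dom B (Src B \<alpha>)" and Y: "Y = Cod B (Src B \<alpha>)"
      and f: "f = Src B \<alpha>" and f': "f' = Trg B \<alpha>"
    have b: "X \<in> Obj B" "Y \<in> Obj B" "f \<in> Arr B" "f' \<in> Arr B" "Dom B f = X" "Cod B f = Y"
        "Dom B f' = X" "Cod B f' = Y" "Src B \<alpha> = f" "Trg B \<alpha> = f'"
      using a by (simp_all add: X Y f f' B.cell_simps)
    \<comment> \<open>Naturality of \<eta> whiskered by \<theta> at \<open>X\<close>, and below
      naturality of \<theta> whiskered by \<eta> at \<open>Y\<close>. The two squares are pasted
      along the image of \<alpha> under the 2-functor in the middle.\<close>
    have 1: "(TArr \<eta> f' \<star> IdC D (TObj \<theta> X)) \<bullet> (FCell (TCod \<eta>) \<alpha> \<star> IdC D (TObj \<eta> X \<cdot> TObj \<theta> X)) =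
        (IdC D (TObj \<eta> Y) \<star> (FCell (TCod \<theta>) \<alpha> \<star> IdC D (TObj \<theta> X))) \<bullet> (TArr \<eta> f \<star> IdC D (TObj \<theta> X))"
      using arg_cong[OF pseudonaturalD(14)[OF \<eta> a], of "\<lambda>c. c \<star> IdC D (TObj \<theta> X)"] a b by (simp add: s)
    have 2: "(IdC D (TObj \<eta> Y) \<star> TArr \<theta> f') \<bullet> (IdC D (TObj \<eta> Y) \<star> (FCell (TCod \<theta>) \<alpha> \<star> IdC D (TObj \<theta> X))) =
        (IdC D (TObj \<eta> Y \<cdot> TObj \<theta> Y) \<star> FCell (TDom \<theta>) \<alpha>) \<bullet> (IdC D (TObj \<eta> Y) \<star> TArr \<theta> f)"
      using arg_cong[OF pseudonaturalD(14)[OF \<theta> a], of "\<lambda>c. IdC D (TObj \<eta> Y) \<star> c"] a b by (simp add: s)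
    show "TArr (comp_trans B D \<eta> \<theta>) (Trg B \<alpha>) \<bullet> (FCell (TCod (comp_trans B D \<eta> \<theta>)) \<alpha> \<star>
            IdC D (TObj (comp_trans B D \<eta> \<theta>) (Dom B (Src B \<alpha>)))) =
        (IdC D (TObj (comp_trans B D \<eta> \<theta>) (Cod B (Src B \<alpha>))) \<star> FCell (TDom (comp_trans B D \<eta> \<theta>)) \<alpha>) \<bullet>
            TArr (comp_trans B D \<eta> \<theta>) (Src B \<alpha>)"
      using a b 1 vcomp_tail[OF 2, of "TArr \<eta> f \<star> IdC D (TObj \<theta> X)"] by (simp add: s)
  qed (simp_all add: s invertible_vcomp invertible_hcomp)
qed

lemma IdC_modification:
  assumes "pseudonatural B D \<theta>"
  shows "modification B D (IdC H \<theta>)"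
proof -
  note t = pseudonaturalD[OF assms]
  show ?thesis
    by (rule modificationI)
      (simp_all add: t Hom_p_cell_simps assms two_functorD[OF t(1)] two_functorD[OF t(2)] B.cell_simps cell_simps)
qed

lemma VComp_modification:
  assumes \<rho>: "modification B D \<rho>" and \<sigma>: "modification B D \<sigma>" and m: "MSrc \<sigma> = MTrg \<rho>"
  shows "modification B D (VComp H \<sigma> \<rho>)"
proof -
  note r = modificationD(1-8)[OF \<rho>] and q = modificationD(2-8)[OF \<sigma>]
  note t = pseudonaturalD(1-12)[OF r(1)] pseudonaturalD(3-12)[OF r(2)] pseudonaturalD(3-12)[OF q(1)]
  note s = t r q m Hom_p_cell_simps two_functorD[OF t(1)] two_functorD[OF t(2)] B.cell_simps whisker_simps
  show ?thesis
  proof (rule modificationI)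
    fix f assume f: "f \<in> Arr B"
    note n = modificationD(9)[OF \<sigma> f] modificationD(9)[OF \<rho> f]
    show "(MObj (VComp H \<sigma> \<rho>) (Cod B f) \<star> IdC D (FArr (TDom (MSrc (VComp H \<sigma> \<rho>))) f)) \<bullet>
          TArr (MSrc (VComp H \<sigma> \<rho>)) f =
        TArr (MTrg (VComp H \<sigma> \<rho>)) f \<bullet>
          (IdC D (FArr (TCod (MSrc (VComp H \<sigma> \<rho>))) f) \<star> MObj (VComp H \<sigma> \<rho>) (Dom B f))"
      using f n vcomp_tail[OF n(1), of "IdC D (FArr (TCod (MSrc \<rho>)) f) \<star> MObj \<rho> (Dom B f)"]
      by (simp add: s)
  qed (simp_all add: s)
qed

lemma HComp_modification:
  assumes \<rho>: "modification B D \<rho>" and \<sigma>: "modification B D \<sigma>"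
    and m: "TDom (MSrc \<sigma>) = TCod (MSrc \<rho>)"
  shows "modification B D (HComp H \<sigma> \<rho>)"
proof -
  note r = modificationD(1-8)[OF \<rho>] and q = modificationD(1-8)[OF \<sigma>]
  note t = pseudonaturalD(1-12)[OF r(1)] pseudonaturalD(3-12)[OF r(2)] pseudonaturalD(2-12)[OF q(1)]
    pseudonaturalD(3-12)[OF q(2)]
  note s = t r q m Hom_p_cell_simps comp_trans_simps two_functorD[OF t(1)] two_functorD[OF t(2)]
    two_functorD[OF pseudonaturalD(2)[OF q(1)]] B.cell_simps whisker_simps comp_pseudonatural
  show ?thesis
  proof (rule modificationI)
    fix f assume f: "f \<in> Arr B"
    define X Y where X: "X = Dom B f" and Y: "Y = Cod B f"
    have b: "X \<in> Obj B" "Y \<in> Obj B" "Dom B f = X" "Cod B f = Y" using f by (simp_all add: X Y B.cell_simps)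
    \<comment> \<open>A structure 2-cell of a composite transformation has two layers. The
      modification square of \<rho> moves past the layer of \<open>MSrc \<rho>\<close> here, and
      that of \<sigma> past the layer of \<open>MSrc \<sigma>\<close> in the next chain.\<close>
    have 1: "((MObj \<sigma> Y \<star> MObj \<rho> Y) \<star> IdC D (FArr (TDom (MSrc \<rho>)) f)) \<bullet>
          (IdC D (TObj (MSrc \<sigma>) Y) \<star> TArr (MSrc \<rho>) f) =
        MObj \<sigma> Y \<star> ((MObj \<rho> Y \<star> IdC D (FArr (TDom (MSrc \<rho>)) f)) \<bullet> TArr (MSrc \<rho>) f)"
      using f b by (simp add: s interchange_cell)
    also have "\<dots> = MObj \<sigma> Y \<star> (TArr (MTrg \<rho>) f \<bullet> (IdC D (FArr (TCod (MSrc \<rho>)) f) \<star> MObj \<rho> X))"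
      using modificationD(9)[OF \<rho> f] b by simp
    also have "\<dots> = (IdC D (TObj (MTrg \<sigma>) Y) \<star> TArr (MTrg \<rho>) f) \<bullet>
        (MObj \<sigma> Y \<star> (IdC D (FArr (TCod (MSrc \<rho>)) f) \<star> MObj \<rho> X))"
      using f b by (simp add: s interchange_cell)
    finally have 1: "((MObj \<sigma> Y \<star> MObj \<rho> Y) \<star> IdC D (FArr (TDom (MSrc \<rho>)) f)) \<bullet>
          (IdC D (TObj (MSrc \<sigma>) Y) \<star> TArr (MSrc \<rho>) f) =
        (IdC D (TObj (MTrg \<sigma>) Y) \<star> TArr (MTrg \<rho>) f) \<bullet>
        (MObj \<sigma> Y \<star> (IdC D (FArr (TCod (MSrc \<rho>)) f) \<star> MObj \<rho> X))" .
    have "(MObj \<sigma> Y \<star> (IdC D (FArr (TCod (MSrc \<rho>)) f) \<star> MObj \<rho> X)) \<bullet>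
          (TArr (MSrc \<sigma>) f \<star> IdC D (TObj (MSrc \<rho>) X)) =
        ((MObj \<sigma> Y \<star> IdC D (FArr (TCod (MSrc \<rho>)) f)) \<bullet> TArr (MSrc \<sigma>) f) \<star> MObj \<rho> X"
      using f b interchange_cell[of "IdC D (TObj (MSrc \<rho>) X)" "MObj \<rho> X" "TArr (MSrc \<sigma>) f"
          "MObj \<sigma> Y \<star> IdC D (FArr (TCod (MSrc \<rho>)) f)"] by (simp add: s)
    also have "\<dots> = (TArr (MTrg \<sigma>) f \<bullet> (IdC D (FArr (TCod (MSrc \<sigma>)) f) \<star> MObj \<sigma> X)) \<star> MObj \<rho> X"
      using modificationD(9)[OF \<sigma> f] b m by simp
    also have "\<dots> = (TArr (MTrg \<sigma>) f \<star> IdC D (TObj (MTrg \<rho>) X)) \<bullet>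
        (IdC D (FArr (TCod (MSrc \<sigma>)) f) \<star> (MObj \<sigma> X \<star> MObj \<rho> X))"
      using f b interchange_cell[of "MObj \<rho> X" "IdC D (TObj (MTrg \<rho>) X)"
          "IdC D (FArr (TCod (MSrc \<sigma>)) f) \<star> MObj \<sigma> X" "TArr (MTrg \<sigma>) f"] by (simp add: s)
    finally have 2: "(MObj \<sigma> Y \<star> (IdC D (FArr (TCod (MSrc \<rho>)) f) \<star> MObj \<rho> X)) \<bullet>
          (TArr (MSrc \<sigma>) f \<star> IdC D (TObj (MSrc \<rho>) X)) =
        (TArr (MTrg \<sigma>) f \<star> IdC D (TObj (MTrg \<rho>) X)) \<bullet>
        (IdC D (FArr (TCod (MSrc \<sigma>)) f) \<star> (MObj \<sigma> X \<star> MObj \<rho> X))" .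
    show "(MObj (HComp H \<sigma> \<rho>) (Cod B f) \<star> IdC D (FArr (TDom (MSrc (HComp H \<sigma> \<rho>))) f)) \<bullet>
          TArr (MSrc (HComp H \<sigma> \<rho>)) f =
        TArr (MTrg (HComp H \<sigma> \<rho>)) f \<bullet>
          (IdC D (FArr (TCod (MSrc (HComp H \<sigma> \<rho>))) f) \<star> MObj (HComp H \<sigma> \<rho>) (Dom B f))"
      using f b 2 vcomp_tail[OF 1, of "TArr (MSrc \<sigma>) f \<star> IdC D (TObj (MSrc \<rho>) X)"]
      by (simp add: s)
  qed (simp_all add: s)
qed

lemma comp_trans_ide:
  assumes \<theta>: "pseudonatural B D \<theta>"
  shows "comp_trans B D \<theta> (Ide H (TDom \<theta>)) = \<theta>" "comp_trans B D (Ide H (TCod \<theta>)) \<theta> = \<theta>"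
proof -
  note t = pseudonaturalD(1-12)[OF \<theta>]
  show "comp_trans B D \<theta> (Ide H (TDom \<theta>)) = \<theta>" "comp_trans B D (Ide H (TCod \<theta>)) \<theta> = \<theta>"
    by (rule trans_eqI[where P = "Obj B" and Q = "Arr B"]; simp add: t comp_trans_simps
        Hom_p_Ide_simps two_functorD[OF t(1)] two_functorD[OF t(2)] B.cell_simps cell_simps)+
qed

lemma comp_trans_assoc:
  assumes "pseudonatural B D \<theta>" "pseudonatural B D \<eta>" "pseudonatural B D \<zeta>"
    and m: "TDom \<eta> = TCod \<theta>" "TDom \<zeta> = TCod \<eta>"
  shows "comp_trans B D (comp_trans B D \<zeta> \<eta>) \<theta> = comp_trans B D \<zeta> (comp_trans B D \<eta> \<theta>)"
proof -
  note t = pseudonaturalD(1-12)[OF assms(1)] pseudonaturalD(2-12)[OF assms(2)]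
    pseudonaturalD(2-12)[OF assms(3)]
  note s = t m comp_trans_simps two_functorD[OF t(1)] two_functorD[OF t(2)]
    two_functorD[OF pseudonaturalD(2)[OF assms(2)]] two_functorD[OF pseudonaturalD(2)[OF assms(3)]]
    B.cell_simps whisker_simps
  show ?thesis by (rule trans_eqI[where P = "Obj B" and Q = "Arr B"]; simp add: s)
qed

text \<open>A modification is determined by its boundary and its components, so every equational
  axiom for 2-cells reduces to the same axiom of \<open>D\<close> at each object.\<close>

lemma Hom_p_two_category: "two_category H"
proof
  show "f \<in> Arr H \<Longrightarrow> Dom H f \<in> Obj H" "f \<in> Arr H \<Longrightarrow> Cod H f \<in> Obj H" for f
    by (simp_all add: Hom_p_sets Hom_p_ops pseudonaturalD)
  show "X \<in> Obj H \<Longrightarrow> Ide H X \<in> hom H X X" for X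
    by (simp add: hom_def Hom_p_sets Hom_p_ops Hom_p_Ide_simps Ide_pseudonatural)
  show "g \<cdot>\<^bsub>H\<^esub> f \<in> hom H X Z" if "f \<in> hom H X Y" "g \<in> hom H Y Z" for f g X Y Z
    using that by (auto simp: hom_def Hom_p_sets Hom_p_ops comp_trans_simps comp_pseudonatural)
  show "f \<cdot>\<^bsub>H\<^esub> Ide H (Dom H f) = f" "Ide H (Cod H f) \<cdot>\<^bsub>H\<^esub> f = f" if "f \<in> Arr H" for f
    using that by (simp_all add: Hom_p_sets Hom_p_ops comp_trans_ide)
  show "(h \<cdot>\<^bsub>H\<^esub> g) \<cdot>\<^bsub>H\<^esub> f = h \<cdot>\<^bsub>H\<^esub> (g \<cdot>\<^bsub>H\<^esub> f)"
    if "f \<in> hom H X Y" "g \<in> hom H Y Z" "h \<in> hom H Z U" for f g h X Y Z U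
    using that by (simp add: hom_def Hom_p_sets Hom_p_ops comp_trans_assoc)
  show "a \<in> Cell H \<Longrightarrow> Src H a \<in> Arr H" for a by (simp add: Hom_p_sets Hom_p_ops modificationD)
  show "a \<in> Cell H \<Longrightarrow> Trg H a \<in> hom H (Dom H (Src H a)) (Cod H (Src H a))" for a
    by (simp add: hom_def Hom_p_sets Hom_p_ops modificationD)
  show "f \<in> Arr H \<Longrightarrow> IdC H f \<in> hom2 H f f" for f
    by (simp add: hom2_def Hom_p_sets Hom_p_ops Hom_p_cell_simps IdC_modification)
  show "b \<bullet>\<^bsub>H\<^esub> a \<in> hom2 H f h" if "a \<in> hom2 H f g" "b \<in> hom2 H g h" for a b f g h
    using that by (auto simp: hom2_def Hom_p_sets Hom_p_ops Hom_p_cell_simps VComp_modification)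
  show "a \<bullet>\<^bsub>H\<^esub> IdC H (Src H a) = a" "IdC H (Trg H a) \<bullet>\<^bsub>H\<^esub> a = a" if "a \<in> Cell H" for a
  proof -
    have a: "modification B D a" using that by (simp add: Hom_p_sets)
    show "a \<bullet>\<^bsub>H\<^esub> IdC H (Src H a) = a" "IdC H (Trg H a) \<bullet>\<^bsub>H\<^esub> a = a"
      by (rule modif_eqI[where P = "Obj B"];
          simp add: modificationD(5-8)[OF a] Hom_p_ops Hom_p_cell_simps cell_simps)+
  qed
  show "(c \<bullet>\<^bsub>H\<^esub> b) \<bullet>\<^bsub>H\<^esub> a = c \<bullet>\<^bsub>H\<^esub> (b \<bullet>\<^bsub>H\<^esub> a)"
    if "a \<in> hom2 H f g" "b \<in> hom2 H g h" "c \<in> hom2 H h k" for a b c f g h k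
  proof -
    have a: "modification B D a" "modification B D b" "modification B D c"
      "MSrc b = MTrg a" "MSrc c = MTrg b"
      using that by (simp_all add: hom2_def Hom_p_sets Hom_p_ops)
    show ?thesis
      by (rule modif_eqI[where P = "Obj B"];
          simp add: modificationD(5-8)[OF a(1)] modificationD(5-8)[OF a(2)] modificationD(5-8)[OF a(3)]
            a(4,5) Hom_p_cell_simps cell_simps)
  qed
  show "b \<star>\<^bsub>H\<^esub> a \<in> hom2 H (g \<cdot>\<^bsub>H\<^esub> f) (g' \<cdot>\<^bsub>H\<^esub> f')"
    if "a \<in> hom2 H f f'" "b \<in> hom2 H g g'" "Dom H g = Cod H f" for a b f f' g g'
    using that by (auto simp: hom2_def Hom_p_sets Hom_p_ops Hom_p_cell_simps HComp_modification)
  show "a \<star>\<^bsub>H\<^esub> IdC H (Ide H (Dom H (Src H a))) = a"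
    "IdC H (Ide H (Cod H (Src H a))) \<star>\<^bsub>H\<^esub> a = a" if "a \<in> Cell H" for a
  proof -
    have a: "modification B D a" using that by (simp add: Hom_p_sets)
    note r = modificationD(1-8)[OF a]
    note t = pseudonaturalD(1-12)[OF r(1)] pseudonaturalD(1-12)[OF r(2)]
    note s = r t comp_trans_simps Hom_p_ops Hom_p_Ide_simps Hom_p_cell_simps
      two_functorD[OF pseudonaturalD(1)[OF r(1)]] two_functorD[OF pseudonaturalD(2)[OF r(1)]]
      B.cell_simps cell_simps
    show "a \<star>\<^bsub>H\<^esub> IdC H (Ide H (Dom H (Src H a))) = a"
      "IdC H (Ide H (Cod H (Src H a))) \<star>\<^bsub>H\<^esub> a = a"
      by (rule modif_eqI[where P = "Obj B"];
          simp add: s comp_trans_ide[OF r(1)] comp_trans_ide[OF r(2), unfolded r(3,4)])+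
  qed
  show "IdC H g \<star>\<^bsub>H\<^esub> IdC H f = IdC H (g \<cdot>\<^bsub>H\<^esub> f)" if "f \<in> hom H X Y" "g \<in> hom H Y Z" for f g X Y Z
  proof -
    have f: "pseudonatural B D f" "pseudonatural B D g" "TDom g = TCod f"
      using that by (simp_all add: hom_def Hom_p_sets Hom_p_ops)
    show ?thesis by (rule modif_eqI[where P = "Obj B"];
        simp add: f(3) pseudonaturalD(5-7)[OF f(1)] pseudonaturalD(5-7)[OF f(2)] comp_trans_simps
          Hom_p_ops Hom_p_cell_simps cell_simps)
  qed
  show "(c \<star>\<^bsub>H\<^esub> b) \<star>\<^bsub>H\<^esub> a = c \<star>\<^bsub>H\<^esub> (b \<star>\<^bsub>H\<^esub> a)"
    if "a \<in> hom2 H f f'" "b \<in> hom2 H g g'" "c \<in> hom2 H h h'" "Dom H g = Cod H f" "Dom H h = Cod H g"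
    for a b c f f' g g' h h'
  proof -
    have a: "modification B D a" "modification B D b" "modification B D c"
      "TDom (MSrc b) = TCod (MSrc a)" "TDom (MSrc c) = TCod (MSrc b)"
      using that by (simp_all add: hom2_def Hom_p_sets Hom_p_ops)
    note r = modificationD(1-8)[OF a(1)] modificationD(1-8)[OF a(2)] modificationD(1-8)[OF a(3)]
    note t = pseudonaturalD(1-7)[OF modificationD(1)[OF a(1)]]
      pseudonaturalD(1-7)[OF modificationD(1)[OF a(2)]] pseudonaturalD(1-7)[OF modificationD(1)[OF a(3)]]
    show ?thesis by (rule modif_eqI[where P = "Obj B"];
        simp add: a(4,5) r t Hom_p_ops Hom_p_cell_simps comp_trans_assoc cell_simps)
  qed
  show "(b' \<bullet>\<^bsub>H\<^esub> b) \<star>\<^bsub>H\<^esub> (a' \<bullet>\<^bsub>H\<^esub> a) = (b' \<star>\<^bsub>H\<^esub> a') \<bullet>\<^bsub>H\<^esub> (b \<star>\<^bsub>H\<^esub> a)"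
    if "a \<in> hom2 H f f'" "a' \<in> hom2 H f' f''" "b \<in> hom2 H g g'" "b' \<in> hom2 H g' g''" "Dom H g = Cod H f"
    for a a' b b' f f' f'' g g' g''
  proof -
    have a: "modification B D a" "modification B D a'" "modification B D b" "modification B D b'"
      "MSrc a' = MTrg a" "MSrc b' = MTrg b" "TDom (MSrc b) = TCod (MSrc a)"
      using that by (simp_all add: hom2_def Hom_p_sets Hom_p_ops)
    note r = modificationD(1-8)[OF a(1)] modificationD(1-8)[OF a(2)] modificationD(1-8)[OF a(3)]
      modificationD(1-8)[OF a(4)]
    note t = pseudonaturalD(1-7)[OF modificationD(1)[OF a(1)]] pseudonaturalD(1-7)[OF modificationD(1)[OF a(3)]]
      pseudonaturalD(1-7)[OF modificationD(2)[OF a(1)]] pseudonaturalD(1-7)[OF modificationD(2)[OF a(3)]]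
    show ?thesis by (rule modif_eqI[where P = "Obj B"];
        simp add: a(5-7) r t Hom_p_ops Hom_p_cell_simps interchange_cell)
  qed
qed

lemma two_natural_Ide: "two_functor B D F \<Longrightarrow> two_natural B D (Ide H F)"
  by (simp add: two_natural_def Ide_pseudonatural Hom_p_Ide_simps two_functorD B.cell_simps cell_simps)

text \<open>An identity structure 2-cell forces its source and target to coincide. The strict
  naturality squares obtained in this way identify the two layers of the composite as identities of
  one and the same arrow.\<close>

lemma two_natural_comp:
  assumes "two_natural B D \<theta>" "two_natural B D \<eta>" and m: "TDom \<eta> = TCod \<theta>"
  shows "two_natural B D (comp_trans B D \<eta> \<theta>)"
proof -
  have p: "pseudonatural B D \<theta>" "pseudonatural B D \<eta>" using assms by (auto simp: two_natural_def)
  note t = pseudonaturalD[OF p(1)] pseudonaturalD[OF p(2)]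
  have c: "FArr (TCod \<eta>) f \<cdot> TObj \<eta> (Dom B f) = TObj \<eta> (Cod B f) \<cdot> FArr (TCod \<theta>) f"
    and e: "TArr \<theta> f = IdC D (FArr (TCod \<theta>) f \<cdot> TObj \<theta> (Dom B f))"
      "TArr \<eta> f = IdC D (TObj \<eta> (Cod B f) \<cdot> FArr (TCod \<theta>) f)" if "f \<in> Arr B" for f
  proof -
    have "Src D (TArr \<eta> f) = Trg D (TArr \<eta> f)"
      using assms(2) that t by (auto simp: two_natural_def cell_simps two_functorD B.cell_simps)
    then show *: "FArr (TCod \<eta>) f \<cdot> TObj \<eta> (Dom B f) = TObj \<eta> (Cod B f) \<cdot> FArr (TCod \<theta>) f"
      using that pseudonaturalD(10,11)[OF p(2)] m by metis
    show "TArr \<theta> f = IdC D (FArr (TCod \<theta>) f \<cdot> TObj \<theta> (Dom B f))"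
      "TArr \<eta> f = IdC D (TObj \<eta> (Cod B f) \<cdot> FArr (TCod \<theta>) f)"
      using assms(1,2) that * by (auto simp: two_natural_def)
  qed
  have "FArr (TCod \<eta>) f \<cdot> (TObj \<eta> (Dom B f) \<cdot> TObj \<theta> (Dom B f)) =
      TObj \<eta> (Cod B f) \<cdot> (FArr (TCod \<theta>) f \<cdot> TObj \<theta> (Dom B f))" if "f \<in> Arr B" for f
    using arg_cong[OF c[OF that], of "\<lambda>g. g \<cdot> TObj \<theta> (Dom B f)"] that m t
    by (simp add: cell_simps two_functorD B.cell_simps)
  then show ?thesis
    using t m by (auto simp: two_natural_def comp_pseudonatural p m comp_trans_simps e cell_simps
        two_functorD B.cell_simps)
qed

end

text \<open>All 2-cells between the chosen arrows are kept, so only identities and composites of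
  arrows have to be checked.\<close>

lemma sub_2cat_two_category:
  assumes "two_category K" and ide: "\<And>X. \<lbrakk>X \<in> Obj K; P X\<rbrakk> \<Longrightarrow> Q (Ide K X)"
    and comp: "\<And>f g. \<lbrakk>f \<in> Arr K; g \<in> Arr K; Dom K g = Cod K f; Q f; Q g\<rbrakk> \<Longrightarrow> Q (g \<cdot>\<^bsub>K\<^esub> f)"
  shows "two_category (sub_2cat K P Q)"
proof -
  interpret two_category K by fact
  show ?thesis
    by standard (auto simp: sub_2cat_def Let_def hom_def hom2_def cell_simps interchange_cell ide comp)
qed

text \<open>Presents \<open>Hom_s_plus\<close> as a single sub-2-category of \<open>Hom_p\<close>,
  the form that \<open>precomp_isomorphism\<close> treats.\<close>

lemma sub_2cat_sub_2cat:
  "sub_2cat (sub_2cat K P Q) P' Q' = sub_2cat K (\<lambda>X. P X \<and> P' X) (\<lambda>f. Q f \<and> Q' f)"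
  by (auto simp: sub_2cat_def Let_def intro!: twocat.equality)

lemma id_fun2_two_functor:
  assumes "two_category B"
  shows "two_functor B B (id_fun2 B)"
proof -
  interpret two_category B by fact
  show ?thesis
    by (auto simp: two_functor_def is_functor_def id_fun2_def hom_def hom2_def cell_simps)
qed

text \<open>Both composites with the inverse are identity 2-functors on the nose, so identity
  transformations serve as the two comparison equivalences.\<close>

lemma isomorphism_2cat_imp_pseudoequivalence_strict:
  assumes B: "two_category B" and B': "two_category B'" and F: "isomorphism_2cat B B' F"
  shows "pseudoequivalence_strict B B' F"
proof -
  have *: "\<exists>\<eta> \<in> hom (Hom_s K K) (id_fun2 K) (id_fun2 K). equivalence (Hom_s K K) \<eta>"
    if "two_category K" for K :: "('x, 'y, 'z, 'm) twocat_scheme"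
  proof -
    interpret two_category_pair K K using that by (simp add: two_category_pair_def)
    interpret S: two_category "Hom_s K K" unfolding Hom_s_def
      by (rule sub_2cat_two_category[OF Hom_p_two_category])
        (simp_all add: Hom_p_sets Hom_p_ops two_natural_Ide two_natural_comp)
    have i: "id_fun2 K \<in> Obj (Hom_s K K)"
      using that by (simp add: Hom_s_def sub_2cat_def Let_def Hom_p_sets id_fun2_two_functor)
    show ?thesis using S.equivalence_ide[OF i] S.ide_hom[OF i] by blast
  qed
  obtain G where G: "two_functor B B' F" "two_functor B' B G" "comp_fun2 B G F = id_fun2 B"
      "comp_fun2 B' F G = id_fun2 B'"
    using F unfolding isomorphism_2cat_def by blast
  then show ?thesis unfolding pseudoequivalence_strict_def
    using *[OF B] *[OF B'] by metis
qed

section \<open>Precomposition\<close>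

lemma comp_fun2_simps:
  "X \<in> Obj A \<Longrightarrow> FObj (comp_fun2 A F q) X = FObj F (FObj q X)"
  "f \<in> Arr A \<Longrightarrow> FArr (comp_fun2 A F q) f = FArr F (FArr q f)"
  "c \<in> Cell A \<Longrightarrow> FCell (comp_fun2 A F q) c = FCell F (FCell q c)"
  "FObj (comp_fun2 A F q) \<in> extensional (Obj A)" "FArr (comp_fun2 A F q) \<in> extensional (Arr A)"
  "FCell (comp_fun2 A F q) \<in> extensional (Cell A)"
  by (simp_all add: comp_fun2_def compose_eq)

lemma whisker_trans_simps:
  "TDom (whisker_trans A q \<theta>) = comp_fun2 A (TDom \<theta>) q"
  "TCod (whisker_trans A q \<theta>) = comp_fun2 A (TCod \<theta>) q"
  "X \<in> Obj A \<Longrightarrow> TObj (whisker_trans A q \<theta>) X = TObj \<theta> (FObj q X)"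
  "f \<in> Arr A \<Longrightarrow> TArr (whisker_trans A q \<theta>) f = TArr \<theta> (FArr q f)"
  "TObj (whisker_trans A q \<theta>) \<in> extensional (Obj A)"
  "TArr (whisker_trans A q \<theta>) \<in> extensional (Arr A)"
  by (simp_all add: whisker_trans_def compose_eq)

lemma whisker_modif_simps:
  "MSrc (whisker_modif A q \<rho>) = whisker_trans A q (MSrc \<rho>)"
  "MTrg (whisker_modif A q \<rho>) = whisker_trans A q (MTrg \<rho>)"
  "X \<in> Obj A \<Longrightarrow> MObj (whisker_modif A q \<rho>) X = MObj \<rho> (FObj q X)"
  "MObj (whisker_modif A q \<rho>) \<in> extensional (Obj A)"
  by (simp_all add: whisker_modif_def compose_eq)

locale precomposition = A: two_category A + two_category_pair L D
  for A :: "('o, 'a, 'c, 'm) twocat_scheme" and L :: "('p, 'b, 'd, 'n) twocat_scheme"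
    and D :: "('q, 'e, 'f, 'l) twocat_scheme" (structure) +
  fixes q
  assumes q: "two_functor A L q"
begin

lemmas q_simps = two_functorD[OF q]

lemma comp_fun2_two_functor:
  assumes "two_functor L D F"
  shows "two_functor A D (comp_fun2 A F q)"
  unfolding two_functor_def is_functor_def hom_def hom2_def
  by (simp add: comp_fun2_simps A.cell_simps q_simps two_functorD[OF assms])

lemma whisker_trans_pseudonatural:
  assumes \<theta>: "pseudonatural L D \<theta>"
  shows "pseudonatural A D (whisker_trans A q \<theta>)"
proof -
  note t = pseudonaturalD(1,2,5-13)[OF \<theta>]
  show ?thesis
  proof (rule pseudonaturalI)
    fix \<alpha> assume "\<alpha> \<in> Cell A"
    then show "TArr (whisker_trans A q \<theta>) (Trg A \<alpha>) \<bullet> (FCell (TCod (whisker_trans A q \<theta>)) \<alpha> \<star>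
          IdC D (TObj (whisker_trans A q \<theta>) (Dom A (Src A \<alpha>)))) =
        (IdC D (TObj (whisker_trans A q \<theta>) (Cod A (Src A \<alpha>))) \<star>
          FCell (TDom (whisker_trans A q \<theta>)) \<alpha>) \<bullet> TArr (whisker_trans A q \<theta>) (Src A \<alpha>)"
      using pseudonaturalD(14)[OF \<theta>, of "FCell q \<alpha>"]
      by (simp add: whisker_trans_simps comp_fun2_simps A.cell_simps q_simps)
  qed (simp_all add: t whisker_trans_simps comp_fun2_simps comp_fun2_two_functor A.cell_simps q_simps)
qed

lemma whisker_modif_modification:
  assumes \<rho>: "modification L D \<rho>"
  shows "modification A D (whisker_modif A q \<rho>)"
proof (rule modificationI)
  fix f assume "f \<in> Arr A"
  then show "(MObj (whisker_modif A q \<rho>) (Cod A f) \<star>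
        IdC D (FArr (TDom (MSrc (whisker_modif A q \<rho>))) f)) \<bullet> TArr (MSrc (whisker_modif A q \<rho>)) f =
      TArr (MTrg (whisker_modif A q \<rho>)) f \<bullet>
        (IdC D (FArr (TCod (MSrc (whisker_modif A q \<rho>))) f) \<star> MObj (whisker_modif A q \<rho>) (Dom A f))"
    using modificationD(9)[OF \<rho>, of "FArr q f"]
    by (simp add: whisker_modif_simps whisker_trans_simps comp_fun2_simps A.cell_simps q_simps)
qed (simp_all add: modificationD(1-8)[OF \<rho>] whisker_modif_simps whisker_trans_simps
      whisker_trans_pseudonatural q_simps)

lemma whisker_trans_ide:
  "two_functor L D F \<Longrightarrow>
    whisker_trans A q (Ide (Hom_p L D) F) = Ide (Hom_p A D) (comp_fun2 A F q)"
  by (rule trans_eqI[where P = "Obj A" and Q = "Arr A"])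
    (simp_all add: whisker_trans_simps comp_fun2_simps Hom_p_Ide_simps q_simps)

lemma whisker_trans_comp:
  "\<lbrakk>pseudonatural L D \<theta>; pseudonatural L D \<eta>; TDom \<eta> = TCod \<theta>\<rbrakk> \<Longrightarrow>
    whisker_trans A q (comp_trans L D \<eta> \<theta>) = comp_trans A D (whisker_trans A q \<eta>) (whisker_trans A q \<theta>)"
  by (rule trans_eqI[where P = "Obj A" and Q = "Arr A"])
    (simp_all add: whisker_trans_simps comp_fun2_simps comp_trans_simps q_simps A.cell_simps)

lemma whisker_modif_ops:
  "pseudonatural L D \<theta> \<Longrightarrow>
    whisker_modif A q (IdC (Hom_p L D) \<theta>) = IdC (Hom_p A D) (whisker_trans A q \<theta>)"
  "\<lbrakk>modification L D \<rho>; modification L D \<sigma>; MSrc \<sigma> = MTrg \<rho>\<rbrakk> \<Longrightarrow>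
    whisker_modif A q (\<sigma> \<bullet>\<^bsub>Hom_p L D\<^esub> \<rho>) = whisker_modif A q \<sigma> \<bullet>\<^bsub>Hom_p A D\<^esub> whisker_modif A q \<rho>"
  "\<lbrakk>modification L D \<rho>; modification L D \<sigma>; TDom (MSrc \<sigma>) = TCod (MSrc \<rho>)\<rbrakk> \<Longrightarrow>
    whisker_modif A q (\<sigma> \<star>\<^bsub>Hom_p L D\<^esub> \<rho>) = whisker_modif A q \<sigma> \<star>\<^bsub>Hom_p A D\<^esub> whisker_modif A q \<rho>"
  by (rule modif_eqI[where P = "Obj A"]; simp add: whisker_modif_simps whisker_trans_simps
      Hom_p_cell_simps whisker_trans_comp modificationD(1-4) q_simps)+

text \<open>The predicates make one proof cover the strict and the pseudo version, with or without
  the condition of inverting a class of arrows.\<close>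

lemma precomp_two_functor:
  fixes P :: "('p, 'b, 'd, 'q, 'e, 'f) fun2 \<Rightarrow> bool" and P' :: "('o, 'a, 'c, 'q, 'e, 'f) fun2 \<Rightarrow> bool"
  assumes P: "\<And>F. \<lbrakk>two_functor L D F; P F\<rbrakk> \<Longrightarrow> P' (comp_fun2 A F q)"
    and Q: "\<And>\<theta>. \<lbrakk>pseudonatural L D \<theta>; Q \<theta>\<rbrakk> \<Longrightarrow> Q' (whisker_trans A q \<theta>)"
    and K: "two_category (sub_2cat (Hom_p L D) P Q)"
  shows "two_functor (sub_2cat (Hom_p L D) P Q) (sub_2cat (Hom_p A D) P' Q')
    (precomp A q (sub_2cat (Hom_p L D) P Q))"
proof -
  let ?K = "sub_2cat (Hom_p L D) P Q"
  interpret K: two_category ?K by fact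
  have K: "Obj ?K = {F. two_functor L D F \<and> P F}"
    "Arr ?K = {\<theta>. pseudonatural L D \<theta> \<and> P (TDom \<theta>) \<and> P (TCod \<theta>) \<and> Q \<theta>}"
    "Cell ?K = {\<rho>. modification L D \<rho> \<and> MSrc \<rho> \<in> Arr ?K \<and> MTrg \<rho> \<in> Arr ?K}"
    "Dom ?K = TDom" "Cod ?K = TCod" "Ide ?K = Ide (Hom_p L D)" "Comp ?K = comp_trans L D"
    "Src ?K = MSrc" "Trg ?K = MTrg" "IdC ?K = IdC (Hom_p L D)"
    "VComp ?K = VComp (Hom_p L D)" "HComp ?K = HComp (Hom_p L D)"
    by (auto simp: sub_2cat_def Let_def Hom_p_sets Hom_p_ops)
  let ?K' = "sub_2cat (Hom_p A D) P' Q'"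
  have K': "Obj ?K' = {F. two_functor A D F \<and> P' F}"
    "Arr ?K' = {\<theta>. pseudonatural A D \<theta> \<and> P' (TDom \<theta>) \<and> P' (TCod \<theta>) \<and> Q' \<theta>}"
    "Cell ?K' = {\<rho>. modification A D \<rho> \<and> MSrc \<rho> \<in> Arr ?K' \<and> MTrg \<rho> \<in> Arr ?K'}"
    "Dom ?K' = TDom" "Cod ?K' = TCod" "Ide ?K' = Ide (Hom_p A D)" "Comp ?K' = comp_trans A D"
    "Src ?K' = MSrc" "Trg ?K' = MTrg" "IdC ?K' = IdC (Hom_p A D)"
    "VComp ?K' = VComp (Hom_p A D)" "HComp ?K' = HComp (Hom_p A D)"
    by (auto simp: sub_2cat_def Let_def Hom_p_sets Hom_p_ops)
  let ?p = "precomp A q ?K"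
  have p: "F \<in> Obj ?K \<Longrightarrow> FObj ?p F = comp_fun2 A F q" "\<theta> \<in> Arr ?K \<Longrightarrow> FArr ?p \<theta> = whisker_trans A q \<theta>"
    "\<rho> \<in> Cell ?K \<Longrightarrow> FCell ?p \<rho> = whisker_modif A q \<rho>" for F \<theta> \<rho>
    by (simp_all add: precomp_def)
  have O: "comp_fun2 A F q \<in> Obj ?K'" if "F \<in> Obj ?K" for F
    using that by (simp add: K K' comp_fun2_two_functor P)
  have Ar: "whisker_trans A q \<theta> \<in> Arr ?K'" if "\<theta> \<in> Arr ?K" for \<theta>
    using that by (auto simp: K K' whisker_trans_pseudonatural whisker_trans_simps P Q pseudonaturalD)
  have Ce: "whisker_modif A q \<rho> \<in> Cell ?K'" if "\<rho> \<in> Cell ?K" for \<rho>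
    using that Ar[of "MSrc \<rho>"] Ar[of "MTrg \<rho>"]
    by (simp add: K(3) K'(3) whisker_modif_modification whisker_modif_simps)
  show ?thesis unfolding two_functor_def is_functor_def hom_def hom2_def
  proof (intro conjI ballI impI)
    fix X assume X: "X \<in> Obj ?K"
    show "FObj ?p X \<in> Obj ?K'" using X O by (simp add: p)
    show "FArr ?p (Ide ?K X) = Ide ?K' (FObj ?p X)"
      using X K.ide_simps(1)[OF X] by (simp add: p K(1,6) K'(6) whisker_trans_ide)
  next
    fix f assume f: "f \<in> Arr ?K"
    then show "FArr ?p f \<in> {fa \<in> Arr ?K'. Dom ?K' fa = FObj ?p (Dom ?K f) \<and> Cod ?K' fa = FObj ?p (Cod ?K f)}"
      using Ar K.arr_simps(1,2)[OF f] by (simp add: p K(4,5) K'(4,5) whisker_trans_simps)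
    show "FCell ?p (IdC ?K f) = IdC ?K' (FArr ?p f)"
      using f K.idc_simps(1)[OF f] by (simp add: p K(2,10) K'(10) whisker_modif_ops)
  next
    fix f g assume fg: "f \<in> Arr ?K" "g \<in> Arr ?K" "Dom ?K g = Cod ?K f"
    show "FArr ?p (g \<cdot>\<^bsub>?K\<^esub> f) = FArr ?p g \<cdot>\<^bsub>?K'\<^esub> FArr ?p f"
      using fg K.comp_simps(1)[OF fg] by (simp add: p K(2,4,5,7) K'(7) whisker_trans_comp)
  next
    fix a assume a: "a \<in> Cell ?K"
    then show "FCell ?p a \<in> {\<alpha> \<in> Cell ?K'. Src ?K' \<alpha> = FArr ?p (Src ?K a) \<and> Trg ?K' \<alpha> = FArr ?p (Trg ?K a)}"
      using Ce K.cell_boundary[OF a] by (simp add: p K(8,9) K'(8,9) whisker_modif_simps)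
  next
    fix a b assume ab: "a \<in> Cell ?K" "b \<in> Cell ?K" "Src ?K b = Trg ?K a"
    show "FCell ?p (b \<bullet>\<^bsub>?K\<^esub> a) = FCell ?p b \<bullet>\<^bsub>?K'\<^esub> FCell ?p a"
      using ab K.vcomp_simps(1)[OF ab] by (simp add: p K(3,8,9,11) K'(11) whisker_modif_ops)
  next
    fix a b assume ab: "a \<in> Cell ?K" "b \<in> Cell ?K" "Dom ?K (Src ?K b) = Cod ?K (Src ?K a)"
    show "FCell ?p (b \<star>\<^bsub>?K\<^esub> a) = FCell ?p b \<star>\<^bsub>?K'\<^esub> FCell ?p a"
      using ab K.hcomp_simps(1)[OF ab] by (simp add: p K(3,4,5,8,12) K'(12) whisker_modif_ops)
  qed (simp_all add: precomp_def)
qed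

end

section \<open>The homotopy 2-category\<close>

lemma disc_two_category:
  assumes "category A"
  shows "two_category (disc A)"
proof -
  interpret category A by fact
  show ?thesis
    by standard (auto simp: hom_def hom2_def arr_simps)
qed

text \<open>Identities have to lie in \<Sigma> because \<open>id_htpy\<close> uses an identity as
  the map \<open>cyl_s\<close> of its cylinder.\<close>

locale relative_category = category A for A :: "('o, 'a) cat" (structure) +
  fixes \<Sigma> :: "'a set"
  assumes Sigma_Arr: "\<Sigma> \<subseteq> Arr A" and Ide_Sigma: "X \<in> Obj A \<Longrightarrow> Ide A X \<in> \<Sigma>"
begin

lemma cylinderD:
  assumes "is_cylinder A \<Sigma> X K"
  shows "cyl_d0 K \<in> Arr A" "cyl_d1 K \<in> Arr A" "cyl_s K \<in> Arr A" "cyl_x K \<in> Arr A"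
    "Dom A (cyl_d0 K) = X" "Dom A (cyl_d1 K) = X" "Dom A (cyl_x K) = X"
    "Cod A (cyl_d0 K) = cylW K" "Cod A (cyl_d1 K) = cylW K" "Dom A (cyl_s K) = cylW K"
    "Cod A (cyl_s K) = cylZ K" "Cod A (cyl_x K) = cylZ K" "cyl_s K \<in> \<Sigma>"
    "cyl_s K \<cdot> cyl_d0 K = cyl_x K" "cyl_s K \<cdot> cyl_d1 K = cyl_x K" "X \<in> Obj A" "cylW K \<in> Obj A" "cylZ K \<in> Obj A"
  using assms dom_closed[of "cyl_d0 K"] cod_closed[of "cyl_d0 K"] cod_closed[of "cyl_s K"]
  unfolding is_cylinder_def hom_def by auto

lemma homotopyD:
  assumes "is_homotopy A \<Sigma> f g H"
  shows "f \<in> Arr A" "g \<in> Arr A" "Dom A g = Dom A f" "Cod A g = Cod A f"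
    "is_cylinder A \<Sigma> (Dom A f) (hcyl H)" "hmap H \<in> Arr A" "Dom A (hmap H) = cylW (hcyl H)"
    "Cod A (hmap H) = Cod A f" "hmap H \<cdot> cyl_d0 (hcyl H) = f" "hmap H \<cdot> cyl_d1 (hcyl H) = g"
  using assms unfolding is_homotopy_def hom_def by auto

lemma hseqD:
  assumes "is_hseq A \<Sigma> f g Hs"
  shows "f \<in> Arr A" "g \<in> Arr A" "Dom A g = Dom A f" "Cod A g = Cod A f" "Hs \<noteq> []"
  using assms by induction (simp_all add: homotopyD)

lemma hseq_append:
  assumes "is_hseq A \<Sigma> g k Ks" "is_hseq A \<Sigma> f g Hs"
  shows "is_hseq A \<Sigma> f k (Ks @ Hs)"
  using assms by (induction) (auto intro: is_hseq.intros)

lemma id_htpy_homotopy: "f \<in> Arr A \<Longrightarrow> is_homotopy A \<Sigma> f f (id_htpy A f)"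
  by (simp add: is_homotopy_def is_cylinder_def id_htpy_def Let_def hom_def arr_simps Ide_Sigma)

lemma id_htpy_hseq: "f \<in> Arr A \<Longrightarrow> is_hseq A \<Sigma> f f [id_htpy A f]"
  by (rule is_hseq.single) (rule id_htpy_homotopy)

lemma lwhisker_homotopy:
  assumes H: "is_homotopy A \<Sigma> f g H" and r: "r \<in> Arr A" "Dom A r = Cod A f"
  shows "is_homotopy A \<Sigma> (r \<cdot> f) (r \<cdot> g) (lwhisker A r H)"
  using homotopyD[OF H] cylinderD[OF homotopyD(5)[OF H]] r
  by (simp add: is_homotopy_def lwhisker_def hom_def arr_simps)

lemma rwhisker_homotopy:
  assumes H: "is_homotopy A \<Sigma> f g H" and l: "l \<in> Arr A" "Cod A l = Dom A f"
  shows "is_homotopy A \<Sigma> (f \<cdot> l) (g \<cdot> l) (rwhisker A H l)"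
proof -
  note h = homotopyD[OF H] and k = cylinderD[OF homotopyD(5)[OF H]]
  have 1: "hmap H \<cdot> (cyl_d0 (hcyl H) \<cdot> l) = f \<cdot> l" "hmap H \<cdot> (cyl_d1 (hcyl H) \<cdot> l) = g \<cdot> l"
    "cyl_s (hcyl H) \<cdot> (cyl_d0 (hcyl H) \<cdot> l) = cyl_x (hcyl H) \<cdot> l"
    "cyl_s (hcyl H) \<cdot> (cyl_d1 (hcyl H) \<cdot> l) = cyl_x (hcyl H) \<cdot> l"
    using h k l comp_assoc_arr by metis+
  show ?thesis using h k l
    by (simp add: is_homotopy_def is_cylinder_def rwhisker_def Let_def hom_def arr_simps 1)
qed

lemma lwhisker_hseq:
  assumes "is_hseq A \<Sigma> f g Hs" "r \<in> Arr A" "Dom A r = Cod A f"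
  shows "is_hseq A \<Sigma> (r \<cdot> f) (r \<cdot> g) (map (lwhisker A r) Hs)"
  using assms by induction (auto intro!: is_hseq.intros lwhisker_homotopy simp: hseqD)

lemma rwhisker_hseq:
  assumes "is_hseq A \<Sigma> f g Hs" "l \<in> Arr A" "Cod A l = Dom A f"
  shows "is_hseq A \<Sigma> (f \<cdot> l) (g \<cdot> l) (map (\<lambda>H. rwhisker A H l) Hs)"
  using assms by induction (auto intro!: is_hseq.intros rwhisker_homotopy simp: hseqD)

text \<open>The sequence passes through \<open>g \<cdot> f'\<close>: lists are read from the right,
  so the homotopies whiskered by \<open>g\<close> come first.\<close>

lemma hcomp_hseq:
  assumes "is_hseq A \<Sigma> f f' Hs" "is_hseq A \<Sigma> g g' Ks" "Dom A g = Cod A f"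
  shows "is_hseq A \<Sigma> (g \<cdot> f) (g' \<cdot> f') (map (\<lambda>K. rwhisker A K f') Ks @ map (lwhisker A g) Hs)"
  using assms by (intro hseq_append[of "g \<cdot> f'"] lwhisker_hseq rwhisker_hseq) (simp_all add: hseqD)

end

section \<open>Images of homotopies under a 2-functor that inverts \<Sigma>\<close>

locale inverting_functor = A: relative_category A \<Sigma> + two_category D
  for A :: "('o, 'a) cat" and \<Sigma> and D :: "('p, 'b, 'd) twocat" (structure) +
  fixes F :: "('o, 'a, 'a, 'p, 'b, 'd) fun2"
  assumes two_functor: "two_functor (disc A) D F" and inverts: "inverts F \<Sigma> D"
begin

lemmas F_simps = disc_functorD[OF two_functor]

lemma hat_cyl_simps:
  assumes "is_cylinder A \<Sigma> X K"
  shows "hat_cyl D F K \<in> Cell D" "Src D (hat_cyl D F K) = FArr F (cyl_d0 K)"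
    "Trg D (hat_cyl D F K) = FArr F (cyl_d1 K)"
    "IdC D (FArr F (cyl_s K)) \<star> hat_cyl D F K = IdC D (FArr F (cyl_x K))"
  using hat_cyl(1)[OF two_category_axioms two_functor inverts assms] unfolding hom2_def by auto

lemma hat_cyl_eqI:
  assumes "is_cylinder A \<Sigma> X K" "\<gamma> \<in> Cell D" "Src D \<gamma> = FArr F (cyl_d0 K)"
    "Trg D \<gamma> = FArr F (cyl_d1 K)" "IdC D (FArr F (cyl_s K)) \<star> \<gamma> = IdC D (FArr F (cyl_x K))"
  shows "hat_cyl D F K = \<gamma>"
  using hat_cyl(2)[OF two_category_axioms two_functor inverts assms(1)] assms unfolding hom2_def by auto

lemma hat_htpy_simps:
  assumes H: "is_homotopy A \<Sigma> f g H"
  shows "hat_htpy D F H \<in> Cell D" "Src D (hat_htpy D F H) = FArr F f"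
    "Trg D (hat_htpy D F H) = FArr F g"
proof -
  note h = A.homotopyD[OF H] and k = A.cylinderD[OF A.homotopyD(5)[OF H]]
    and e = hat_cyl_simps[OF A.homotopyD(5)[OF H]]
  show "hat_htpy D F H \<in> Cell D" unfolding hat_htpy_def using h k e F_simps by (simp add: cell_simps)
  have "Src D (hat_htpy D F H) = FArr F (hmap H \<cdot>\<^bsub>A\<^esub> cyl_d0 (hcyl H))"
    "Trg D (hat_htpy D F H) = FArr F (hmap H \<cdot>\<^bsub>A\<^esub> cyl_d1 (hcyl H))"
    unfolding hat_htpy_def using h(6,7) k e F_simps by (simp_all add: cell_simps)
  then show "Src D (hat_htpy D F H) = FArr F f" "Trg D (hat_htpy D F H) = FArr F g" using h by simp_all
qed

lemma hat_hseq_Cons: "Hs \<noteq> [] \<Longrightarrow> hat_hseq D F (H # Hs) = hat_htpy D F H \<bullet> hat_hseq D F Hs"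
  by (cases Hs) auto

lemma hat_hseq_simps:
  assumes "is_hseq A \<Sigma> f g Hs"
  shows "hat_hseq D F Hs \<in> Cell D" "Src D (hat_hseq D F Hs) = FArr F f"
    "Trg D (hat_hseq D F Hs) = FArr F g"
  using assms by induction (simp_all add: hat_htpy_simps hat_hseq_Cons A.hseqD cell_simps)

lemma hat_hseq_append:
  assumes "is_hseq A \<Sigma> g k Ks" "is_hseq A \<Sigma> f g Hs"
  shows "hat_hseq D F (Ks @ Hs) = hat_hseq D F Ks \<bullet> hat_hseq D F Hs"
  using assms
  by induction (simp_all add: hat_htpy_simps hat_hseq_simps hat_hseq_Cons A.hseqD cell_simps)

text \<open>The cylinder has \<open>cyl_s\<close> an identity, so an identity 2-cell solves the
  equation that characterizes \<open>hat_cyl\<close>.\<close>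

lemma hat_id_htpy:
  assumes f: "f \<in> Arr A"
  shows "hat_htpy D F (id_htpy A f) = IdC D (FArr F f)"
proof -
  have "hat_cyl D F (hcyl (id_htpy A f)) = IdC D (Ide D (FObj F (Dom A f)))"
    by (rule hat_cyl_eqI[OF A.homotopyD(5)[OF A.id_htpy_homotopy[OF f]]])
      (simp_all add: id_htpy_def Let_def f F_simps cell_simps A.arr_simps)
  then show ?thesis by (simp add: hat_htpy_def) (simp add: id_htpy_def Let_def f F_simps cell_simps A.arr_simps)
qed

lemma hat_lwhisker:
  assumes H: "is_homotopy A \<Sigma> f g H" and r: "r \<in> Arr A" "Dom A r = Cod A f"
  shows "hat_htpy D F (lwhisker A r H) = IdC D (FArr F r) \<star> hat_htpy D F H"
  using A.homotopyD[OF H] A.cylinderD[OF A.homotopyD(5)[OF H]] hat_cyl_simps[OF A.homotopyD(5)[OF H]] r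
  by (simp add: hat_htpy_def lwhisker_def F_simps whisker_simps)

text \<open>Unlike left whiskering, this changes the cylinder. Its map \<open>cyl_s\<close> stays
  the same, so the old hat 2-cell whiskered with \<open>l\<close> solves the new equation, and
  uniqueness applies.\<close>

lemma hat_rwhisker:
  assumes H: "is_homotopy A \<Sigma> f g H" and l: "l \<in> Arr A" "Cod A l = Dom A f"
  shows "hat_htpy D F (rwhisker A H l) = hat_htpy D F H \<star> IdC D (FArr F l)"
proof -
  note h = A.homotopyD[OF H] and k = A.cylinderD[OF A.homotopyD(5)[OF H]]
    and e = hat_cyl_simps[OF A.homotopyD(5)[OF H]]
  have "IdC D (FArr F (cyl_s (hcyl H))) \<star> (hat_cyl D F (hcyl H) \<star> IdC D (FArr F l)) =
      (IdC D (FArr F (cyl_s (hcyl H))) \<star> hat_cyl D F (hcyl H)) \<star> IdC D (FArr F l)"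
    using k e(1-3) l by (simp add: F_simps cell_simps)
  also have "\<dots> = IdC D (FArr F (cyl_x (hcyl H \<lparr>cyl_x := cyl_x (hcyl H) \<cdot>\<^bsub>A\<^esub> l\<rparr>)))"
    using k e l by (simp add: F_simps cell_simps)
  finally have "hat_cyl D F (hcyl (rwhisker A H l)) = hat_cyl D F (hcyl H) \<star> IdC D (FArr F l)"
    by (intro hat_cyl_eqI[OF A.homotopyD(5)[OF A.rwhisker_homotopy[OF H l]]])
      (use k e l in \<open>simp_all add: rwhisker_def Let_def F_simps cell_simps\<close>)
  then show ?thesis unfolding hat_htpy_def using h k e(1-3) l
    by (simp add: F_simps cell_simps) (simp add: rwhisker_def Let_def)
qed

lemma hat_lwhisker_hseq:
  assumes "is_hseq A \<Sigma> f g Hs" "r \<in> Arr A" "Dom A r = Cod A f"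
  shows "hat_hseq D F (map (lwhisker A r) Hs) = IdC D (FArr F r) \<star> hat_hseq D F Hs"
  using assms
proof induction
  case (step f g Hs k H)
  then show ?case using A.hseqD[OF step(1)] A.homotopyD[OF step(2)] hat_hseq_simps[OF step(1)] hat_htpy_simps[OF step(2)]
    by (simp add: hat_hseq_Cons hat_lwhisker F_simps whisker_left_vcomp)
qed (simp add: hat_lwhisker)

lemma hat_rwhisker_hseq:
  assumes "is_hseq A \<Sigma> f g Hs" "l \<in> Arr A" "Cod A l = Dom A f"
  shows "hat_hseq D F (map (\<lambda>H. rwhisker A H l) Hs) = hat_hseq D F Hs \<star> IdC D (FArr F l)"
  using assms
proof induction
  case (step f g Hs k H)
  then show ?case using A.hseqD[OF step(1)] A.homotopyD[OF step(2)] hat_hseq_simps[OF step(1)] hat_htpy_simps[OF step(2)]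
    by (simp add: hat_hseq_Cons hat_rwhisker F_simps whisker_right_vcomp)
qed (simp add: hat_rwhisker)

text \<open>The horizontal composite in \<open>Ho\<close> is defined by one of the two orders of
  whiskering; \<open>hcomp_exchange\<close> shows that its image is the horizontal composite in
  \<open>D\<close>.\<close>

lemma hat_hcomp:
  assumes H: "is_hseq A \<Sigma> f f' Hs" and K: "is_hseq A \<Sigma> g g' Ks" and m: "Dom A g = Cod A f"
  shows "hat_hseq D F (map (\<lambda>K. rwhisker A K f') Ks @ map (lwhisker A g) Hs) =
    hat_hseq D F Ks \<star> hat_hseq D F Hs"
proof -
  note h = A.hseqD[OF H] A.hseqD[OF K] hat_hseq_simps[OF H] hat_hseq_simps[OF K]
  show ?thesis
    using hat_hseq_append[OF A.rwhisker_hseq[OF K, of f'] A.lwhisker_hseq[OF H, of g]] h m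
      hat_rwhisker_hseq[OF K, of f'] hat_lwhisker_hseq[OF H, of g]
      hcomp_exchange(1)[of "hat_hseq D F Hs" "hat_hseq D F Ks"]
    by (simp add: F_simps)
qed

end

lemma Ho_simps:
  "Obj (Ho A \<Sigma>) = Obj A" "Arr (Ho A \<Sigma>) = Arr A" "Dom (Ho A \<Sigma>) = Dom A" "Cod (Ho A \<Sigma>) = Cod A"
  "Ide (Ho A \<Sigma>) = Ide A" "Comp (Ho A \<Sigma>) = Comp A"
  by (simp_all add: Ho_def)

definition Ho_cell :: "('o, 'a) cat \<Rightarrow> 'a set \<Rightarrow> 'a \<Rightarrow> 'a \<Rightarrow> ('o, 'a) homotopy list
    \<Rightarrow> 'a \<times> 'a \<times> ('o, 'a) homotopy list set" where
  "Ho_cell A \<Sigma> f g Hs = (f, g, hclass A \<Sigma> f g Hs)"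

text \<open>The 2-functor induced by \<open>F\<close> on the homotopy 2-category sends a class to the common value of
  \<open>hat_hseq D F\<close> on its members.\<close>

definition Ho_ext :: "('o, 'a) cat \<Rightarrow> 'a set \<Rightarrow> ('p, 'b, 'd) twocat
    \<Rightarrow> ('o, 'a, 'a, 'p, 'b, 'd) fun2
    \<Rightarrow> ('o, 'a, 'a \<times> 'a \<times> ('o, 'a) homotopy list set, 'p, 'b, 'd) fun2" where
  "Ho_ext A \<Sigma> D F = \<lparr>FObj = FObj F, FArr = FArr F,
     FCell = (\<lambda>c\<in>Cell (Ho A \<Sigma>). hat_hseq D F (SOME Hs. Hs \<in> snd (snd c)))\<rparr>"

section \<open>Operations of the homotopy 2-category on representatives\<close>

context relative_category
begin

abbreviation "cell \<equiv> Ho_cell A \<Sigma>"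

lemma Ho_cell_in: "is_hseq A \<Sigma> f g Hs \<Longrightarrow> cell f g Hs \<in> Cell (Ho A \<Sigma>)"
  by (auto simp: Ho_def Ho_cell_def)

lemma Ho_cellE:
  assumes "c \<in> Cell (Ho A \<Sigma>)"
  obtains f g Hs where "c = cell f g Hs" "is_hseq A \<Sigma> f g Hs"
  using assms by (auto simp: Ho_def Ho_cell_def)

lemma Ho_cell_boundary: "Src (Ho A \<Sigma>) (cell f g Hs) = f" "Trg (Ho A \<Sigma>) (cell f g Hs) = g"
  by (simp_all add: Ho_def Ho_cell_def)

lemma hseq_equivI:
  assumes "\<And>(D :: ('a univ, 'a univ, 'a univ) twocat) F. inverting_functor A \<Sigma> D F \<Longrightarrow>
    hat_hseq D F Hs = hat_hseq D F Ks"
  shows "hseq_equiv A \<Sigma> Hs Ks"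
  unfolding hseq_equiv_def
proof (intro allI impI)
  fix D :: "('a univ, 'a univ, 'a univ) twocat" and F
  assume "two_category D" "two_functor (disc A) D F" "inverts F \<Sigma> D"
  then have "inverting_functor A \<Sigma> D F"
    by (simp add: inverting_functor_def inverting_functor_axioms_def relative_category_axioms)
  then show "hat_hseq D F Hs = hat_hseq D F Ks" by (rule assms)
qed

text \<open>Here \<open>D\<close> has arbitrary types, whereas \<open>hseq_equivI\<close> tests only
  targets on \<open>'a univ\<close>. This is what makes \<open>Ho_ext\<close> well behaved for every
  target.\<close>

lemma hseq_equivD:
  assumes "inverting_functor A \<Sigma> D F" "is_hseq A \<Sigma> f g Hs" "is_hseq A \<Sigma> f g Ks" "hseq_equiv A \<Sigma> Hs Ks"
  shows "hat_hseq D F Hs = hat_hseq D F Ks"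
proof -
  interpret I: inverting_functor A \<Sigma> D F by fact
  show ?thesis using hseq_equiv_hat_eq[OF category_axioms Sigma_Arr assms(2-4) I.two_category_axioms
    I.two_functor I.inverts] .
qed

lemma hclass_eq:
  assumes "is_hseq A \<Sigma> f g Hs" "is_hseq A \<Sigma> f g Ks"
  shows "hclass A \<Sigma> f g Hs = hclass A \<Sigma> f g Ks \<longleftrightarrow> hseq_equiv A \<Sigma> Hs Ks"
proof
  have "Ks \<in> hclass A \<Sigma> f g Ks" using assms by (simp add: hclass_def hseq_equiv_def)
  moreover assume "hclass A \<Sigma> f g Hs = hclass A \<Sigma> f g Ks"
  ultimately show "hseq_equiv A \<Sigma> Hs Ks" by (auto simp: hclass_def)
qed (auto simp: hclass_def hseq_equiv_def)

text \<open>The unions in the definition of \<open>Ho\<close> run over nonempty families. If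
  \<open>op\<close> respects equivalence, all members are the same class, and the union collapses to
  it.\<close>

lemma hclass_UN:
  assumes "\<And>Ks' Hs'. \<lbrakk>Ks' \<in> hclass A \<Sigma> g g' Ks; Hs' \<in> hclass A \<Sigma> f f' Hs\<rbrakk> \<Longrightarrow>
      is_hseq A \<Sigma> k k' (op Ks' Hs') \<and> hseq_equiv A \<Sigma> (op Ks' Hs') (op Ks Hs)"
    and "is_hseq A \<Sigma> g g' Ks" "is_hseq A \<Sigma> f f' Hs"
  shows "(\<Union>Ks'\<in>hclass A \<Sigma> g g' Ks. \<Union>Hs'\<in>hclass A \<Sigma> f f' Hs. hclass A \<Sigma> k k' (op Ks' Hs')) =
    hclass A \<Sigma> k k' (op Ks Hs)"
proof -
  have 1: "Ks \<in> hclass A \<Sigma> g g' Ks" "Hs \<in> hclass A \<Sigma> f f' Hs"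
    using assms(2,3) by (simp_all add: hclass_def hseq_equiv_def)
  have "hclass A \<Sigma> k k' (op Ks' Hs') = hclass A \<Sigma> k k' (op Ks Hs)"
    if "Ks' \<in> hclass A \<Sigma> g g' Ks" "Hs' \<in> hclass A \<Sigma> f f' Hs" for Ks' Hs'
    using hclass_eq[of k k' "op Ks' Hs'" "op Ks Hs"] assms(1)[OF that] assms(1)[OF 1] by simp
  then have "(\<Union>Ks'\<in>hclass A \<Sigma> g g' Ks. \<Union>Hs'\<in>hclass A \<Sigma> f f' Hs. hclass A \<Sigma> k k' (op Ks' Hs')) =
      (\<Union>Ks'\<in>hclass A \<Sigma> g g' Ks. \<Union>Hs'\<in>hclass A \<Sigma> f f' Hs. hclass A \<Sigma> k k' (op Ks Hs))"
    by (intro SUP_cong refl)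
  also have "\<dots> = hclass A \<Sigma> k k' (op Ks Hs)" using 1 by auto
  finally show ?thesis .
qed

lemma hclassD:
  assumes "Hs' \<in> hclass A \<Sigma> f g Hs" "is_hseq A \<Sigma> f g Hs"
  shows "is_hseq A \<Sigma> f g Hs'" "inverting_functor A \<Sigma> D F \<Longrightarrow> hat_hseq D F Hs' = hat_hseq D F Hs"
  using assms hseq_equivD[of D F f g Hs Hs'] by (auto simp: hclass_def)

lemma Ho_vcomp:
  assumes H: "is_hseq A \<Sigma> f g Hs" and K: "is_hseq A \<Sigma> g k Ks"
  shows "cell g k Ks \<bullet>\<^bsub>Ho A \<Sigma>\<^esub> cell f g Hs = cell f k (Ks @ Hs)"
proof -
  have "(\<Union>Ks'\<in>hclass A \<Sigma> g k Ks. \<Union>Hs'\<in>hclass A \<Sigma> f g Hs. hclass A \<Sigma> f k (Ks' @ Hs')) =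
      hclass A \<Sigma> f k (Ks @ Hs)"
  proof (rule hclass_UN[OF _ K H, of _ _ "(@)"])
    fix Ks' Hs' assume *: "Ks' \<in> hclass A \<Sigma> g k Ks" "Hs' \<in> hclass A \<Sigma> f g Hs"
    note c = hclassD[OF *(1) K] hclassD[OF *(2) H]
    \<comment> \<open>Independence of the representatives is tested on images, where concatenation
      becomes vertical composition.\<close>
    have "hseq_equiv A \<Sigma> (Ks' @ Hs') (Ks @ Hs)"
    proof (rule hseq_equivI)
      fix D F assume i: "inverting_functor A \<Sigma> (D :: ('a univ, 'a univ, 'a univ) twocat) F"
      then show "hat_hseq D F (Ks' @ Hs') = hat_hseq D F (Ks @ Hs)"
        using c(2,4)[OF i] H K c(1,3) inverting_functor.hat_hseq_append by metis
    qed
    then show "is_hseq A \<Sigma> f k (Ks' @ Hs') \<and> hseq_equiv A \<Sigma> (Ks' @ Hs') (Ks @ Hs)"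
      using hseq_append c by blast
  qed
  then show ?thesis by (simp add: Ho_def Ho_cell_def)
qed

lemma Ho_hcomp:
  assumes H: "is_hseq A \<Sigma> f f' Hs" and K: "is_hseq A \<Sigma> g g' Ks" and m: "Dom A g = Cod A f"
  shows "cell g g' Ks \<star>\<^bsub>Ho A \<Sigma>\<^esub> cell f f' Hs =
    cell (g \<cdot> f) (g' \<cdot> f') (map (\<lambda>K. rwhisker A K f') Ks @ map (lwhisker A g) Hs)"
proof -
  define op where "op = (\<lambda>Ks Hs. map (\<lambda>K. rwhisker A K f') Ks @ map (lwhisker A g) Hs)"
  have "(\<Union>Ks'\<in>hclass A \<Sigma> g g' Ks. \<Union>Hs'\<in>hclass A \<Sigma> f f' Hs. hclass A \<Sigma> (g \<cdot> f) (g' \<cdot> f') (op Ks' Hs')) =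
      hclass A \<Sigma> (g \<cdot> f) (g' \<cdot> f') (op Ks Hs)"
  proof (rule hclass_UN[OF _ K H, of _ _ op])
    fix Ks' Hs' assume *: "Ks' \<in> hclass A \<Sigma> g g' Ks" "Hs' \<in> hclass A \<Sigma> f f' Hs"
    note c = hclassD[OF *(1) K] hclassD[OF *(2) H]
    have "hseq_equiv A \<Sigma> (op Ks' Hs') (op Ks Hs)"
    proof (rule hseq_equivI)
      fix D F assume i: "inverting_functor A \<Sigma> (D :: ('a univ, 'a univ, 'a univ) twocat) F"
      then show "hat_hseq D F (op Ks' Hs') = hat_hseq D F (op Ks Hs)"
        using c(2,4)[OF i] H K m c(1,3) inverting_functor.hat_hcomp[OF i] unfolding op_def by metis
    qed
    then show "is_hseq A \<Sigma> (g \<cdot> f) (g' \<cdot> f') (op Ks' Hs') \<and> hseq_equiv A \<Sigma> (op Ks' Hs') (op Ks Hs)"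
      using hcomp_hseq[OF c(3,1) m] unfolding op_def by blast
  qed
  then show ?thesis by (simp add: Ho_def Ho_cell_def op_def)
qed

lemma Ho_IdC: "IdC (Ho A \<Sigma>) f = cell f f [id_htpy A f]"
  by (simp add: Ho_def Ho_cell_def)

lemma Ho_cell_simps:
  "c \<in> Cell (Ho A \<Sigma>) \<Longrightarrow> Src (Ho A \<Sigma>) c \<in> Arr A" "c \<in> Cell (Ho A \<Sigma>) \<Longrightarrow> Trg (Ho A \<Sigma>) c \<in> Arr A"
  "c \<in> Cell (Ho A \<Sigma>) \<Longrightarrow> Dom A (Trg (Ho A \<Sigma>) c) = Dom A (Src (Ho A \<Sigma>) c)"
  "c \<in> Cell (Ho A \<Sigma>) \<Longrightarrow> Cod A (Trg (Ho A \<Sigma>) c) = Cod A (Src (Ho A \<Sigma>) c)"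
  "f \<in> Arr A \<Longrightarrow> IdC (Ho A \<Sigma>) f \<in> Cell (Ho A \<Sigma>)"
  "Src (Ho A \<Sigma>) (IdC (Ho A \<Sigma>) f) = f" "Trg (Ho A \<Sigma>) (IdC (Ho A \<Sigma>) f) = f"
  by (auto elim!: Ho_cellE simp: Ho_cell_boundary hseqD Ho_IdC Ho_cell_in id_htpy_hseq)

lemma Ho_vcomp_simps:
  assumes "c \<in> Cell (Ho A \<Sigma>)" "d \<in> Cell (Ho A \<Sigma>)" "Src (Ho A \<Sigma>) d = Trg (Ho A \<Sigma>) c"
  shows "d \<bullet>\<^bsub>Ho A \<Sigma>\<^esub> c \<in> Cell (Ho A \<Sigma>)" "Src (Ho A \<Sigma>) (d \<bullet>\<^bsub>Ho A \<Sigma>\<^esub> c) = Src (Ho A \<Sigma>) c"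
    "Trg (Ho A \<Sigma>) (d \<bullet>\<^bsub>Ho A \<Sigma>\<^esub> c) = Trg (Ho A \<Sigma>) d"
  using assms by (auto elim!: Ho_cellE simp: Ho_cell_boundary Ho_vcomp Ho_cell_in hseq_append)

lemma Ho_hcomp_simps:
  assumes "c \<in> Cell (Ho A \<Sigma>)" "d \<in> Cell (Ho A \<Sigma>)" "Dom A (Src (Ho A \<Sigma>) d) = Cod A (Src (Ho A \<Sigma>) c)"
  shows "d \<star>\<^bsub>Ho A \<Sigma>\<^esub> c \<in> Cell (Ho A \<Sigma>)"
    "Src (Ho A \<Sigma>) (d \<star>\<^bsub>Ho A \<Sigma>\<^esub> c) = Src (Ho A \<Sigma>) d \<cdot> Src (Ho A \<Sigma>) c"
    "Trg (Ho A \<Sigma>) (d \<star>\<^bsub>Ho A \<Sigma>\<^esub> c) = Trg (Ho A \<Sigma>) d \<cdot> Trg (Ho A \<Sigma>) c"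
  using assms by (auto elim!: Ho_cellE simp: Ho_cell_boundary Ho_hcomp Ho_cell_in hcomp_hseq)

end

context inverting_functor
begin

abbreviation "E \<equiv> Ho_ext A \<Sigma> D F"

text \<open>The representative selected by \<open>SOME\<close> is arbitrary, but it lies in the
  class of \<open>Hs\<close>, on which the image is constant.\<close>

lemma Ho_ext_cell:
  assumes H: "is_hseq A \<Sigma> f g Hs"
  shows "FCell E (A.cell f g Hs) = hat_hseq D F Hs"
proof -
  have "Hs \<in> hclass A \<Sigma> f g Hs" using H by (simp add: hclass_def hseq_equiv_def)
  then have "(SOME Hs'. Hs' \<in> hclass A \<Sigma> f g Hs) \<in> hclass A \<Sigma> f g Hs" by (rule someI)
  from A.hclassD(2)[OF this H inverting_functor_axioms] A.Ho_cell_in[OF H] show ?thesis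
    by (simp add: Ho_ext_def Ho_cell_def)
qed

lemma Ho_ext_simps:
  "FObj E = FObj F" "FArr E = FArr F"
  "c \<in> Cell (Ho A \<Sigma>) \<Longrightarrow> FCell E c \<in> Cell D"
  "c \<in> Cell (Ho A \<Sigma>) \<Longrightarrow> Src D (FCell E c) = FArr F (Src (Ho A \<Sigma>) c)"
  "c \<in> Cell (Ho A \<Sigma>) \<Longrightarrow> Trg D (FCell E c) = FArr F (Trg (Ho A \<Sigma>) c)"
  "f \<in> Arr A \<Longrightarrow> FCell E (IdC (Ho A \<Sigma>) f) = IdC D (FArr F f)"
  "\<lbrakk>c \<in> Cell (Ho A \<Sigma>); d \<in> Cell (Ho A \<Sigma>); Src (Ho A \<Sigma>) d = Trg (Ho A \<Sigma>) c\<rbrakk> \<Longrightarrow>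
    FCell E (d \<bullet>\<^bsub>Ho A \<Sigma>\<^esub> c) = FCell E d \<bullet> FCell E c"
  "\<lbrakk>c \<in> Cell (Ho A \<Sigma>); d \<in> Cell (Ho A \<Sigma>); Dom A (Src (Ho A \<Sigma>) d) = Cod A (Src (Ho A \<Sigma>) c)\<rbrakk> \<Longrightarrow>
    FCell E (d \<star>\<^bsub>Ho A \<Sigma>\<^esub> c) = FCell E d \<star> FCell E c"
  by (simp_all add: Ho_ext_def[of A \<Sigma> D F, THEN arg_cong[of _ _ FObj]]
      Ho_ext_def[of A \<Sigma> D F, THEN arg_cong[of _ _ FArr]])
    (auto elim!: A.Ho_cellE simp: Ho_ext_cell A.Ho_cell_boundary hat_hseq_simps A.Ho_IdC A.id_htpy_hseq
      hat_id_htpy A.Ho_vcomp A.Ho_hcomp A.hseq_append hat_hseq_append A.hcomp_hseq hat_hcomp)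

lemma Ho_ext_two_functor: "two_functor (Ho A \<Sigma>) D E"
  using two_functor_extensional[OF two_functor]
  by (auto simp: two_functor_def is_functor_def hom_def hom2_def Ho_simps Ho_ext_simps F_simps)
    (simp add: Ho_ext_def)

end

context relative_category
begin

lemma Ho_cell_eqI:
  assumes "c \<in> Cell (Ho A \<Sigma>)" "d \<in> Cell (Ho A \<Sigma>)" "Src (Ho A \<Sigma>) c = Src (Ho A \<Sigma>) d"
    "Trg (Ho A \<Sigma>) c = Trg (Ho A \<Sigma>) d"
    and "\<And>(D :: ('a univ, 'a univ, 'a univ) twocat) F. inverting_functor A \<Sigma> D F \<Longrightarrow>
      FCell (Ho_ext A \<Sigma> D F) c = FCell (Ho_ext A \<Sigma> D F) d"
  shows "c = d"
proof -
  obtain f g Hs where c: "c = cell f g Hs" "is_hseq A \<Sigma> f g Hs" using assms(1) by (rule Ho_cellE)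
  obtain f' g' Ks where d: "d = cell f' g' Ks" "is_hseq A \<Sigma> f' g' Ks" using assms(2) by (rule Ho_cellE)
  have e: "f' = f" "g' = g" using assms(3,4) c d by (simp_all add: Ho_cell_boundary)
  have "hseq_equiv A \<Sigma> Hs Ks"
    by (rule hseq_equivI) (use assms(5) c d e inverting_functor.Ho_ext_cell in metis)
  then show ?thesis using c d hclass_eq[of f g Hs Ks] by (simp add: e Ho_cell_def)
qed

lemma Ho_two_category: "two_category (Ho A \<Sigma>)"
proof -
  note s = Ho_simps Ho_cell_simps Ho_vcomp_simps Ho_hcomp_simps arr_simps
  interpret Ho: category "Ho A \<Sigma>" by standard (auto simp: hom_def s)
  \<comment> \<open>The premise \<open>two_category D\<close> is made explicit because the facts in
    \<open>t\<close> are used outside their locales and carry it as a condition.\<close>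
  have eq: "c = d" if "c \<in> Cell (Ho A \<Sigma>)" "d \<in> Cell (Ho A \<Sigma>)" "Src (Ho A \<Sigma>) c = Src (Ho A \<Sigma>) d"
    "Trg (Ho A \<Sigma>) c = Trg (Ho A \<Sigma>) d"
    "\<And>(D :: ('a univ, 'a univ, 'a univ) twocat) F. \<lbrakk>inverting_functor A \<Sigma> D F; two_category D\<rbrakk> \<Longrightarrow>
      FCell (Ho_ext A \<Sigma> D F) c = FCell (Ho_ext A \<Sigma> D F) d" for c d
    by (rule Ho_cell_eqI[OF that(1-4)]) (use that(5) inverting_functor.axioms(2) in blast)
  note t = two_category.cell_simps two_category.interchange_cell inverting_functor.Ho_ext_simps
    inverting_functor.F_simps
  show ?thesis
  proof
    show "\<alpha> \<in> Cell (Ho A \<Sigma>) \<Longrightarrow> \<alpha> \<bullet>\<^bsub>Ho A \<Sigma>\<^esub> IdC (Ho A \<Sigma>) (Src (Ho A \<Sigma>) \<alpha>) = \<alpha>"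
      "\<alpha> \<in> Cell (Ho A \<Sigma>) \<Longrightarrow> IdC (Ho A \<Sigma>) (Trg (Ho A \<Sigma>) \<alpha>) \<bullet>\<^bsub>Ho A \<Sigma>\<^esub> \<alpha> = \<alpha>"
      "\<alpha> \<in> Cell (Ho A \<Sigma>) \<Longrightarrow>
        \<alpha> \<star>\<^bsub>Ho A \<Sigma>\<^esub> IdC (Ho A \<Sigma>) (Ide (Ho A \<Sigma>) (Dom (Ho A \<Sigma>) (Src (Ho A \<Sigma>) \<alpha>))) = \<alpha>"
      "\<alpha> \<in> Cell (Ho A \<Sigma>) \<Longrightarrow>
        IdC (Ho A \<Sigma>) (Ide (Ho A \<Sigma>) (Cod (Ho A \<Sigma>) (Src (Ho A \<Sigma>) \<alpha>))) \<star>\<^bsub>Ho A \<Sigma>\<^esub> \<alpha> = \<alpha>" for \<alpha>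
      by (rule eq; simp add: s t)+
    show "(\<gamma> \<bullet>\<^bsub>Ho A \<Sigma>\<^esub> \<beta>) \<bullet>\<^bsub>Ho A \<Sigma>\<^esub> \<alpha> = \<gamma> \<bullet>\<^bsub>Ho A \<Sigma>\<^esub> (\<beta> \<bullet>\<^bsub>Ho A \<Sigma>\<^esub> \<alpha>)"
      if "\<alpha> \<in> hom2 (Ho A \<Sigma>) f g" "\<beta> \<in> hom2 (Ho A \<Sigma>) g h" "\<gamma> \<in> hom2 (Ho A \<Sigma>) h k" for \<alpha> \<beta> \<gamma> f g h k
      by (rule eq; use that in \<open>simp add: s t hom2_def\<close>)
    show "(\<gamma> \<star>\<^bsub>Ho A \<Sigma>\<^esub> \<beta>) \<star>\<^bsub>Ho A \<Sigma>\<^esub> \<alpha> = \<gamma> \<star>\<^bsub>Ho A \<Sigma>\<^esub> (\<beta> \<star>\<^bsub>Ho A \<Sigma>\<^esub> \<alpha>)"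
      if "\<alpha> \<in> hom2 (Ho A \<Sigma>) f f'" "\<beta> \<in> hom2 (Ho A \<Sigma>) g g'" "\<gamma> \<in> hom2 (Ho A \<Sigma>) h h'"
        "Dom (Ho A \<Sigma>) g = Cod (Ho A \<Sigma>) f" "Dom (Ho A \<Sigma>) h = Cod (Ho A \<Sigma>) g" for \<alpha> \<beta> \<gamma> f f' g g' h h'
      by (rule eq; use that in \<open>auto simp: s t hom2_def\<close>)
    show "IdC (Ho A \<Sigma>) g \<star>\<^bsub>Ho A \<Sigma>\<^esub> IdC (Ho A \<Sigma>) f = IdC (Ho A \<Sigma>) (g \<cdot>\<^bsub>Ho A \<Sigma>\<^esub> f)"
      if "f \<in> hom (Ho A \<Sigma>) X Y" "g \<in> hom (Ho A \<Sigma>) Y Z" for f g X Y Z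
      by (rule eq; use that in \<open>simp add: s t hom_def\<close>)
    show "(\<beta>' \<bullet>\<^bsub>Ho A \<Sigma>\<^esub> \<beta>) \<star>\<^bsub>Ho A \<Sigma>\<^esub> (\<alpha>' \<bullet>\<^bsub>Ho A \<Sigma>\<^esub> \<alpha>) =
        (\<beta>' \<star>\<^bsub>Ho A \<Sigma>\<^esub> \<alpha>') \<bullet>\<^bsub>Ho A \<Sigma>\<^esub> (\<beta> \<star>\<^bsub>Ho A \<Sigma>\<^esub> \<alpha>)"
      if "\<alpha> \<in> hom2 (Ho A \<Sigma>) f f'" "\<alpha>' \<in> hom2 (Ho A \<Sigma>) f' f''" "\<beta> \<in> hom2 (Ho A \<Sigma>) g g'"
        "\<beta>' \<in> hom2 (Ho A \<Sigma>) g' g''" "Dom (Ho A \<Sigma>) g = Cod (Ho A \<Sigma>) f" for \<alpha> \<alpha>' \<beta> \<beta>' f f' f'' g g' g''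
      by (rule eq; use that in \<open>auto simp: s t hom2_def\<close>)
  qed (auto simp: s hom_def hom2_def)
qed

sublocale Ho: two_category "Ho A \<Sigma>" by (rule Ho_two_category)

lemma Ho_incl_simps:
  "X \<in> Obj A \<Longrightarrow> FObj (Ho_incl A \<Sigma>) X = X" "f \<in> Arr A \<Longrightarrow> FArr (Ho_incl A \<Sigma>) f = f"
  "f \<in> Arr A \<Longrightarrow> FCell (Ho_incl A \<Sigma>) f = IdC (Ho A \<Sigma>) f"
  by (simp_all add: Ho_incl_def)

lemma Ho_incl_two_functor: "two_functor (disc A) (Ho A \<Sigma>) (Ho_incl A \<Sigma>)"
  by (auto simp: two_functor_def is_functor_def hom_def hom2_def Ho_simps Ho_incl_simps arr_simps
      Ho.cell_simps[unfolded Ho_simps])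
    (simp_all add: Ho_incl_def)

end

section \<open>The universal property\<close>

lemma (in two_category) invertible_cancel:
  assumes "invertible D c" "c \<bullet> a = c \<bullet> b" "a \<in> Cell D" "b \<in> Cell D" "Trg D a = Src D c" "Trg D b = Src D c"
  shows "a = b"
proof -
  obtain d where d: "c \<in> Cell D" "d \<in> Cell D" "Src D d = Trg D c" "Trg D d = Src D c"
    "d \<bullet> c = IdC D (Src D c)"
    using assms(1) by (rule invertibleE)
  have "(d \<bullet> c) \<bullet> a = (d \<bullet> c) \<bullet> b"
    using assms d(1-4) by (simp add: cell_simps)
  then show ?thesis using assms d by (simp add: cell_simps)
qed

section \<open>Naturality of pseudonatural transformations with respect to images of
  homotopies\<close>

context inverting_functor
begin

text \<open>Write \<open_none>G for the codomain of \<theta> and \<open>s\<close> for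
  \<open>cyl_s K\<close>. Whiskering either side with the image of \<open>s\<close> under
  \<open>G\<close> and composing with the structure 2-cell of \<theta> at \<open>s\<close>,
  whiskered by \<open>F\<close> of \<open>cyl_d1 K\<close>, yields \<theta> at
  \<open>cyl_x K\<close>. Both operations can be cancelled.\<close>

lemma hat_cyl_natural:
  assumes \<theta>: "pseudonatural (disc A) D \<theta>" and d: "TDom \<theta> = F"
    and G: "inverting_functor A \<Sigma> D G" "TCod \<theta> = G" and K: "is_cylinder A \<Sigma> X K"
  shows "TArr \<theta> (cyl_d1 K) \<bullet> (hat_cyl D G K \<star> IdC D (TObj \<theta> X)) =
    (IdC D (TObj \<theta> (cylW K)) \<star> hat_cyl D F K) \<bullet> TArr \<theta> (cyl_d0 K)"
    (is "?l = ?r")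
proof -
  interpret G: inverting_functor A \<Sigma> D G by fact
  note t = pseudonaturalD[OF \<theta>, unfolded d G(2) disc_simps]
  note k = A.cylinderD[OF K]
  note e = hat_cyl_simps[OF K] and e' = G.hat_cyl_simps[OF K]
  note s = t(5-12) F_simps G.F_simps A.arr_simps whisker_simps
  have x: "FArr G (cyl_s K) \<cdot> FArr G (cyl_d0 K) = FArr G (cyl_x K)"
    "FArr G (cyl_s K) \<cdot> FArr G (cyl_d1 K) = FArr G (cyl_x K)"
    "FArr F (cyl_s K) \<cdot> FArr F (cyl_d0 K) = FArr F (cyl_x K)"
    "FArr F (cyl_s K) \<cdot> FArr F (cyl_d1 K) = FArr F (cyl_x K)"
    using k F_simps(6) G.F_simps(6) by metis+
  have lr: "?l \<in> Cell D" "?r \<in> Cell D"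
    "Src D ?l = FArr G (cyl_d0 K) \<cdot> TObj \<theta> X" "Trg D ?l = TObj \<theta> (cylW K) \<cdot> FArr F (cyl_d1 K)"
    "Src D ?r = FArr G (cyl_d0 K) \<cdot> TObj \<theta> X" "Trg D ?r = TObj \<theta> (cylW K) \<cdot> FArr F (cyl_d1 K)"
    using k e e' by (simp_all add: s)
  \<comment> \<open>The arrow \<open>cyl_x K\<close> factors through both ends of the cylinder, so
    the composition axiom gives two expressions for \<theta> at it, one for each side of the
    claim.\<close>
  have cx: "TArr \<theta> (cyl_x K) =
      (TArr \<theta> (cyl_s K) \<star> IdC D (FArr F (cyl_d0 K))) \<bullet> (IdC D (FArr G (cyl_s K)) \<star> TArr \<theta> (cyl_d0 K))"
    "TArr \<theta> (cyl_x K) =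
      (TArr \<theta> (cyl_s K) \<star> IdC D (FArr F (cyl_d1 K))) \<bullet> (IdC D (FArr G (cyl_s K)) \<star> TArr \<theta> (cyl_d1 K))"
    using t(13)[of "cyl_d0 K" "cyl_s K"] t(13)[of "cyl_d1 K" "cyl_s K"] k by simp_all
  have y: "FArr G (cyl_s K) \<cdot> (FArr G (cyl_d1 K) \<cdot> TObj \<theta> X) = FArr G (cyl_x K) \<cdot> TObj \<theta> X"
    using k by (simp add: s flip: x(2))
  have "IdC D (FArr G (cyl_s K)) \<star> (hat_cyl D G K \<star> IdC D (TObj \<theta> X)) =
      (IdC D (FArr G (cyl_s K)) \<star> hat_cyl D G K) \<star> IdC D (TObj \<theta> X)"
    using k e'(1-3) by (simp add: s)
  also have "\<dots> = IdC D (FArr G (cyl_x K) \<cdot> TObj \<theta> X)"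
    unfolding e'(4) using k by (simp add: s)
  finally have "IdC D (FArr G (cyl_s K)) \<star> ?l = IdC D (FArr G (cyl_s K)) \<star> TArr \<theta> (cyl_d1 K)"
    using k e'(1-3) y by (simp add: s)
  then have L: "(TArr \<theta> (cyl_s K) \<star> IdC D (FArr F (cyl_d1 K))) \<bullet> (IdC D (FArr G (cyl_s K)) \<star> ?l) =
      TArr \<theta> (cyl_x K)"
    by (simp add: cx(2))
  \<comment> \<open>Exchange carries the hat 2-cell across \<theta> at \<open>cyl_s K\<close>; on
    the other side it is whiskered with the image of \<open>cyl_s K\<close> and becomes an
    identity.\<close>
  have 1: "(TArr \<theta> (cyl_s K) \<star> IdC D (FArr F (cyl_d1 K))) \<bullet>
        (IdC D (FArr G (cyl_s K) \<cdot> TObj \<theta> (cylW K)) \<star> hat_cyl D F K) =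
      (IdC D (TObj \<theta> (cylZ K)) \<star> (IdC D (FArr F (cyl_s K)) \<star> hat_cyl D F K)) \<bullet>
        (TArr \<theta> (cyl_s K) \<star> IdC D (FArr F (cyl_d0 K)))"
    using k e(1-3) hcomp_exchange[of "hat_cyl D F K" "TArr \<theta> (cyl_s K)"] by (simp add: s)
  also have "\<dots> = TArr \<theta> (cyl_s K) \<star> IdC D (FArr F (cyl_d0 K))"
    using k e x by (simp add: s)
  finally have 1: "(TArr \<theta> (cyl_s K) \<star> IdC D (FArr F (cyl_d1 K))) \<bullet>
        (IdC D (FArr G (cyl_s K) \<cdot> TObj \<theta> (cylW K)) \<star> hat_cyl D F K) =
      TArr \<theta> (cyl_s K) \<star> IdC D (FArr F (cyl_d0 K))" .
  have "(TArr \<theta> (cyl_s K) \<star> IdC D (FArr F (cyl_d1 K))) \<bullet> (IdC D (FArr G (cyl_s K)) \<star> ?r) =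
      ((TArr \<theta> (cyl_s K) \<star> IdC D (FArr F (cyl_d1 K))) \<bullet>
        (IdC D (FArr G (cyl_s K) \<cdot> TObj \<theta> (cylW K)) \<star> hat_cyl D F K)) \<bullet>
      (IdC D (FArr G (cyl_s K)) \<star> TArr \<theta> (cyl_d0 K))"
    using k e(1-3) by (simp add: s)
  also have "\<dots> = TArr \<theta> (cyl_x K)" unfolding 1 by (simp add: cx(1))
  finally have R: "(TArr \<theta> (cyl_s K) \<star> IdC D (FArr F (cyl_d1 K))) \<bullet> (IdC D (FArr G (cyl_s K)) \<star> ?r) =
      TArr \<theta> (cyl_x K)" .
  \<comment> \<open>The invertible factor is cancelled first. The names \<open>l\<close> and
    \<open>r\<close> hide the two sides from the simplifier, which would otherwise distribute the
    whiskering over them.\<close>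
  have s_eq: "IdC D (FArr G (cyl_s K)) \<star> l = IdC D (FArr G (cyl_s K)) \<star> r" if "l = ?l" "r = ?r" for l r
    by (rule invertible_cancel[of "TArr \<theta> (cyl_s K) \<star> IdC D (FArr F (cyl_d1 K))"])
      (use L R lr[folded that] k in \<open>simp_all add: that[symmetric] s invertible_hcomp invertible_idc\<close>)
  have "equivalence D (FArr G (cyl_s K))" using k G.inverts unfolding inverts_def by blast
  then obtain g \<eta> where "FArr G (cyl_s K) \<in> hom D (Dom D (FArr G (cyl_s K))) (Cod D (FArr G (cyl_s K)))"
    "g \<in> hom D (Cod D (FArr G (cyl_s K))) (Dom D (FArr G (cyl_s K)))"
    "\<eta> \<in> hom2 D (Ide D (Dom D (FArr G (cyl_s K)))) (g \<cdot> FArr G (cyl_s K))" "invertible D \<eta>"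
    unfolding equivalence_def hom_def by auto
  from whisker_faithful[OF this _ _ _ s_eq[OF refl refl]] show ?thesis
    using lr k by (simp add: hom2_def s)
qed

text \<open>The square of the cylinder, whiskered with \<open>G\<close> of \<open>hmap H\<close>, is
  pasted with the exchange of the hat 2-cell and \<theta> at \<open>hmap H\<close>; the composition
  axiom assembles the structure 2-cells at \<open>f\<close> and \<open>g\<close>.\<close>

lemma hat_htpy_natural:
  assumes \<theta>: "pseudonatural (disc A) D \<theta>" and d: "TDom \<theta> = F"
    and G: "inverting_functor A \<Sigma> D G" "TCod \<theta> = G" and H: "is_homotopy A \<Sigma> f g H"
  shows "TArr \<theta> g \<bullet> (hat_htpy D G H \<star> IdC D (TObj \<theta> (Dom A f))) =
    (IdC D (TObj \<theta> (Cod A f)) \<star> hat_htpy D F H) \<bullet> TArr \<theta> f"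
proof -
  interpret G: inverting_functor A \<Sigma> D G by fact
  note t = pseudonaturalD[OF \<theta>, unfolded d G(2) disc_simps]
  define K h X W Y where defs: "K = hcyl H" "h = hmap H" "X = Dom A f" "W = cylW (hcyl H)" "Y = Cod A f"
  note hh = A.homotopyD[OF H, folded defs] and k = A.cylinderD[OF A.homotopyD(5)[OF H], folded defs]
  have Y: "Y \<in> Obj A" using hh(8) A.cod_closed[OF hh(6)] by simp
  note e = hat_cyl_simps[OF A.homotopyD(5)[OF H], folded defs]
    and e' = G.hat_cyl_simps[OF A.homotopyD(5)[OF H], folded defs]
  note s = t(5-12) F_simps G.F_simps A.arr_simps whisker_simps
  have tf: "TArr \<theta> f = (TArr \<theta> h \<star> IdC D (FArr F (cyl_d0 K))) \<bullet> (IdC D (FArr G h) \<star> TArr \<theta> (cyl_d0 K))"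
    "TArr \<theta> g = (TArr \<theta> h \<star> IdC D (FArr F (cyl_d1 K))) \<bullet> (IdC D (FArr G h) \<star> TArr \<theta> (cyl_d1 K))"
    using t(13)[of "cyl_d0 K" h] t(13)[of "cyl_d1 K" h] k hh by simp_all
  have 1: "(IdC D (FArr G h) \<star> TArr \<theta> (cyl_d1 K)) \<bullet>
        (IdC D (FArr G h) \<star> (hat_cyl D G K \<star> IdC D (TObj \<theta> X))) =
      (IdC D (FArr G h \<cdot> TObj \<theta> W) \<star> hat_cyl D F K) \<bullet> (IdC D (FArr G h) \<star> TArr \<theta> (cyl_d0 K))"
    using arg_cong[OF hat_cyl_natural[OF \<theta> d G A.homotopyD(5)[OF H], folded defs],
        of "\<lambda>c. IdC D (FArr G h) \<star> c"] k Y hh(1-8) e(1-3) e'(1-3)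
    by (simp add: s)
  have 2: "(TArr \<theta> h \<star> IdC D (FArr F (cyl_d1 K))) \<bullet> (IdC D (FArr G h \<cdot> TObj \<theta> W) \<star> hat_cyl D F K) =
      (IdC D (TObj \<theta> Y) \<star> (IdC D (FArr F h) \<star> hat_cyl D F K)) \<bullet> (TArr \<theta> h \<star> IdC D (FArr F (cyl_d0 K)))"
    using hcomp_exchange[of "hat_cyl D F K" "TArr \<theta> h"] k Y hh(1-8) e(1-3) by (simp add: s)
  have "TArr \<theta> g \<bullet> (hat_htpy D G H \<star> IdC D (TObj \<theta> X)) =
      (TArr \<theta> h \<star> IdC D (FArr F (cyl_d1 K))) \<bullet> ((IdC D (FArr G h) \<star> TArr \<theta> (cyl_d1 K)) \<bullet>
        (IdC D (FArr G h) \<star> (hat_cyl D G K \<star> IdC D (TObj \<theta> X))))"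
    unfolding tf hat_htpy_def defs(1,2)[symmetric] using k Y hh(1-8) e'(1-3) by (simp add: s)
  also have "\<dots> = ((TArr \<theta> h \<star> IdC D (FArr F (cyl_d1 K))) \<bullet>
      (IdC D (FArr G h \<cdot> TObj \<theta> W) \<star> hat_cyl D F K)) \<bullet> (IdC D (FArr G h) \<star> TArr \<theta> (cyl_d0 K))"
    unfolding 1 using k Y hh(1-8) e(1-3) by (simp add: s)
  also have "\<dots> = (IdC D (TObj \<theta> Y) \<star> hat_htpy D F H) \<bullet> TArr \<theta> f"
    unfolding 2 tf hat_htpy_def defs(1,2)[symmetric] using k Y hh(1-8) e(1-3) by (simp add: s)
  finally show ?thesis unfolding defs .
qed

lemma hat_hseq_natural:
  assumes \<theta>: "pseudonatural (disc A) D \<theta>" and d: "TDom \<theta> = F"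
    and G: "inverting_functor A \<Sigma> D G" "TCod \<theta> = G" and H: "is_hseq A \<Sigma> f g Hs"
  shows "TArr \<theta> g \<bullet> (hat_hseq D G Hs \<star> IdC D (TObj \<theta> (Dom A f))) =
    (IdC D (TObj \<theta> (Cod A f)) \<star> hat_hseq D F Hs) \<bullet> TArr \<theta> f"
  using H
proof induction
  case (single f g H)
  then show ?case using hat_htpy_natural[OF assms(1-4)] by simp
next
  case (step f g Hs k H)
  interpret G: inverting_functor A \<Sigma> D G by fact
  note t = pseudonaturalD[OF \<theta>, unfolded d G(2) disc_simps]
  note h = A.hseqD[OF step(1)] A.homotopyD(1-4)[OF step(2)]
  note s = t(5-12) F_simps G.F_simps A.arr_simps whisker_simps hat_hseq_Cons G.hat_hseq_Cons
    hat_htpy_simps[OF step(2)] G.hat_htpy_simps[OF step(2)] hat_hseq_simps[OF step(1)]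
    G.hat_hseq_simps[OF step(1)]
  have 1: "TArr \<theta> k \<bullet> (hat_htpy D G H \<star> IdC D (TObj \<theta> (Dom A f))) =
      (IdC D (TObj \<theta> (Cod A f)) \<star> hat_htpy D F H) \<bullet> TArr \<theta> g"
    using hat_htpy_natural[OF assms(1-4) step(2)] h by simp
  show ?case
    using vcomp_tail[OF 1, of "hat_hseq D G Hs \<star> IdC D (TObj \<theta> (Dom A f))"] step(3) h
    by (simp add: s)
qed

end

section \<open>Cylinder 2-cells as generators of the homotopy 2-category\<close>

context relative_category
begin

abbreviation "i \<equiv> Ho_incl A \<Sigma>"

text \<open>The 2-cell \<open>[(K, id)]\<close> of the homotopy 2-category plays the role of \<open>hat_cyl\<close>: whiskered with
  \<open>cyl_s K\<close> it becomes an identity.\<close>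

definition cyl_cell :: "('o, 'a) cylinder \<Rightarrow> 'a \<times> 'a \<times> ('o, 'a) homotopy list set" where
  "cyl_cell K = cell (cyl_d0 K) (cyl_d1 K) [\<lparr>hcyl = K, hmap = Ide A (cylW K)\<rparr>]"

lemma cyl_cell_hseq:
  "is_cylinder A \<Sigma> X K \<Longrightarrow>
    is_hseq A \<Sigma> (cyl_d0 K) (cyl_d1 K) [\<lparr>hcyl = K, hmap = Ide A (cylW K)\<rparr>]"
  by (rule is_hseq.single) (use cylinderD[of X K] in \<open>simp add: is_homotopy_def hom_def arr_simps\<close>)

lemma cyl_cell_simps:
  assumes "is_cylinder A \<Sigma> X K"
  shows "cyl_cell K \<in> Cell (Ho A \<Sigma>)" "Src (Ho A \<Sigma>) (cyl_cell K) = cyl_d0 K"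
    "Trg (Ho A \<Sigma>) (cyl_cell K) = cyl_d1 K"
  unfolding cyl_cell_def using cyl_cell_hseq[OF assms] by (simp_all add: Ho_cell_in Ho_cell_boundary)

lemma Ho_ext_cyl_cell:
  assumes K: "is_cylinder A \<Sigma> X K" and F: "inverting_functor A \<Sigma> D F"
  shows "FCell (Ho_ext A \<Sigma> D F) (cyl_cell K) = hat_cyl D F K"
proof -
  interpret I: inverting_functor A \<Sigma> D F by fact
  show ?thesis unfolding cyl_cell_def I.Ho_ext_cell[OF cyl_cell_hseq[OF K]]
    using cylinderD[OF K] I.hat_cyl_simps[OF K] by (simp add: hat_htpy_def I.F_simps I.cell_simps)
qed

text \<open>Under every test 2-functor this becomes the defining equation of \<open>hat_cyl\<close>,
  so it already holds in \<open>Ho\<close>.\<close>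

lemma cyl_cell_s:
  assumes K: "is_cylinder A \<Sigma> X K"
  shows "IdC (Ho A \<Sigma>) (cyl_s K) \<star>\<^bsub>Ho A \<Sigma>\<^esub> cyl_cell K = IdC (Ho A \<Sigma>) (cyl_x K)"
proof (rule Ho_cell_eqI)
  note k = cylinderD[OF K] and c = cyl_cell_simps[OF K]
  fix D :: "('a univ, 'a univ, 'a univ) twocat" and F assume "inverting_functor A \<Sigma> D F"
  then interpret I: inverting_functor A \<Sigma> D F .
  show "FCell (Ho_ext A \<Sigma> D F) (IdC (Ho A \<Sigma>) (cyl_s K) \<star>\<^bsub>Ho A \<Sigma>\<^esub> cyl_cell K) =
      FCell (Ho_ext A \<Sigma> D F) (IdC (Ho A \<Sigma>) (cyl_x K))"
    using k c I.hat_cyl_simps[OF K]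
    by (simp add: I.Ho_ext_simps Ho_ext_cyl_cell[OF K I.inverting_functor_axioms] Ho_cell_simps)
qed (use cylinderD[OF K] cyl_cell_simps[OF K] in
    \<open>simp_all add: Ho_cell_simps Ho_hcomp_simps arr_simps\<close>)

text \<open>Together with \<open>Ho_vcomp\<close> this shows that cylinder 2-cells generate all
  2-cells by left whiskering and vertical composition, so that a 2-functor on \<open>Ho\<close> is
  controlled by its values on them.\<close>

lemma homotopy_cell:
  assumes H: "is_homotopy A \<Sigma> f g H"
  shows "cell f g [H] = IdC (Ho A \<Sigma>) (hmap H) \<star>\<^bsub>Ho A \<Sigma>\<^esub> cyl_cell (hcyl H)"
proof (rule Ho_cell_eqI)
  note h = homotopyD[OF H] and k = cylinderD[OF homotopyD(5)[OF H]]
    and c = cyl_cell_simps[OF homotopyD(5)[OF H]]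
  fix D :: "('a univ, 'a univ, 'a univ) twocat" and F assume "inverting_functor A \<Sigma> D F"
  then interpret I: inverting_functor A \<Sigma> D F .
  show "FCell (Ho_ext A \<Sigma> D F) (cell f g [H]) =
      FCell (Ho_ext A \<Sigma> D F) (IdC (Ho A \<Sigma>) (hmap H) \<star>\<^bsub>Ho A \<Sigma>\<^esub> cyl_cell (hcyl H))"
    unfolding I.Ho_ext_cell[OF is_hseq.single[OF H]] using k c h(6,7)
    by (simp add: I.Ho_ext_simps Ho_ext_cyl_cell[OF h(5) I.inverting_functor_axioms] Ho_cell_simps
        hat_htpy_def)
qed (use homotopyD[OF H] cylinderD[OF homotopyD(5)[OF H]] cyl_cell_simps[OF homotopyD(5)[OF H]]
      is_hseq.single[OF H] in
    \<open>simp_all add: Ho_cell_simps Ho_hcomp_simps arr_simps Ho_cell_in Ho_cell_boundary\<close>)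

end

text \<open>Inverting \<open>\<Sigma>\<close> is not automatic for the homotopy 2-category of an arbitrary pair: it has to be
  established before the universal property.\<close>

locale inverted_relative_category = relative_category +
  assumes inverts_incl: "inverts (Ho_incl A \<Sigma>) \<Sigma> (Ho A \<Sigma>)"

section \<open>Restriction along the inclusion and its inverse\<close>

locale Ho_to_two_category = A: inverted_relative_category A \<Sigma> + two_category D
  for A :: "('o, 'a) cat" and \<Sigma> and D :: "('p, 'b, 'd) twocat" (structure)
begin

sublocale precomposition "disc A" "Ho A \<Sigma>" D "Ho_incl A \<Sigma>"
  by (intro precomposition.intro two_category_pair.intro precomposition_axioms.intro
      disc_two_category A.category_axioms A.Ho_two_category two_category_axioms A.Ho_incl_two_functor)

abbreviation "Adisc \<equiv> disc A"
abbreviation "L \<equiv> Ho A \<Sigma>"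
abbreviation "restrict_fun F \<equiv> comp_fun2 Adisc F A.i"
abbreviation "ext \<equiv> Ho_ext A \<Sigma> D"

text \<open>This is where \<open>inverts_incl\<close> enters: an arrow of \<Sigma> is an equivalence
  in \<open>Ho\<close>, and \<open>F\<close> preserves equivalences.\<close>

lemma restrict_inverting:
  assumes "two_functor L D F"
  shows "inverting_functor A \<Sigma> D (restrict_fun F)"
proof
  show "two_functor Adisc D (restrict_fun F)" by (rule comp_fun2_two_functor[OF assms])
  have "equivalence D (FArr (restrict_fun F) s)" if "s \<in> \<Sigma>" for s
    using that A.inverts_incl subsetD[OF A.Sigma_Arr that]
      two_functor_equivalence[OF A.Ho_two_category assms, of s]
    by (auto simp: inverts_def comp_fun2_simps A.Ho_incl_simps)
  then show "inverts (restrict_fun F) \<Sigma> D" by (simp add: inverts_def)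
qed

lemma restrict_simps:
  "X \<in> Obj A \<Longrightarrow> FObj (restrict_fun F) X = FObj F X"
  "f \<in> Arr A \<Longrightarrow> FArr (restrict_fun F) f = FArr F f"
  by (simp_all add: comp_fun2_simps A.Ho_incl_simps)

text \<open>By \<open>cyl_cell_s\<close>, the value of \<open>F\<close> on a cylinder 2-cell solves
  the equation characterizing \<open>hat_cyl\<close>, hence equals it. Agreement then spreads to
  homotopies by whiskering and to sequences by vertical composition.\<close>

lemma ext_restrict:
  assumes F: "two_functor L D F"
  shows "ext (restrict_fun F) = F"
proof -
  interpret R: inverting_functor A \<Sigma> D "restrict_fun F" by (rule restrict_inverting[OF F])
  note FD = two_functorD[OF F, unfolded Ho_simps]
  have cyl: "hat_cyl D (restrict_fun F) K = FCell F (A.cyl_cell K)" if K: "is_cylinder A \<Sigma> X K" for X K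
  proof (rule R.hat_cyl_eqI[OF K])
    show "IdC D (FArr (restrict_fun F) (cyl_s K)) \<star> FCell F (A.cyl_cell K) =
        IdC D (FArr (restrict_fun F) (cyl_x K))"
      using arg_cong[OF A.cyl_cell_s[OF K], of "FCell F"] A.cyl_cell_simps[OF K] A.cylinderD[OF K]
      by (simp add: FD restrict_simps A.Ho_cell_simps)
  qed (use A.cyl_cell_simps[OF K] A.cylinderD[OF K] in \<open>simp_all add: FD restrict_simps\<close>)
  have htpy: "hat_htpy D (restrict_fun F) H = FCell F (A.cell f g [H])" if H: "is_homotopy A \<Sigma> f g H" for f g H
    using A.homotopyD[OF H] A.cyl_cell_simps[OF A.homotopyD(5)[OF H]]
      A.cylinderD[OF A.homotopyD(5)[OF H]]
    by (simp add: A.homotopy_cell[OF H] hat_htpy_def cyl FD restrict_simps A.Ho_cell_simps)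
  have hseq: "hat_hseq D (restrict_fun F) Hs = FCell F (A.cell f g Hs)" if "is_hseq A \<Sigma> f g Hs" for f g Hs
    using that
  proof induction
    case (single f g H)
    then show ?case by (simp add: htpy)
  next
    case (step f g Hs k H)
    note hs = is_hseq.single[OF step(2)]
    have "FCell F (A.cell f k (H # Hs)) = FCell F (A.cell g k [H] \<bullet>\<^bsub>L\<^esub> A.cell f g Hs)"
      using A.Ho_vcomp[OF step(1) hs] by simp
    then show ?case using step hs A.hseqD[OF step(1)]
      by (simp add: R.hat_hseq_Cons FD htpy A.Ho_cell_in A.Ho_cell_boundary)
  qed
  show ?thesis
  proof (rule fun2_eqI[where P = "Obj A" and Q = "Arr A" and R = "Cell L"])
    fix c assume "c \<in> Cell L"
    then show "FCell (ext (restrict_fun F)) c = FCell F c"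
      by (auto elim!: A.Ho_cellE simp: R.Ho_ext_cell hseq)
  qed (use two_functor_extensional[OF F] two_functor_extensional[OF R.Ho_ext_two_functor] in
      \<open>simp_all add: Ho_simps R.Ho_ext_simps(1,2) restrict_simps\<close>)
qed

lemma restrict_ext:
  assumes "inverting_functor A \<Sigma> D F"
  shows "restrict_fun (ext F) = F"
proof -
  interpret R: inverting_functor A \<Sigma> D F by fact
  note FD = two_functorD[OF R.Ho_ext_two_functor, unfolded Ho_simps]
  show ?thesis
    by (rule fun2_eqI[where P = "Obj A" and Q = "Arr A" and R = "Arr A"])
      (use two_functor_extensional[OF R.two_functor] in
        \<open>simp_all add: comp_fun2_simps[where A = Adisc, simplified] A.Ho_incl_simps R.Ho_ext_simps R.F_simps FD\<close>)
qed

text \<open>The components are kept, since \<open>Ho\<close> has the objects and arrows of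
  \<open>A\<close>; only the two boundary 2-functors are replaced by their extensions.\<close>

definition ext_trans :: "('o, 'a, 'a, 'p, 'b, 'd) trans
    \<Rightarrow> ('o, 'a, 'a \<times> 'a \<times> ('o, 'a) homotopy list set, 'p, 'b, 'd) trans" where
  "ext_trans \<theta> = \<lparr>TDom = ext (TDom \<theta>), TCod = ext (TCod \<theta>), TObj = TObj \<theta>, TArr = TArr \<theta>\<rparr>"

definition ext_modif :: "('o, 'a, 'a, 'p, 'b, 'd) modif
    \<Rightarrow> ('o, 'a, 'a \<times> 'a \<times> ('o, 'a) homotopy list set, 'p, 'b, 'd) modif" where
  "ext_modif \<rho> = \<lparr>MSrc = ext_trans (MSrc \<rho>), MTrg = ext_trans (MTrg \<rho>), MObj = MObj \<rho>\<rparr>"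

text \<open>All conditions on objects and arrows are inherited. The only new one concerns 2-cells
  and is \<open>hat_hseq_natural\<close> on a representative.\<close>

lemma ext_trans_pseudonatural:
  assumes \<theta>: "pseudonatural Adisc D \<theta>"
    and i: "inverts (TDom \<theta>) \<Sigma> D" "inverts (TCod \<theta>) \<Sigma> D"
  shows "pseudonatural L D (ext_trans \<theta>)"
proof -
  interpret F: inverting_functor A \<Sigma> D "TDom \<theta>" by standard (use pseudonaturalD(1)[OF \<theta>] i in auto)
  interpret G: inverting_functor A \<Sigma> D "TCod \<theta>" by standard (use pseudonaturalD(2)[OF \<theta>] i in auto)
  note t = pseudonaturalD[OF \<theta>, unfolded disc_simps]
  show ?thesis
  proof (rule pseudonaturalI)
    fix c assume "c \<in> Cell L"
    then obtain f g Hs where c: "c = A.cell f g Hs" "is_hseq A \<Sigma> f g Hs" by (rule A.Ho_cellE)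
    show "TArr (ext_trans \<theta>) (Trg L c) \<bullet> (FCell (TCod (ext_trans \<theta>)) c \<star>
          IdC D (TObj (ext_trans \<theta>) (Dom L (Src L c)))) =
        (IdC D (TObj (ext_trans \<theta>) (Cod L (Src L c))) \<star> FCell (TDom (ext_trans \<theta>)) c) \<bullet>
          TArr (ext_trans \<theta>) (Src L c)"
      using F.hat_hseq_natural[OF \<theta> refl G.inverting_functor_axioms refl c(2)] c(2)
      by (simp add: ext_trans_def c(1) A.Ho_cell_boundary F.Ho_ext_cell G.Ho_ext_cell Ho_simps)
  qed (use t F.Ho_ext_two_functor G.Ho_ext_two_functor in
      \<open>simp_all add: ext_trans_def Ho_simps F.Ho_ext_simps(1,2) G.Ho_ext_simps(1,2)\<close>)
qed

lemma ext_whisker_trans: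
  assumes \<theta>: "pseudonatural L D \<theta>"
  shows "ext_trans (whisker_trans Adisc A.i \<theta>) = \<theta>"
  using pseudonaturalD(1-4)[OF \<theta>]
  by (intro trans_eqI[where P = "Obj A" and Q = "Arr A"])
    (simp_all add: ext_trans_def whisker_trans_simps[where A = Adisc, simplified] ext_restrict Ho_simps A.Ho_incl_simps)

lemma whisker_ext_trans:
  assumes \<theta>: "pseudonatural Adisc D \<theta>" and i: "inverts (TDom \<theta>) \<Sigma> D" "inverts (TCod \<theta>) \<Sigma> D"
  shows "whisker_trans Adisc A.i (ext_trans \<theta>) = \<theta>"
proof -
  interpret F: inverting_functor A \<Sigma> D "TDom \<theta>" by standard (use pseudonaturalD(1)[OF \<theta>] i in auto)
  interpret G: inverting_functor A \<Sigma> D "TCod \<theta>" by standard (use pseudonaturalD(2)[OF \<theta>] i in auto)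
  show ?thesis using pseudonaturalD(3,4)[OF \<theta>]
    by (intro trans_eqI[where P = "Obj A" and Q = "Arr A"])
      (simp_all add: ext_trans_def whisker_trans_simps[where A = Adisc, simplified] A.Ho_incl_simps
        restrict_ext[OF F.inverting_functor_axioms] restrict_ext[OF G.inverting_functor_axioms])
qed

lemma ext_modif_modification:
  assumes \<rho>: "modification Adisc D \<rho>"
    and i: "inverts (TDom (MSrc \<rho>)) \<Sigma> D" "inverts (TCod (MSrc \<rho>)) \<Sigma> D"
  shows "modification L D (ext_modif \<rho>)"
proof -
  note r = modificationD[OF \<rho>, unfolded disc_simps]
  interpret F: inverting_functor A \<Sigma> D "TDom (MSrc \<rho>)" by standard (use pseudonaturalD(1)[OF r(1)] i in auto)
  interpret G: inverting_functor A \<Sigma> D "TCod (MSrc \<rho>)" by standard (use pseudonaturalD(2)[OF r(1)] i in auto)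
  have p: "pseudonatural L D (ext_trans (MSrc \<rho>))" "pseudonatural L D (ext_trans (MTrg \<rho>))"
    using r i by (simp_all add: ext_trans_pseudonatural)
  show ?thesis using r(3-)
    by (intro modificationI)
      (simp_all add: ext_modif_def p, simp_all add: ext_trans_def Ho_simps F.Ho_ext_simps(1,2) G.Ho_ext_simps(1,2))
qed

text \<open>The predicates \<open>Q\<close> and \<open>Q'\<close> allow the same argument for
  pseudonatural and for 2-natural transformations. The source carries no condition on objects
  because every 2-functor on \<open>Ho\<close> restricts to one that inverts \<Sigma>.\<close>

theorem precomp_isomorphism:
  fixes Q Q'
  assumes Q: "\<And>\<theta>. pseudonatural L D \<theta> \<Longrightarrow> Q' (whisker_trans Adisc A.i \<theta>) \<longleftrightarrow> Q \<theta>"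
    and K: "two_category (sub_2cat (Hom_p L D) (\<lambda>_. True) Q)"
    and K': "two_category (sub_2cat (Hom_p Adisc D) (\<lambda>F. inverts F \<Sigma> D) Q')"
  shows "isomorphism_2cat (sub_2cat (Hom_p L D) (\<lambda>_. True) Q)
    (sub_2cat (Hom_p Adisc D) (\<lambda>F. inverts F \<Sigma> D) Q')
    (precomp Adisc A.i (sub_2cat (Hom_p L D) (\<lambda>_. True) Q))"
proof -
  let ?K = "sub_2cat (Hom_p L D) (\<lambda>_. True) Q"
  let ?K' = "sub_2cat (Hom_p Adisc D) (\<lambda>F. inverts F \<Sigma> D) Q'"
  let ?p = "precomp Adisc A.i ?K"
  have Ks: "Obj ?K = {F. two_functor L D F}" "Arr ?K = {\<theta>. pseudonatural L D \<theta> \<and> Q \<theta>}"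
    "Cell ?K = {\<rho>. modification L D \<rho> \<and> MSrc \<rho> \<in> Arr ?K \<and> MTrg \<rho> \<in> Arr ?K}"
    by (auto simp: sub_2cat_def Let_def Hom_p_sets Hom_p_ops)
  have Ks': "Obj ?K' = {F. two_functor Adisc D F \<and> inverts F \<Sigma> D}"
    "Arr ?K' = {\<theta>. pseudonatural Adisc D \<theta> \<and> inverts (TDom \<theta>) \<Sigma> D \<and> inverts (TCod \<theta>) \<Sigma> D \<and> Q' \<theta>}"
    "Cell ?K' = {\<rho>. modification Adisc D \<rho> \<and> MSrc \<rho> \<in> Arr ?K' \<and> MTrg \<rho> \<in> Arr ?K'}"
    by (auto simp: sub_2cat_def Let_def Hom_p_sets Hom_p_ops)
  have inv: "inverts (restrict_fun F) \<Sigma> D" if "two_functor L D F" for F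
    using inverting_functor.inverts[OF restrict_inverting[OF that]] .
  have I: "inverting_functor A \<Sigma> D F" if "F \<in> Obj ?K'" for F
    by standard (use that Ks' in auto)
  have p: "two_functor ?K ?K' ?p"
    by (rule precomp_two_functor[OF _ _ K]) (use Q inv in auto)
  note pD = two_functorD[OF p]
  have ps: "F \<in> Obj ?K \<Longrightarrow> FObj ?p F = restrict_fun F" "\<theta> \<in> Arr ?K \<Longrightarrow> FArr ?p \<theta> = whisker_trans Adisc A.i \<theta>"
    "\<rho> \<in> Cell ?K \<Longrightarrow> FCell ?p \<rho> = whisker_modif Adisc A.i \<rho>" for F \<theta> \<rho>
    by (simp_all add: precomp_def)
  have eA: "ext_trans \<theta> \<in> Arr ?K \<and> whisker_trans Adisc A.i (ext_trans \<theta>) = \<theta>" if "\<theta> \<in> Arr ?K'" for \<theta>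
    using that Q[of "ext_trans \<theta>"] by (simp add: Ks' Ks ext_trans_pseudonatural whisker_ext_trans)
  have eC: "ext_modif \<rho> \<in> Cell ?K \<and> whisker_modif Adisc A.i (ext_modif \<rho>) = \<rho>" if "\<rho> \<in> Cell ?K'" for \<rho>
  proof
    have r: "modification Adisc D \<rho>" "MSrc \<rho> \<in> Arr ?K'" "MTrg \<rho> \<in> Arr ?K'"
      using that Ks'(3) by auto
    then have "modification L D (ext_modif \<rho>)" by (simp add: Ks'(2) ext_modif_modification)
    then show "ext_modif \<rho> \<in> Cell ?K" unfolding Ks(3) using eA[OF r(2)] eA[OF r(3)] by (simp add: ext_modif_def)
    show "whisker_modif Adisc A.i (ext_modif \<rho>) = \<rho>"
      by (rule modif_eqI[where P = "Obj A"])
        (use eA[OF r(2)] eA[OF r(3)] modificationD(5)[OF r(1)] in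
          \<open>simp_all add: whisker_modif_simps[where A = Adisc, simplified] ext_modif_def A.Ho_incl_simps\<close>)
  qed
  show ?thesis
  proof (rule isomorphism_2catI[OF K K' p])
    show "bij_betw (FObj ?p) (Obj ?K) (Obj ?K')"
    proof (rule bij_betw_byWitness[where f' = ext])
      show "\<forall>F\<in>Obj ?K. ext (FObj ?p F) = F" by (simp add: ps) (simp add: Ks ext_restrict)
      have e: "ext F \<in> Obj ?K" if "F \<in> Obj ?K'" for F
        using inverting_functor.Ho_ext_two_functor[OF I[OF that]] by (simp add: Ks)
      then show "\<forall>F\<in>Obj ?K'. FObj ?p (ext F) = F" by (simp add: ps restrict_ext I)
      show "ext ` Obj ?K' \<subseteq> Obj ?K" using e by auto
    qed (use pD(1) in auto)
    show "bij_betw (FArr ?p) (Arr ?K) (Arr ?K')"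
    proof (rule bij_betw_byWitness[where f' = ext_trans])
      show "\<forall>\<theta>\<in>Arr ?K. ext_trans (FArr ?p \<theta>) = \<theta>" by (simp add: ps) (simp add: Ks ext_whisker_trans)
    qed (use pD(2) eA ps in auto)
    show "bij_betw (FCell ?p) (Cell ?K) (Cell ?K')"
    proof (rule bij_betw_byWitness[where f' = ext_modif])
      show "\<forall>\<rho>\<in>Cell ?K. ext_modif (FCell ?p \<rho>) = \<rho>"
      proof
        fix \<rho> assume r: "\<rho> \<in> Cell ?K"
        then have m: "modification L D \<rho>" by (simp add: Ks)
        show "ext_modif (FCell ?p \<rho>) = \<rho>" unfolding ps(3)[OF r]
          by (rule modif_eqI[where P = "Obj A"])
            (use modificationD(1,2,5)[OF m] in \<open>simp_all add: ext_modif_def ext_whisker_trans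
              whisker_modif_simps[where A = Adisc, simplified] A.Ho_incl_simps Ho_simps\<close>)
      qed
    qed (use pD(7) eC ps in auto)
  qed
qed

end

section \<open>Weak equivalences between fibrant-cofibrant objects\<close>

context relative_category
begin

text \<open>Two arrows \<open>f\<close>, \<open>g\<close> coequalized by some \<open>s \<in> \<Sigma>\<close> are homotopic through the cylinder with
  \<open>d\<^sub>0 = f\<close> and \<open>d\<^sub>1 = g\<close>, and the homotopy obtained by exchanging \<open>f\<close> and \<open>g\<close> is its inverse.\<close>

lemma coequalized_isomorphic:
  assumes s: "s \<in> \<Sigma>" and fg: "f \<in> Arr A" "g \<in> Arr A" "Dom A g = Dom A f" "Cod A f = Dom A s"
    "Cod A g = Dom A s" "s \<cdot> f = s \<cdot> g"
  shows "\<exists>c. c \<in> Cell (Ho A \<Sigma>) \<and> Src (Ho A \<Sigma>) c = f \<and> Trg (Ho A \<Sigma>) c = g \<and> invertible (Ho A \<Sigma>) c"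
proof -
  \<comment> \<open>All four choices of ends from \<open>f\<close> and \<open>g\<close> are needed:
    the two mixed ones give the mutually inverse 2-cells, the two constant ones serve to compute
    their composites.\<close>
  define K where "K a b = \<lparr>cylW = Dom A s, cylZ = Cod A s, cyl_d0 = a, cyl_d1 = b, cyl_s = s,
    cyl_x = s \<cdot> f\<rparr>" for a b
  have sA: "s \<in> Arr A" using s Sigma_Arr by blast
  have K: "is_cylinder A \<Sigma> (Dom A f) (K a b)" if "a \<in> {f, g}" "b \<in> {f, g}" for a b
    using that fg s sA by (auto simp: K_def is_cylinder_def hom_def arr_simps)
  have sel: "cyl_d0 (K a b) = a" "cyl_d1 (K a b) = b" "cyl_s (K a b) = s" "cyl_x (K a b) = s \<cdot> f" for a b
    by (simp_all add: K_def)
  have comp: "cyl_cell (K b a) \<bullet>\<^bsub>Ho A \<Sigma>\<^esub> cyl_cell (K a b) = IdC (Ho A \<Sigma>) a"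
    if ab: "a \<in> {f, g}" "b \<in> {f, g}" for a b
  proof (rule Ho_cell_eqI)
    have aA: "a \<in> Arr A" "b \<in> Arr A" "Cod A a = Dom A s" "Cod A b = Dom A s" "s \<cdot> a = s \<cdot> f"
      using ab fg by auto
    note c = cyl_cell_simps[OF K[OF ab], unfolded sel] cyl_cell_simps[OF K[OF ab(2,1)], unfolded sel]
    fix D :: "('a univ, 'a univ, 'a univ) twocat" and F assume "inverting_functor A \<Sigma> D F"
    then interpret I: inverting_functor A \<Sigma> D F .
    note e = I.hat_cyl_simps[OF K[OF ab], unfolded sel] I.hat_cyl_simps[OF K[OF ab(2,1)], unfolded sel]
    have x: "FArr F s \<cdot>\<^bsub>D\<^esub> FArr F a = FArr F (s \<cdot> f)" using I.F_simps(6)[of a s] aA sA by simp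
    have xA: "s \<cdot> f \<in> Arr A" using fg sA by (simp add: arr_simps)
    \<comment> \<open>The composite and the identity of \<open>F a\<close> both solve the equation
      of the constant cylinder \<open>K a a\<close>, so uniqueness of hat 2-cells identifies
      them.\<close>
    have "hat_cyl D F (K a a) = hat_cyl D F (K b a) \<bullet>\<^bsub>D\<^esub> hat_cyl D F (K a b)"
      by (rule I.hat_cyl_eqI[OF K[OF ab(1,1)]])
        (use e aA sA xA in \<open>simp_all add: sel I.F_simps I.cell_simps I.whisker_left_vcomp\<close>)
    moreover have "hat_cyl D F (K a a) = IdC D (FArr F a)"
      by (rule I.hat_cyl_eqI[OF K[OF ab(1,1)]]) (use aA sA x in \<open>simp_all add: sel I.F_simps I.cell_simps\<close>)
    ultimately show "FCell (Ho_ext A \<Sigma> D F) (cyl_cell (K b a) \<bullet>\<^bsub>Ho A \<Sigma>\<^esub> cyl_cell (K a b)) =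
        FCell (Ho_ext A \<Sigma> D F) (IdC (Ho A \<Sigma>) a)"
      using c aA by (simp add: I.Ho_ext_simps Ho_ext_cyl_cell[OF K[OF ab] I.inverting_functor_axioms]
          Ho_ext_cyl_cell[OF K[OF ab(2,1)] I.inverting_functor_axioms])
  qed (use cyl_cell_simps[OF K[OF ab], unfolded sel] cyl_cell_simps[OF K[OF ab(2,1)], unfolded sel]
      ab fg in \<open>auto simp: Ho_cell_simps Ho_vcomp_simps\<close>)
  have "invertible (Ho A \<Sigma>) (cyl_cell (K f g))"
    by (rule invertibleI[of _ _ "cyl_cell (K g f)"])
      (use cyl_cell_simps[OF K[of f g], unfolded sel] cyl_cell_simps[OF K[of g f], unfolded sel]
        comp[of f g] comp[of g f] in simp_all)
  then show ?thesis using cyl_cell_simps[OF K[of f g], unfolded sel] by (intro exI[of _ "cyl_cell (K f g)"]) simp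
qed

lemma section_equivalence:
  assumes s: "s \<in> \<Sigma>" and t: "t \<in> Arr A" "Dom A t = Cod A s" "Cod A t = Dom A s"
    "s \<cdot> t = Ide A (Cod A s)"
  shows "equivalence (Ho A \<Sigma>) s"
proof -
  have sA: "s \<in> Arr A" using s Sigma_Arr by blast
  have "s \<cdot> (t \<cdot> s) = s" using comp_assoc_arr[of s t s] sA t by (simp add: arr_simps)
  then obtain \<eta> where "\<eta> \<in> Cell (Ho A \<Sigma>)" "Src (Ho A \<Sigma>) \<eta> = Ide A (Dom A s)"
    "Trg (Ho A \<Sigma>) \<eta> = t \<cdot> s" "invertible (Ho A \<Sigma>) \<eta>"
    using coequalized_isomorphic[OF s, of "Ide A (Dom A s)" "t \<cdot> s"] sA t by (auto simp: arr_simps)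
  then show ?thesis using sA t
    by (intro equivalenceI[of _ _ t \<eta> "IdC (Ho A \<Sigma>) (Ide A (Cod A s))"])
      (simp_all add: Ho_simps Ho_cell_simps arr_simps Ho.invertible_idc)
qed

text \<open>Here the retraction \<open>r\<close> is the map required in \<Sigma>: it coequalizes
  \<open>s \<cdot> r\<close> and the identity, which gives the invertible counit, while the unit is
  an identity 2-cell.\<close>

lemma retraction_equivalence:
  assumes r: "r \<in> \<Sigma>" and s: "s \<in> Arr A" "Dom A r = Cod A s" "Cod A r = Dom A s"
    "r \<cdot> s = Ide A (Dom A s)"
  shows "equivalence (Ho A \<Sigma>) s"
proof -
  have rA: "r \<in> Arr A" using r Sigma_Arr by blast
  have "r \<cdot> (s \<cdot> r) = r" using comp_assoc_arr[of r s r] rA s by (simp add: arr_simps)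
  then obtain \<epsilon> where "\<epsilon> \<in> Cell (Ho A \<Sigma>)" "Src (Ho A \<Sigma>) \<epsilon> = s \<cdot> r"
    "Trg (Ho A \<Sigma>) \<epsilon> = Ide A (Cod A s)" "invertible (Ho A \<Sigma>) \<epsilon>"
    using coequalized_isomorphic[OF r, of "s \<cdot> r" "Ide A (Cod A s)"] rA s by (auto simp: arr_simps)
  then show ?thesis using rA s
    by (intro equivalenceI[of _ _ r "IdC (Ho A \<Sigma>) (Ide A (Dom A s))" \<epsilon>])
      (simp_all add: Ho_simps Ho_cell_simps arr_simps Ho.invertible_idc)
qed

end

section \<open>Fibrant-cofibrant objects of a model category\<close>

lemma full_subcat_simps:
  "Obj (full_subcat C S) = Obj C \<inter> S"
  "Arr (full_subcat C S) = {f \<in> Arr C. Dom C f \<in> S \<and> Cod C f \<in> S}"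
  "Dom (full_subcat C S) = Dom C" "Cod (full_subcat C S) = Cod C" "Ide (full_subcat C S) = Ide C"
  "Comp (full_subcat C S) = Comp C"
  by (simp_all add: full_subcat_def)

lemma full_subcat_category:
  assumes "category C"
  shows "category (full_subcat C S)"
proof -
  interpret category C by fact
  show ?thesis by standard (auto simp: full_subcat_simps hom_def arr_simps)
qed

context model_category
begin

lemma W_Ide: "X \<in> Obj C \<Longrightarrow> Ide C X \<in> W"
  and W_Arr: "W \<subseteq> Arr C" and Fib_Arr: "Fib \<subseteq> Arr C" and Cof_Arr: "Cof \<subseteq> Arr C"
  and Fib_comp: "\<lbrakk>f \<in> Fib; g \<in> Fib; Dom C g = Cod C f\<rbrakk> \<Longrightarrow> g \<cdot> f \<in> Fib"
  and Cof_comp: "\<lbrakk>f \<in> Cof; g \<in> Cof; Dom C g = Cod C f\<rbrakk> \<Longrightarrow> g \<cdot> f \<in> Cof"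
  using classes unfolding wide_retract_closed_def by auto

lemma fibrant_Fib:
  assumes "fibrant C Fib Y" "p \<in> Fib" "Cod C p = Y"
  shows "fibrant C Fib (Dom C p)"
proof -
  obtain T q where T: "terminal C T" "q \<in> Fib" "q \<in> Arr C" "Dom C q = Y" "Cod C q = T"
    using assms(1) unfolding fibrant_def hom_def by auto
  moreover have "p \<in> Arr C" using assms(2) Fib_Arr by blast
  ultimately show ?thesis unfolding fibrant_def using assms Fib_comp[of p q]
    by (intro conjI exI[of _ T] bexI[of _ "q \<cdot> p"]) (auto simp: hom_def arr_simps)
qed

lemma cofibrant_Cof:
  assumes "cofibrant C Cof X" "j \<in> Cof" "Dom C j = X"
  shows "cofibrant C Cof (Cod C j)"
proof -
  obtain I q where I: "initial C I" "q \<in> Cof" "q \<in> Arr C" "Dom C q = I" "Cod C q = X"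
    using assms(1) unfolding cofibrant_def hom_def by auto
  moreover have "j \<in> Arr C" using assms(2) Cof_Arr by blast
  ultimately show ?thesis unfolding cofibrant_def using assms Cof_comp[of q j]
    by (intro conjI exI[of _ I] bexI[of _ "j \<cdot> q"]) (auto simp: hom_def arr_simps)
qed

text \<open>A section is a lift of the identity of the codomain in the square from the cofibration
  out of an initial object to \<open>p\<close>; initiality makes the square commute.\<close>

lemma trivial_fibration_section:
  assumes "cofibrant C Cof (Cod C p)" "p \<in> Fib \<inter> W"
  obtains t where "t \<in> Arr C" "Dom C t = Cod C p" "Cod C t = Dom C p" "p \<cdot> t = Ide C (Cod C p)"
proof -
  obtain I u where u: "initial C I" "u \<in> Cof" "u \<in> Arr C" "Dom C u = I" "Cod C u = Cod C p"
    using assms(1) unfolding cofibrant_def hom_def by auto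
  have p: "p \<in> Arr C" using assms(2) Fib_Arr by blast
  obtain v where v: "v \<in> hom C I (Dom C p)"
    using u(1) dom_closed[OF p] unfolding initial_def by blast
  have "p \<cdot> v \<in> hom C I (Cod C p)" "Ide C (Cod C p) \<cdot> u \<in> hom C I (Cod C p)"
    using u v p by (auto simp: hom_def arr_simps)
  then have "p \<cdot> v = Ide C (Cod C p) \<cdot> u"
    using u(1) cod_closed[OF p] unfolding initial_def by blast
  moreover have "Ide C (Cod C p) \<in> hom C (Cod C p) (Cod C p)" using p by (simp add: hom_def arr_simps)
  ultimately obtain d where "d \<in> hom C (Cod C p) (Dom C p)" "p \<cdot> d = Ide C (Cod C p)"
    using lift_cof_tfib[OF u(2) assms(2)] u v unfolding has_lifting_def by auto
  then show ?thesis using that unfolding hom_def by auto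
qed

text \<open>A retraction is a lift of the identity of the domain in the square from \<open>j\<close>
  to the fibration onto a terminal object; terminality makes the square commute.\<close>

lemma trivial_cofibration_retraction:
  assumes "fibrant C Fib (Dom C j)" "j \<in> Cof \<inter> W"
  obtains r where "r \<in> Arr C" "Dom C r = Cod C j" "Cod C r = Dom C j" "r \<cdot> j = Ide C (Dom C j)"
proof -
  obtain T q where q: "terminal C T" "q \<in> Fib" "q \<in> Arr C" "Dom C q = Dom C j" "Cod C q = T"
    using assms(1) unfolding fibrant_def hom_def by auto
  have j: "j \<in> Arr C" using assms(2) Cof_Arr by blast
  obtain v where v: "v \<in> hom C (Cod C j) T"
    using q(1) cod_closed[OF j] unfolding terminal_def by blast
  have "q \<cdot> Ide C (Dom C j) \<in> hom C (Dom C j) T" "v \<cdot> j \<in> hom C (Dom C j) T"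
    using q v j by (auto simp: hom_def arr_simps)
  then have "q \<cdot> Ide C (Dom C j) = v \<cdot> j"
    using q(1) dom_closed[OF j] unfolding terminal_def by blast
  moreover have "Ide C (Dom C j) \<in> hom C (Dom C j) (Dom C j)" using j by (simp add: hom_def arr_simps)
  ultimately obtain d where "d \<in> hom C (Cod C j) (Dom C j)" "d \<cdot> j = Ide C (Dom C j)"
    using lift_tcof_fib[OF assms(2) q(2)] q v unfolding has_lifting_def by auto
  then show ?thesis using that unfolding hom_def by auto
qed

lemma fc_simps:
  "Obj (fc C Fib Cof) = {X. fibrant C Fib X \<and> cofibrant C Cof X}"
  "Arr (fc C Fib Cof) = {f \<in> Arr C. fibrant C Fib (Dom C f) \<and> cofibrant C Cof (Dom C f) \<and>
    fibrant C Fib (Cod C f) \<and> cofibrant C Cof (Cod C f)}"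
  "Dom (fc C Fib Cof) = Dom C" "Cod (fc C Fib Cof) = Cod C" "Ide (fc C Fib Cof) = Ide C"
  "Comp (fc C Fib Cof) = Comp C"
  by (auto simp: fc_def full_subcat_simps fibrant_def)

lemma fc_relative_category: "relative_category (fc C Fib Cof) (W \<inter> Arr (fc C Fib Cof))"
proof -
  interpret fc: category "fc C Fib Cof"
    unfolding fc_def by (rule full_subcat_category[OF category_axioms])
  show ?thesis
  proof
    fix X assume X: "X \<in> Obj (fc C Fib Cof)"
    then have "X \<in> Obj C" by (simp add: fc_simps fibrant_def)
    then show "Ide (fc C Fib Cof) X \<in> W \<inter> Arr (fc C Fib Cof)"
      using fc.ide_simps(1)[OF X] W_Ide by (simp add: fc_simps(5))
  qed blast
qed

text \<open>Factor a weak equivalence as a trivial cofibration \<open>j\<close> followed by a trivial fibration \<open>p\<close>;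
  the middle object is again fibrant and cofibrant, so that \<open>j\<close> has a retraction and \<open>p\<close> a section.\<close>

lemma fc_inverted_relative_category:
  "inverted_relative_category (fc C Fib Cof) (W \<inter> Arr (fc C Fib Cof))"
proof -
  let ?A = "fc C Fib Cof" and ?S = "W \<inter> Arr (fc C Fib Cof)"
  interpret A: relative_category ?A ?S by (rule fc_relative_category)
  have "equivalence (Ho ?A ?S) f" if f: "f \<in> ?S" for f
  proof -
    have fA: "f \<in> Arr C" "f \<in> W" using f W_Arr by auto
    obtain j p where jp: "j \<in> Cof \<inter> W" "p \<in> Fib" "Dom C p = Cod C j" "f = p \<cdot> j"
      using factor_tcof_fib[OF fA(1)] by auto
    have a: "j \<in> Arr C" "p \<in> Arr C" using jp Cof_Arr Fib_Arr by auto
    have pW: "p \<in> W" using two_of_three[OF a jp(3)] jp(1) fA(2) unfolding jp(4) by blast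
    have d: "Dom C f = Dom C j" "Cod C f = Cod C p" unfolding jp(4) using a jp(3) by (simp_all add: arr_simps)
    have fc: "fibrant C Fib (Cod C j)" "cofibrant C Cof (Cod C j)" "fibrant C Fib (Dom C j)"
      "cofibrant C Cof (Dom C j)" "fibrant C Fib (Cod C p)" "cofibrant C Cof (Cod C p)"
      using f d jp(1-3) fibrant_Fib[of "Cod C p" p] cofibrant_Cof[of "Dom C j" j]
      by (auto simp: fc_simps)
    obtain t where t: "t \<in> Arr C" "Dom C t = Cod C p" "Cod C t = Dom C p" "p \<cdot> t = Ide C (Cod C p)"
      by (rule trivial_fibration_section[OF fc(6)]) (use jp pW in auto)
    obtain r where r: "r \<in> Arr C" "Dom C r = Cod C j" "Cod C r = Dom C j" "r \<cdot> j = Ide C (Dom C j)"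
      by (rule trivial_cofibration_retraction[OF fc(3) jp(1)])
    \<comment> \<open>\<open>retraction_equivalence\<close> uses \<open>r\<close> as a member of
      \<Sigma>; it is a weak equivalence by 3-for-2, since \<open>j\<close> and
      \<open>r \<cdot> j\<close>, an identity, are.\<close>
    have "r \<in> W" using two_of_three[OF a(1) r(1,2)] jp(1) r(4) W_Ide[OF dom_closed[OF a(1)]] by auto
    then have "equivalence (Ho ?A ?S) j" "equivalence (Ho ?A ?S) p"
      using A.retraction_equivalence[of r j] A.section_equivalence[of p t] r t fc a jp(1-3) pW
      by (simp_all add: fc_simps)
    then show ?thesis using A.Ho.equivalence_comp[of j p] jp(3,4) by (simp add: Ho_simps fc_simps)
  qed
  then have "inverts (Ho_incl ?A ?S) ?S (Ho ?A ?S)" by (auto simp: inverts_def A.Ho_incl_simps)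
  then show ?thesis by unfold_locales
qed

end

text \<open>Lets \<open>Hom_p\<close> itself appear as the source in
  \<open>precomp_isomorphism\<close>.\<close>

lemma sub_2cat_True:
  assumes "two_category K"
  shows "sub_2cat K (\<lambda>_. True) (\<lambda>_. True) = K"
proof -
  interpret two_category K by fact
  show ?thesis by (auto simp: sub_2cat_def Let_def cell_boundary intro!: twocat.equality)
qed

section \<open>The strict and the pseudo case of the universal property\<close>

context Ho_to_two_category
begin

lemma Hom_p_precomp_isomorphism:
  "isomorphism_2cat (Hom_p L D) (Hom_p_plus Adisc \<Sigma> D) (precomp Adisc A.i (Hom_p L D))"
proof -
  interpret P: two_category_pair Adisc D
    by (intro two_category_pair.intro A.two_category_axioms two_category_axioms)
  show ?thesis
    using precomp_isomorphism[of "\<lambda>_. True" "\<lambda>_. True"] sub_2cat_two_category[OF P.Hom_p_two_category]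
    by (simp add: Hom_p_plus_def sub_2cat_True Hom_p_two_category)
qed

text \<open>The inclusion is the identity on objects and arrows, so both conditions say the same
  about the same components.\<close>

lemma two_natural_whisker:
  assumes "pseudonatural L D \<theta>"
  shows "two_natural Adisc D (whisker_trans Adisc A.i \<theta>) \<longleftrightarrow> two_natural L D \<theta>"
proof -
  have "TArr (whisker_trans Adisc A.i \<theta>) f = TArr \<theta> f"
    "FArr (TCod (whisker_trans Adisc A.i \<theta>)) f \<cdot> TObj (whisker_trans Adisc A.i \<theta>) (Dom A f) =
      FArr (TCod \<theta>) f \<cdot> TObj \<theta> (Dom A f)" if "f \<in> Arr A" for f
    using that A.dom_closed[of f] by (simp_all add: whisker_trans_simps restrict_simps A.Ho_incl_simps)
  then show ?thesis using assms by (simp add: two_natural_def whisker_trans_pseudonatural Ho_simps)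
qed

lemma Hom_s_precomp_isomorphism:
  "isomorphism_2cat (Hom_s L D) (Hom_s_plus Adisc \<Sigma> D) (precomp Adisc A.i (Hom_s L D))"
proof -
  interpret P: two_category_pair Adisc D
    by (intro two_category_pair.intro A.two_category_axioms two_category_axioms)
  have "two_category (sub_2cat (Hom_p L D) (\<lambda>_. True) (two_natural L D))"
    by (rule sub_2cat_two_category[OF Hom_p_two_category])
      (simp_all add: Hom_p_sets Hom_p_ops two_natural_Ide two_natural_comp)
  moreover have "two_category (sub_2cat (Hom_p Adisc D) (\<lambda>F. inverts F \<Sigma> D) (two_natural Adisc D))"
    by (rule sub_2cat_two_category[OF P.Hom_p_two_category])
      (simp_all add: Hom_p_sets Hom_p_ops P.two_natural_Ide P.two_natural_comp)
  ultimately show ?thesis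
    using precomp_isomorphism[of "two_natural Adisc D" "two_natural L D"]
    by (simp add: Hom_s_def Hom_s_plus_def sub_2cat_sub_2cat two_natural_whisker)
qed

lemma Hom_p_precomp_pseudoequivalence:
  "pseudoequivalence_strict (Hom_p L D) (Hom_p_plus Adisc \<Sigma> D) (precomp Adisc A.i (Hom_p L D))"
proof -
  interpret P: two_category_pair Adisc D
    by (intro two_category_pair.intro A.two_category_axioms two_category_axioms)
  have "two_category (Hom_p_plus Adisc \<Sigma> D)"
    unfolding Hom_p_plus_def by (rule sub_2cat_two_category[OF P.Hom_p_two_category]) simp_all
  then show ?thesis
    by (intro isomorphism_2cat_imp_pseudoequivalence_strict Hom_p_two_category Hom_p_precomp_isomorphism)
qed

end

theorem theorem3p3:
  fixes C :: "('o, 'a) cat" and W Fib Cof :: "'a set"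
  assumes "model_category C W Fib Cof"
  defines "Cfc \<equiv> fc C Fib Cof"
  defines "Wfc \<equiv> W \<inter> Arr Cfc"
  defines "i \<equiv> Ho_incl Cfc Wfc"
  shows "two_localization_strict TYPE(('x, 'y, 'z) twocat) (disc Cfc) Wfc (Ho Cfc Wfc) i \<and>
    (\<forall>D :: ('x, 'y, 'z) twocat. two_category D \<longrightarrow>
       isomorphism_2cat (Hom_s (Ho Cfc Wfc) D) (Hom_s_plus (disc Cfc) Wfc D)
         (precomp (disc Cfc) i (Hom_s (Ho Cfc Wfc) D)) \<and>
       isomorphism_2cat (Hom_p (Ho Cfc Wfc) D) (Hom_p_plus (disc Cfc) Wfc D)
         (precomp (disc Cfc) i (Hom_p (Ho Cfc Wfc) D)))"
proof -
  interpret A: inverted_relative_category Cfc Wfc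
    unfolding Cfc_def Wfc_def by (rule model_category.fc_inverted_relative_category[OF assms(1)])
  have "Ho_to_two_category Cfc Wfc D" if "two_category D" for D :: "('x, 'y, 'z) twocat"
    by (intro Ho_to_two_category.intro A.inverted_relative_category_axioms that)
  note H = Ho_to_two_category.Hom_p_precomp_isomorphism[OF this, folded i_def]
    Ho_to_two_category.Hom_s_precomp_isomorphism[OF this, folded i_def]
    Ho_to_two_category.Hom_p_precomp_pseudoequivalence[OF this, folded i_def]
  show ?thesis unfolding two_localization_strict_def
    using H A.Ho_two_category A.Ho_incl_two_functor A.inverts_incl by (simp add: i_def)
qed

end
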